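(* Let $K$ be a field of characteristic zero, $R=K[x,y,z]$, $s\ge 3$, and let $I=(L_1^{a_1},\dots,L_s^{a_s})$, where $L_1,\dots,L_s$ are general linear forms and $a_1,\dots,a_s$ are positive integers. Set $$p=\max\Big\{j\;\Big|\;\sum_{a_i\le j}(j+1-a_i)\le j\Big\},$$ and let $L$ be a general linear form. Then there exists an integer $j$ for which $\times L^3:[R/I]_{j-3}\to[R/I]_j$ fails to have maximal rank if and only if $$\#\{i\mid a_i\le p+1\}=p+2-\sum_{a_i\le p}(p+1-a_i)\ \ge 4,$$ this number is even, and no $a_i$ equals $p+2$. Moreover, in this case maximal rank fails in exactly one degree, namely $j=p+2$; in that degree $\dim[R/I]_{p-1}=\dim[R/I]_{p+2}$ and the cokernel of $\times L^3:[R/I]_{p-1}\to[R/I]_{p+2}$ has dimension $1$.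
   Context: A map has maximal rank if it is injective or surjective. A sum over an empty index set is zero. "General" means in a suitable nonempty Zariski open set. *)

theory Defs
  imports Complex_Main "HOL-Library.Poly_Mapping"
begin

text \<open>Polynomials over the field 'k in the variables indexed by nat, represented
as finitely supported maps from monomials (exponent vectors) to coefficients.
The ring R = K[x,y,z] consists of those polynomials only involving the
variables 0, 1, 2.\<close>

type_synonym 'k mpoly = "(nat \<Rightarrow>\<^sub>0 nat) \<Rightarrow>\<^sub>0 'k"

definition mdeg :: "(nat \<Rightarrow>\<^sub>0 nat) \<Rightarrow> nat" where
  "mdeg m = (\<Sum>v\<in>Poly_Mapping.keys m. Poly_Mapping.lookup m v)"

definition smult :: "'k::field \<Rightarrow> 'k mpoly \<Rightarrow> 'k mpoly" where
  "smult c f = Poly_Mapping.single 0 c * f"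

text \<open>Homogeneous component [R]_d of R = K[x,y,z] (d an integer; zero for d < 0).\<close>
definition homR :: "int \<Rightarrow> ('k::field) mpoly set" where
  "homR d = {f. \<forall>m\<in>Poly_Mapping.keys f. Poly_Mapping.keys m \<subseteq> {0,1,2} \<and> int (mdeg m) = d}"

definition linform :: "(nat \<Rightarrow> 'k::field) \<Rightarrow> 'k mpoly" where
  "linform c = (\<Sum>k<3. Poly_Mapping.single (Poly_Mapping.single k 1) (c k))"

text \<open>Degree j component of the ideal generated by the homogeneous forms G i,
  i < s, where G i has degree e i.\<close>
definition idealdeg :: "nat \<Rightarrow> (nat \<Rightarrow> 'k::field mpoly) \<Rightarrow> (nat \<Rightarrow> nat) \<Rightarrow> int \<Rightarrow> 'k mpoly set" where
  "idealdeg s G e j = {f. \<exists>g. (\<forall>i<s. g i \<in> homR (j - int (e i))) \<and> f = (\<Sum>i<s. G i * g i)}"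

definition kdim :: "'k::field mpoly set \<Rightarrow> nat" where
  "kdim S = vector_space.dim smult S"

definition quotdim :: "nat \<Rightarrow> (nat \<Rightarrow> 'k::field mpoly) \<Rightarrow> (nat \<Rightarrow> nat) \<Rightarrow> int \<Rightarrow> nat" where
  "quotdim s G e j = kdim (homR j :: 'k mpoly set) - kdim (idealdeg s G e j)"

text \<open>The map \<times>F : [R/I]_{j-k} \<rightarrow> [R/I]_j (F of degree k) is injective.\<close>
definition mult_inj :: "nat \<Rightarrow> (nat \<Rightarrow> 'k::field mpoly) \<Rightarrow> (nat \<Rightarrow> nat) \<Rightarrow> 'k mpoly \<Rightarrow> nat \<Rightarrow> int \<Rightarrow> bool" where
  "mult_inj s G e F k j \<longleftrightarrow>
     (\<forall>g\<in>homR (j - int k). F * g \<in> idealdeg s G e j \<longrightarrow> g \<in> idealdeg s G e (j - int k))"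

definition image_plus_ideal :: "nat \<Rightarrow> (nat \<Rightarrow> 'k::field mpoly) \<Rightarrow> (nat \<Rightarrow> nat) \<Rightarrow> 'k mpoly \<Rightarrow> nat \<Rightarrow> int \<Rightarrow> 'k mpoly set" where
  "image_plus_ideal s G e F k j = {h + F * g | h g. h \<in> idealdeg s G e j \<and> g \<in> homR (j - int k)}"

definition mult_surj :: "nat \<Rightarrow> (nat \<Rightarrow> 'k::field mpoly) \<Rightarrow> (nat \<Rightarrow> nat) \<Rightarrow> 'k mpoly \<Rightarrow> nat \<Rightarrow> int \<Rightarrow> bool" where
  "mult_surj s G e F k j \<longleftrightarrow> homR j \<subseteq> image_plus_ideal s G e F k j"

definition max_rank :: "nat \<Rightarrow> (nat \<Rightarrow> 'k::field mpoly) \<Rightarrow> (nat \<Rightarrow> nat) \<Rightarrow> 'k mpoly \<Rightarrow> nat \<Rightarrow> int \<Rightarrow> bool" where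
  "max_rank s G e F k j \<longleftrightarrow> mult_inj s G e F k j \<or> mult_surj s G e F k j"

definition coker_dim :: "nat \<Rightarrow> (nat \<Rightarrow> 'k::field mpoly) \<Rightarrow> (nat \<Rightarrow> nat) \<Rightarrow> 'k mpoly \<Rightarrow> nat \<Rightarrow> int \<Rightarrow> nat" where
  "coker_dim s G e F k j = kdim (homR j :: 'k mpoly set) - kdim (image_plus_ideal s G e F k j)"

definition mpeval :: "'k::field mpoly \<Rightarrow> (nat \<Rightarrow> 'k) \<Rightarrow> 'k" where
  "mpeval P t = (\<Sum>m\<in>Poly_Mapping.keys P. Poly_Mapping.lookup P m * (\<Prod>v\<in>Poly_Mapping.keys m. t v ^ Poly_Mapping.lookup m v))"

text \<open>A property holds for general points of K^n (coordinates t 0, ..., t (n-1)):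
  it holds on a nonempty Zariski open set, i.e. on the non-vanishing locus of some
  nonzero polynomial in the variables 0..n-1 (every nonempty Zariski open set
  contains such a basic open set).\<close>
definition general :: "nat \<Rightarrow> ((nat \<Rightarrow> 'k::field) \<Rightarrow> bool) \<Rightarrow> bool" where
  "general n Q \<longleftrightarrow> (\<exists>P :: 'k mpoly. P \<noteq> 0 \<and> (\<forall>m\<in>Poly_Mapping.keys P. Poly_Mapping.keys m \<subseteq> {..<n}) \<and>
      (\<forall>t. mpeval P t \<noteq> 0 \<longrightarrow> Q t))"

definition pnum :: "nat \<Rightarrow> (nat \<Rightarrow> nat) \<Rightarrow> nat" where
  "pnum s a = (GREATEST j. (\<Sum>i\<in>{i. i < s \<and> a i \<le> j}. (j + 1 - a i)) \<le> j)"

end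

theory Submission
  imports Defs "HOL-Computational_Algebra.Polynomial"
begin

text \<open>By semicontinuity every lower bound for the dimension of a graded piece of (L_1^a_1, ..., L_s^a_s, L^k)
  holds for general linear forms as soon as it holds for one choice of them. So take L = z and L_i = x + u_i y + c_i z
  with distinct u_i and c_i \<in> {0, 1}: a functional on R_j killing the ideal and z^3 R_(j-3) is a triple of univariate
  polynomials, and in the basis (1-z)^2, z(1-z), z^2 its vanishing conditions decouple. This bounds the dimensions of
  R/(I, L) and R/(I, L^3), which gives maximal rank outside degree p + 2 and a cokernel of dimension at most one in
  degree p + 2. In the critical case the cokernel is dual to a double curve, multiplied by lines, and so is nonzero.
  It remains to see that R/I then has the expected dimension in degree p + 2, that is, that there are no syzygies in
  that degree. For an odd number of forms this follows from the dimension bounds; one further general form M is added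
  and the degree of its coefficient is raised step by step, by differentiating syzygies in directions killing M.\<close>

text \<open>Only lower bounds on ideal pieces are open conditions; matching upper bounds come from
  counting generators, and equality means that there are no syzygies. The integer \<open>p\<close>
  is the turning point for multiplication by L: up to degree \<open>p\<close> the count makes L
  injective, from \<open>p + 1\<close> on it is surjective. Composing three such steps settles every
  degree except \<open>p + 1\<close> and \<open>p + 2\<close>. The number in the theorem comes from
  plane curves. A functional on R_j killing I and L^3 is a curve of degree j with a (j-2)-fold point
  at L and multiplicity j + 1 - a_i at L_i. The line joining L and L_i splits off j - 1 - a_i times
  and leaves a double point. For j = \<open>p + 2\<close> the residual degree is \<delta> + 1, which
  is p + 2 minus the sum in the theorem, and there are \<open>N\<close> double points. The obstacle
  is the critical case: the cokernel bound 1 determines dim I_(p+2) only up to one, and a single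
  syzygy would make L^3 injective again. This does happen for N = 2, where the Koszul relation is
  that syzygy. With one form omitted the number is odd, no double curve survives and the count is
  sharp.\<close>

abbreviation "lookup \<equiv> Poly_Mapping.lookup"
abbreviation "keys \<equiv> Poly_Mapping.keys"
abbreviation "single \<equiv> Poly_Mapping.single"

abbreviation msmult :: "'k::field \<Rightarrow> 'k mpoly \<Rightarrow> 'k mpoly" where "msmult \<equiv> Defs.smult"

lemma lookup_msmult: "lookup (msmult c f) m = c * lookup f m"
  unfolding Defs.smult_def mult_map_scale_conv_mult[symmetric]
  by (simp add: Poly_Mapping.map.rep_eq when_def)

interpretation mp: vector_space "msmult :: 'k::field \<Rightarrow> 'k mpoly \<Rightarrow> 'k mpoly"
  by unfold_locales (auto intro!: poly_mapping_eqI simp: lookup_msmult lookup_add algebra_simps)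

interpretation mpk: vector_space_pair "msmult :: 'k::field \<Rightarrow> 'k mpoly \<Rightarrow> 'k mpoly" "(*) :: 'k \<Rightarrow> 'k \<Rightarrow> 'k"
  by unfold_locales (auto simp: algebra_simps)

abbreviation functional :: "('k::field mpoly \<Rightarrow> 'k) \<Rightarrow> bool" where
  "functional \<equiv> Vector_Spaces.linear msmult (*)"

lemma kdim_eq: "kdim S = mp.dim S"
  by (simp add: kdim_def)

lemma mult_msmult: "F * msmult c g = msmult c (F * g)" "msmult c g * F = msmult c (g * F)"
  by (simp_all add: Defs.smult_def algebra_simps)

lemma keys_msmult: "keys (msmult c f) \<subseteq> keys f"
  by (auto simp: in_keys_iff lookup_msmult)

lemma mpoly_sum_monomials:
  fixes f :: "'k::field mpoly"
  assumes "finite A" "keys f \<subseteq> A"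
  shows "f = (\<Sum>m\<in>A. msmult (lookup f m) (single m 1))"
proof (rule poly_mapping_eqI)
  fix k
  have "(\<Sum>m\<in>A. lookup f m * (1 when m = k)) = (\<Sum>m\<in>A. if m = k then lookup f k else 0)"
    by (intro sum.cong) (auto simp: when_def)
  also have "\<dots> = lookup f k"
    using assms by (auto simp: in_keys_iff)
  finally show "lookup f k = lookup (\<Sum>m\<in>A. msmult (lookup f m) (single m 1)) k"
    by (simp add: lookup_sum lookup_msmult lookup_single)
qed

subsection \<open>Dimension counts\<close>

text \<open>\<open>kdim\<close> is the cardinality of a basis, hence 0 for an infinite one, so
  monotonicity and all counts below need this hypothesis.\<close>

definition findim :: "'k::field mpoly set \<Rightarrow> bool" where
  "findim V \<longleftrightarrow> (\<exists>B. finite B \<and> V \<subseteq> mp.span B)"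

text \<open>The same set arises when a generator \<open>F\<close> is added to an ideal piece
  \<open>V\<close> and when the image of multiplication by \<open>F\<close> modulo \<open>V\<close>
  is pulled back, so one construction serves both purposes.\<close>

definition sumF :: "'k::field mpoly set \<Rightarrow> 'k mpoly \<Rightarrow> 'k mpoly set \<Rightarrow> 'k mpoly set" where
  "sumF V F R = {h + F * g | h g. h \<in> V \<and> g \<in> R}"

lemma findim_subset: "findim W \<Longrightarrow> V \<subseteq> W \<Longrightarrow> findim V"
  by (auto simp: findim_def)

lemma findim_finite_indep: assumes "findim W" "mp.independent B" "B \<subseteq> W" shows "finite B"
  using assms mp.independent_span_bound[of _ B] unfolding findim_def by fastforce

lemma findim_basis:
  assumes "findim V"
  obtains B where "B \<subseteq> V" "finite B" "mp.independent B" "V \<subseteq> mp.span B" "card B = kdim V"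
proof -
  obtain B where B: "B \<subseteq> V" "mp.independent B" "V \<subseteq> mp.span B" "card B = mp.dim V"
    using mp.basis_exists by blast
  then show ?thesis using that findim_finite_indep[OF assms] by (auto simp: kdim_eq)
qed

lemma kdim_mono: assumes "V \<subseteq> W" "findim W" shows "kdim V \<le> kdim W"
proof -
  obtain B where B: "finite B" "W \<subseteq> mp.span B" "card B = kdim W"
    using findim_basis[OF assms(2)] by metis
  then show ?thesis using mp.dim_le_card[of V B] assms by (auto simp: kdim_eq)
qed

lemma extend_basis:
  assumes "findim W" "mp.subspace V" "V \<subseteq> W"
  obtains B C where "B \<subseteq> C" "finite C" "mp.independent C" "B \<subseteq> V" "C \<subseteq> W" "V = mp.span B" "W \<subseteq> mp.span C"
    "card B = kdim V" "card C = kdim W"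
proof -
  obtain B where B: "B \<subseteq> V" "finite B" "mp.independent B" "V \<subseteq> mp.span B" "card B = kdim V"
    using findim_basis[OF findim_subset[OF assms(1,3)]] by blast
  obtain C where C: "B \<subseteq> C" "C \<subseteq> W" "mp.independent C" "W \<subseteq> mp.span C"
    using mp.maximal_independent_subset_extend[of B W] B assms by blast
  have "finite C" using findim_finite_indep assms C by blast
  moreover have "card C = kdim W"
    using mp.basis_card_eq_dim[of C W] C by (simp add: kdim_eq)
  moreover have "V = mp.span B"
    using B assms(2) mp.span_minimal by blast
  ultimately show ?thesis using that B C by blast
qed

lemma kdim_subspace_eq:
  assumes "findim W" "mp.subspace V" "V \<subseteq> W" "kdim W \<le> kdim V" shows "V = W"
proof -
  obtain B C where BC: "B \<subseteq> C" "finite C" "V = mp.span B" "W \<subseteq> mp.span C"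
    "card B = kdim V" "card C = kdim W"
    using extend_basis[OF assms(1-3)] by metis
  have "B = C" using BC assms(4) by (metis card_seteq)
  then have "W \<subseteq> V" using BC(3,4) by simp
  then show ?thesis using assms(3) by (rule subset_antisym[rotated])
qed

lemma subspace_sumF:
  assumes "mp.subspace V" "mp.subspace R" shows "mp.subspace (sumF V F R)"
proof (rule mp.subspaceI)
  show "0 \<in> sumF V F R"
    unfolding sumF_def by (rule CollectI, rule exI[of _ 0], rule exI[of _ 0]) (use assms[THEN mp.subspace_0] in simp)
next
  fix x y assume "x \<in> sumF V F R" "y \<in> sumF V F R"
  then obtain h g h' g' where *: "x = h + F * g" "y = h' + F * g'" "h \<in> V" "g \<in> R" "h' \<in> V" "g' \<in> R"
    unfolding sumF_def by blast
  have "x + y = (h + h') + F * (g + g')" using * by (simp add: algebra_simps)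
  then show "x + y \<in> sumF V F R" using * assms mp.subspace_add unfolding sumF_def by blast
next
  fix c x assume "x \<in> sumF V F R"
  then obtain h g where *: "x = h + F * g" "h \<in> V" "g \<in> R" unfolding sumF_def by blast
  have "msmult c x = msmult c h + F * msmult c g"
    using * by (simp add: mult_msmult mp.scale_right_distrib)
  then show "msmult c x \<in> sumF V F R" using * assms mp.subspace_scale unfolding sumF_def by blast
qed

lemma sumF_left: "mp.subspace R \<Longrightarrow> V \<subseteq> sumF V F R"
  unfolding sumF_def by (rule subsetI, rule CollectI, rule exI, rule exI[of _ 0]) (simp add: mp.subspace_0)

lemma sumF_right: "mp.subspace V \<Longrightarrow> g \<in> R \<Longrightarrow> F * g \<in> sumF V F R"
  unfolding sumF_def by (rule CollectI, rule exI[of _ 0], rule exI[of _ g]) (simp add: mp.subspace_0)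

lemma mult_mem_span:
  assumes "g \<in> mp.span C" "\<And>c. c \<in> C \<Longrightarrow> F * c \<in> V" "mp.subspace V"
  shows "F * g \<in> V"
  using assms(1)
proof (induction rule: mp.span_induct_alt)
  case base then show ?case using mp.subspace_0[OF assms(3)] by simp
next
  case (step c x y)
  then show ?case
    using mp.subspace_add[OF assms(3) mp.subspace_scale[OF assms(3) assms(2)[of x]]]
    by (simp add: distrib_left mult_msmult)
qed

lemma findim_sumF: assumes "findim V" "findim R" shows "findim (sumF V F R)"
proof -
  obtain B C where B: "finite B" "V \<subseteq> mp.span B" "finite C" "R \<subseteq> mp.span C"
    using assms unfolding findim_def by blast
  have "h + F * g \<in> mp.span (B \<union> (*) F ` C)" if "h \<in> V" "g \<in> R" for h g
  proof (rule mp.span_add)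
    show "h \<in> mp.span (B \<union> (*) F ` C)" using B that mp.span_mono by blast
    show "F * g \<in> mp.span (B \<union> (*) F ` C)"
      by (rule mult_mem_span[of _ C]) (use B that in \<open>auto intro: mp.span_base\<close>)
  qed
  then show ?thesis unfolding findim_def sumF_def using B
    by (intro exI[of _ "B \<union> (*) F ` C"]) auto
qed

text \<open>One half of rank-nullity for multiplication by \<open>F\<close> modulo \<open>V\<close>:
  a basis of \<open>U\<close> is extended to one of \<open>R\<close>, and its part in
  \<open>U\<close> adds nothing to \<open>V\<close>.\<close>

lemma kdim_sumF_le:
  assumes "findim V" "findim R" "mp.subspace V" "mp.subspace U" "U \<subseteq> R" "\<And>g. g \<in> U \<Longrightarrow> F * g \<in> V"
  shows "kdim (sumF V F R) + kdim U \<le> kdim V + kdim R"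
proof -
  obtain D where D: "D \<subseteq> V" "finite D" "V \<subseteq> mp.span D" "card D = kdim V"
    using findim_basis[OF assms(1)] by metis
  obtain B C where BC: "B \<subseteq> C" "finite C" "B \<subseteq> U" "R \<subseteq> mp.span C"
    "card B = kdim U" "card C = kdim R"
    using extend_basis[OF assms(2,4,5)] by metis
  let ?E = "D \<union> (*) F ` (C - B)"
  have VE: "V \<subseteq> mp.span ?E" using D mp.span_mono[of D ?E] by blast
  have "h + F * g \<in> mp.span ?E" if "h \<in> V" "g \<in> R" for h g
  proof (rule mp.span_add)
    show "h \<in> mp.span ?E" using VE that by blast
    show "F * g \<in> mp.span ?E"
    proof (rule mult_mem_span[of _ C])
      fix c assume "c \<in> C"
      show "F * c \<in> mp.span ?E"
      proof (cases "c \<in> B")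
        case True then show ?thesis using assms BC VE by blast
      next
        case False then show ?thesis using \<open>c \<in> C\<close> by (auto intro: mp.span_base)
      qed
    qed (use that BC in auto)
  qed
  then have "sumF V F R \<subseteq> mp.span ?E" unfolding sumF_def by blast
  then have "kdim (sumF V F R) \<le> card ?E" using mp.dim_le_card[of "sumF V F R" ?E] D(2) BC(2) by (simp add: kdim_eq)
  also have "\<dots> \<le> card D + card (C - B)"
    by (meson BC(2) add_left_mono card_Un_le card_image_le finite_Diff le_trans)
  also have "card (C - B) = card C - card B" using BC by (meson card_Diff_subset finite_subset)
  finally show ?thesis using D BC card_mono[of C B] by linarith
qed

text \<open>The other half of rank-nullity: a basis of \<open>V\<close> is extended to the sum, and
  preimages \<open>G c\<close> of the new basis vectors span \<open>R\<close> together with the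
  kernel, which lies in \<open>U\<close>.\<close>

lemma kdim_sumF_ge:
  assumes "findim V" "findim R" "mp.subspace V" "mp.subspace R" "mp.subspace U"
    "\<And>g. g \<in> R \<Longrightarrow> F * g \<in> V \<Longrightarrow> g \<in> U" "findim U"
  shows "kdim V + kdim R \<le> kdim (sumF V F R) + kdim U"
proof -
  obtain B C where BC: "B \<subseteq> C" "finite C" "B \<subseteq> V" "V = mp.span B" "C \<subseteq> sumF V F R" "sumF V F R \<subseteq> mp.span C"
    "card B = kdim V" "card C = kdim (sumF V F R)"
    using extend_basis[OF findim_sumF[OF assms(1,2)] assms(3) sumF_left[OF assms(4)]] by metis
  obtain D where D: "D \<subseteq> U" "finite D" "U \<subseteq> mp.span D" "card D = kdim U"
    using findim_basis[OF assms(7)] by metis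
  have "\<forall>c\<in>C. \<exists>g\<in>R. c - F * g \<in> V" using BC(5) unfolding sumF_def by force
  then obtain G where G: "\<And>c. c \<in> C \<Longrightarrow> G c \<in> R \<and> c - F * G c \<in> V" by metis
  let ?E = "D \<union> G ` (C - B)"
  have "g \<in> mp.span ?E" if g: "g \<in> R" for g
  proof -
    have "F * g \<in> sumF V F R" using g sumF_right assms by blast
    then have "F * g \<in> mp.span C" using BC by blast
    then obtain r where r: "(\<Sum>c\<in>C. msmult (r c) c) = F * g"
      using mp.span_finite[OF BC(2)] by (auto simp: image_iff)
    let ?g = "\<Sum>c\<in>C-B. msmult (r c) (G c)"
    have gR: "?g \<in> R"
      by (intro mp.subspace_sum mp.subspace_scale assms) (use G in auto)
    have "F * (g - ?g) = (\<Sum>c\<in>C. msmult (r c) c) - (\<Sum>c\<in>C-B. msmult (r c) (F * G c))"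
      by (simp add: r right_diff_distrib sum_distrib_left mult_msmult)
    also have "(\<Sum>c\<in>C. msmult (r c) c) = (\<Sum>c\<in>C-B. msmult (r c) c) + (\<Sum>c\<in>B. msmult (r c) c)"
      using sum.subset_diff[OF BC(1,2)] by blast
    also have "(\<Sum>c\<in>C-B. msmult (r c) c) + (\<Sum>c\<in>B. msmult (r c) c) - (\<Sum>c\<in>C-B. msmult (r c) (F * G c))
      = (\<Sum>c\<in>C-B. msmult (r c) (c - F * G c)) + (\<Sum>c\<in>B. msmult (r c) c)"
      by (simp add: mp.scale_right_diff_distrib sum_subtractf)
    also have "\<dots> \<in> V"
      by (intro mp.subspace_add mp.subspace_sum mp.subspace_scale assms) (use G BC in auto)
    finally have "g - ?g \<in> U"
      using assms(6) g gR mp.subspace_diff[OF assms(4)] by blast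
    then have "g - ?g \<in> mp.span ?E" using D mp.span_mono[of D ?E] by blast
    moreover have "?g \<in> mp.span ?E"
      by (intro mp.span_sum mp.span_scale mp.span_base) auto
    ultimately show ?thesis using mp.span_add by fastforce
  qed
  then have "kdim R \<le> card ?E" using mp.dim_le_card[of R ?E] D BC by (auto simp: kdim_eq)
  also have "\<dots> \<le> card D + card (C - B)"
    by (meson BC(2) add_left_mono card_Un_le card_image_le finite_Diff le_trans)
  also have "card (C - B) = card C - card B" using BC by (meson card_Diff_subset finite_subset)
  finally show ?thesis using D BC card_mono[of C B] by linarith
qed

lemma kdim_zero: "kdim {0} = 0"
  using mp.dim_span_eq_card_independent[of "{}", OF mp.independent_empty] by (simp add: kdim_eq)

lemma kdim_sumF_le_sum:
  fixes F :: "'k::field mpoly"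
  assumes "findim V" "findim R" "mp.subspace V" "mp.subspace R"
  shows "kdim (sumF V F R) \<le> kdim V + kdim R"
  using kdim_sumF_le[of V R "{0}" F] assms by (simp add: mp.subspace_0 kdim_zero)

lemma kdim_span_singleton: assumes "x \<noteq> 0" shows "kdim (mp.span {x}) = 1"
  using mp.dim_span_eq_card_independent[of "{x}"] assms by (simp add: kdim_eq)

lemma kdim_span_insert:
  assumes "findim V" "mp.subspace V" "w \<notin> V" shows "kdim (mp.span (insert w V)) = kdim V + 1"
proof -
  obtain B where B: "B \<subseteq> V" "finite B" "mp.independent B" "V \<subseteq> mp.span B" "card B = kdim V"
    using findim_basis[OF assms(1)] by blast
  have sB: "mp.span B = V" using B assms(2) mp.span_minimal by blast
  have "mp.independent (insert w B)" using mp.independent_insertI assms B sB by blast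
  moreover have "mp.span (insert w V) = mp.span (insert w B)"
    unfolding mp.span_eq using B(1,4) mp.span_mono[of B "insert w B"] mp.span_superset[of "insert w V"]
      mp.span_superset[of "insert w B"] by (auto intro: mp.span_base)
  moreover have "w \<notin> B" using assms B by blast
  ultimately show ?thesis using mp.dim_span_eq_card_independent[of "insert w B"] B(2,5)
    by (simp add: kdim_eq del: mp.dim_span)
qed

lemma separating_functional:
  fixes V :: "'k::field mpoly set"
  assumes "mp.subspace V" "w \<notin> V"
  obtains \<phi> where "functional \<phi>" "\<And>v. v \<in> V \<Longrightarrow> \<phi> v = 0" "\<phi> w = 1"
proof -
  obtain B where B: "B \<subseteq> V" "mp.independent B" "V \<subseteq> mp.span B"
    using mp.basis_exists[of V] by metis
  have sB: "mp.span B = V" using B assms(1) mp.span_minimal by blast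
  have "mp.independent (insert w B)" using mp.independent_insertI[of w B] assms(2) B(2) sB by simp
  then obtain \<phi> where \<phi>: "functional \<phi>" "\<forall>x\<in>insert w B. \<phi> x = (if x = w then 1 else 0 :: 'k)"
    using mpk.linear_independent_extend[of "insert w B" "\<lambda>x. if x = w then 1 else 0"] by blast
  have "\<phi> b = 0" if "b \<in> B" for b using \<phi> that B assms by auto
  then have "\<phi> v = 0" if "v \<in> V" for v
    using mpk.linear_eq_0_on_span[OF \<phi>(1), of B v] that B by blast
  then show ?thesis using that \<phi> by auto
qed

subsection \<open>Graded pieces\<close>

definition monom3 :: "nat \<Rightarrow> nat \<Rightarrow> nat \<Rightarrow> (nat \<Rightarrow>\<^sub>0 nat)" where
  "monom3 a b c = single 0 a + single 1 b + single 2 c"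

definition var :: "nat \<Rightarrow> 'k::field mpoly" where
  "var k = single (single k 1) 1"

definition mons :: "int \<Rightarrow> (nat \<Rightarrow>\<^sub>0 nat) set" where
  "mons j = {m. keys m \<subseteq> {0,1,2} \<and> int (mdeg m) = j}"

text \<open>The binomial coefficient (j+2 choose 2). Negative degrees are treated apart because the
  quadratic becomes positive again below -2.\<close>

definition hdim :: "int \<Rightarrow> nat" where
  "hdim j = (if j < 0 then 0 else nat ((j + 1) * (j + 2) div 2))"

lemma mdeg_eq: "keys m \<subseteq> {0,1,2} \<Longrightarrow>
    mdeg m = lookup m 0 + lookup m 1 + lookup m 2"
proof -
  assume *: "keys m \<subseteq> {0,1,2}"
  have "mdeg m = (\<Sum>v\<in>{0,1,2}. lookup m v)"
    unfolding mdeg_def by (rule sum.mono_neutral_left) (use * in \<open>auto simp: in_keys_iff\<close>)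
  then show ?thesis by simp
qed

lemma lookup_monom3:
  "lookup (monom3 a b c) v = (if v = 0 then a else if v = 1 then b else if v = 2 then c else 0)"
  by (simp add: monom3_def lookup_add lookup_single when_def)

lemma keys_monom3: "keys (monom3 a b c) \<subseteq> {0,1,2}"
  by (auto simp: in_keys_iff lookup_monom3 split: if_splits)

lemma mons_iff: "m \<in> mons j \<longleftrightarrow> (\<exists>a b c. m = monom3 a b c \<and> int (a + b + c) = j)"
proof
  assume m: "m \<in> mons j"
  have "m = monom3 (lookup m 0) (lookup m 1) (lookup m 2)"
    using m by (intro poly_mapping_eqI) (auto simp: mons_def lookup_monom3 in_keys_iff)
  then show "\<exists>a b c. m = monom3 a b c \<and> int (a + b + c) = j"
    using m mdeg_eq[of m] by (auto simp: mons_def)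
qed (use keys_monom3 in \<open>auto simp: mons_def mdeg_eq lookup_monom3\<close>)

lemma homR_iff: "f \<in> homR j \<longleftrightarrow> keys f \<subseteq> mons j"
  by (auto simp: homR_def mons_def)

lemma monom3_inject: "monom3 a b c = monom3 a' b' c' \<longleftrightarrow> a = a' \<and> b = b' \<and> c = c'"
proof
  assume "monom3 a b c = monom3 a' b' c'"
  then have "lookup (monom3 a b c) v = lookup (monom3 a' b' c') v" for v by simp
  from this[of 0] this[of 1] this[of 2] show "a = a' \<and> b = b' \<and> c = c'"
    by (simp add: lookup_monom3)
qed auto

lemma mons_neg: "j < 0 \<Longrightarrow> mons j = {}"
  by (auto simp: mons_iff)

lemma mons_nat: "mons (int n) = (\<lambda>(c, b). monom3 (n - b - c) b c) ` (SIGMA c:{..n}. {..n - c})"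
  (is "_ = ?R")
proof
  show "mons (int n) \<subseteq> ?R"
  proof
    fix m assume "m \<in> mons (int n)"
    then obtain a b c where "m = monom3 a b c" "a + b + c = n" by (auto simp: mons_iff)
    then show "m \<in> ?R" by (intro image_eqI[of _ _ "(c, b)"]) auto
  qed
  show "?R \<subseteq> mons (int n)" by (fastforce simp: mons_iff)
qed

lemma finite_mons: "finite (mons j)"
proof (cases "j < 0")
  case False
  then show ?thesis using mons_nat[of "nat j"] by simp
qed (simp add: mons_neg)

lemma card_mons: "card (mons j) = hdim j"
proof (cases "j < 0")
  case False
  then obtain n where j: "j = int n" by (metis nonneg_int_cases not_less)
  have "card (mons j) = card (SIGMA c:{..n}. {..n - c})"
    unfolding j mons_nat by (rule card_image) (auto simp: inj_on_def monom3_inject)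
  also have "\<dots> = (\<Sum>c\<le>n. n - c + 1)" by simp
  also have "\<dots> = (\<Sum>c\<le>n. c + 1)"
    by (rule sum.reindex_bij_witness[of _ "\<lambda>c. n - c" "\<lambda>c. n - c"]) auto
  finally have c: "card (mons j) = (\<Sum>c\<le>n. c + 1)" .
  have "2 * (\<Sum>c\<le>n. c + 1) = (n + 1) * (n + 2)"
    by (induction n) (auto simp: algebra_simps)
  then have "int (2 * card (mons j)) = int ((n + 1) * (n + 2))" using c by simp
  then have "2 * int (card (mons j)) = (j + 1) * (j + 2)"
    unfolding j by (simp add: algebra_simps)
  then have "int (card (mons j)) = (j + 1) * (j + 2) div 2" by linarith
  then show ?thesis using False by (simp add: hdim_def)
qed (simp add: mons_neg hdim_def)

lemma hdim_formula: "-2 \<le> j \<Longrightarrow> 2 * int (hdim j) = (j + 1) * (j + 2)"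
proof -
  assume j: "-2 \<le> j"
  have ev: "even ((j + 1) * (j + 2))" by simp
  consider "j = -2" | "j = -1" | "j \<ge> 0" using j by linarith
  then show ?thesis
  proof cases
    case 3
    then have "(j + 1) * (j + 2) \<ge> 0" by simp
    then have "int (hdim j) = (j + 1) * (j + 2) div 2" using 3 by (simp add: hdim_def)
    then show ?thesis using ev by simp
  qed (auto simp: hdim_def)
qed

lemma hdim_diff: "int (hdim j) - int (hdim (j - 1)) = max 0 (j + 1)"
proof (cases "j \<ge> -1")
  case True
  then have "2 * (int (hdim j) - int (hdim (j - 1))) = 2 * (j + 1)"
    using hdim_formula[of j] hdim_formula[of "j - 1"] by (simp add: algebra_simps)
  then show ?thesis using True by simp
qed (simp add: hdim_def)

lemma hdim_neg: "j < 0 \<Longrightarrow> hdim j = 0" by (simp add: hdim_def)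
lemma hdim_0: "hdim 0 = 1" by (simp add: hdim_def)
lemma hdim_1: "hdim 1 = 3" by (simp add: hdim_def)
lemma subspace_homR: "mp.subspace (homR j)"
proof (rule mp.subspaceI)
  show "0 \<in> homR j" by (simp add: homR_def)
  show "x + y \<in> homR j" if "x \<in> homR j" "y \<in> homR j" for x y
    using that keys_add[of x y] by (auto simp: homR_iff)
  show "msmult c x \<in> homR j" if "x \<in> homR j" for c x
    using that keys_msmult[of c x] by (auto simp: homR_iff)
qed

lemmas zero_homR = mp.subspace_0[OF subspace_homR]
  and add_homR = mp.subspace_add[OF subspace_homR]
  and scale_homR = mp.subspace_scale[OF subspace_homR]
  and neg_homR = mp.subspace_neg[OF subspace_homR]

lemma single_homR: "m \<in> mons j \<Longrightarrow> single m c \<in> homR j"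
  by (auto simp: homR_iff)

lemma homR_span: "homR j = mp.span ((\<lambda>m. single m (1::'k::field)) ` mons j)"
proof
  show "homR j \<subseteq> mp.span ((\<lambda>m. single m (1::'k)) ` mons j)"
  proof
    fix f :: "'k mpoly" assume "f \<in> homR j"
    then have f: "f = (\<Sum>m\<in>mons j. msmult (lookup f m) (single m 1))"
      using mpoly_sum_monomials[OF finite_mons] homR_iff by metis
    show "f \<in> mp.span ((\<lambda>m. single m (1::'k)) ` mons j)"
      by (subst f) (intro mp.span_sum mp.span_scale mp.span_base, auto)
  qed
  show "mp.span ((\<lambda>m. single m (1::'k)) ` mons j) \<subseteq> homR j"
    by (rule mp.span_minimal[OF _ subspace_homR]) (auto intro: single_homR)
qed

lemma findim_homR: "findim (homR j)"
  unfolding findim_def using homR_span finite_mons by (metis finite_imageI subset_refl)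

lemma inj_single_one: "inj_on (\<lambda>m. single m (1::'k::field)) A"
  by (rule inj_onI) (metis (mono_tags) lookup_single_eq lookup_single_not_eq zero_neq_one)

lemma kdim_homR: "kdim (homR j :: 'k::field mpoly set) = hdim j"
proof -
  let ?s = "\<lambda>m. single m (1::'k)"
  have "mp.independent (?s ` mons j)"
  proof (rule mp.independent_if_scalars_zero)
    show "finite (?s ` mons j)" using finite_mons by simp
    fix f x assume s: "(\<Sum>x\<in>?s ` mons j. msmult (f x) x) = 0" and x: "x \<in> ?s ` mons j"
    then obtain m where m: "m \<in> mons j" "x = ?s m" by auto
    have "0 = lookup (\<Sum>x\<in>?s ` mons j. msmult (f x) x) m" using s by simp
    also have "\<dots> = (\<Sum>m'\<in>mons j. f (?s m') * (1 when m' = m))"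
      by (subst sum.reindex[OF inj_single_one]) (simp add: lookup_sum lookup_msmult lookup_single)
    also have "\<dots> = (\<Sum>m'\<in>mons j. if m' = m then f x else 0)"
      by (rule sum.cong) (auto simp: when_def m)
    also have "\<dots> = f x" using m finite_mons by simp
    finally show "f x = 0" by simp
  qed
  then have "kdim (homR j :: 'k mpoly set) = card (?s ` mons j)"
    unfolding kdim_eq homR_span by (rule mp.dim_span_eq_card_independent)
  then show ?thesis by (simp add: card_image[OF inj_single_one] card_mons)
qed

lemma homR_neg: "j < 0 \<Longrightarrow> homR j = {0}"
  by (auto simp: homR_iff mons_neg)

lemma mons_add: "m \<in> mons i \<Longrightarrow> n \<in> mons j \<Longrightarrow> m + n \<in> mons (i + j)"
proof -
  assume "m \<in> mons i" "n \<in> mons j"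
  then obtain a b c a' b' c' where *: "m = monom3 a b c" "int (a + b + c) = i" "n = monom3 a' b' c'" "int (a' + b' + c') = j"
    by (auto simp: mons_iff)
  have "m + n = monom3 (a + a') (b + b') (c + c')"
    using * by (intro poly_mapping_eqI) (simp add: lookup_add lookup_monom3)
  then show ?thesis unfolding mons_iff using * by (intro exI[of _ "a + a'"] exI[of _ "b + b'"] exI[of _ "c + c'"]) auto
qed

lemma homR_mult: "f \<in> homR i \<Longrightarrow> g \<in> homR j \<Longrightarrow> f * g \<in> homR (i + j)"
  unfolding homR_iff using keys_mult[of f g] mons_add by blast

lemma homR_one: "1 \<in> homR 0"
  using single_homR[of 0 0 1] by (simp add: mons_def mdeg_def)

lemma homR_power: "f \<in> homR i \<Longrightarrow> f ^ n \<in> homR (int n * i)"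
proof (induction n)
  case 0 then show ?case by (simp add: homR_one)
next
  case (Suc n)
  then show ?case using homR_mult[of f i "f ^ n" "int n * i"] by (simp add: algebra_simps)
qed

lemma var_power: "var k ^ n = single (single k n) 1"
  by (induction n) (simp_all add: var_def mult_single single_add[symmetric])

lemma single_monom3: "single (monom3 a b c) 1 = var 0 ^ a * var 1 ^ b * var 2 ^ c"
  by (simp add: var_power mult_single monom3_def)

lemma var_homR: "k < 3 \<Longrightarrow> var k \<in> homR 1"
proof -
  assume "k < 3"
  then have "single k 1 \<in> mons 1"
    by (auto simp: mons_def mdeg_def)
  then show ?thesis unfolding var_def by (rule single_homR)
qed

lemma var_power_homR: "k < 3 \<Longrightarrow> var k ^ n \<in> homR (int n)"
  using homR_power[OF var_homR] by fastforce

lemma linform_eq: "linform c = msmult (c 0) (var 0) + msmult (c 1) (var 1) + msmult (c 2) (var 2)"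
proof -
  have "msmult x (var k) = single (single k 1) x" for x :: 'a and k
    by (simp add: Defs.smult_def var_def mult_single)
  then show ?thesis by (simp add: linform_def numeral_3_eq_3 numeral_2_eq_2)
qed

lemma linform_homR: "linform c \<in> homR 1"
  unfolding linform_eq by (intro add_homR scale_homR var_homR) auto

lemma linform_power_homR: "linform c ^ n \<in> homR (int n)"
  using homR_power[OF linform_homR] by fastforce

lemma linform_cong: "c 0 = d 0 \<Longrightarrow> c 1 = d 1 \<Longrightarrow> c 2 = d 2 \<Longrightarrow> linform c = linform d"
  by (simp add: linform_eq)

lemma homR_functional_zero:
  assumes "functional \<phi>"
    "\<And>a b c. a + b + c = n \<Longrightarrow> \<phi> (var 0 ^ a * var 1 ^ b * var 2 ^ c) = 0" "f \<in> homR (int n)"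
  shows "\<phi> f = 0"
proof (rule mpk.linear_eq_0_on_span[OF assms(1)])
  show "f \<in> mp.span ((\<lambda>m. single m 1) ` mons (int n))"
    using assms(3) homR_span by blast
  fix x assume "x \<in> (\<lambda>m. single m (1::'a)) ` mons (int n)"
  then obtain a b c where "x = var 0 ^ a * var 1 ^ b * var 2 ^ c" "int (a + b + c) = int n"
    unfolding mons_iff by (metis (mono_tags, lifting) imageE mem_Collect_eq mons_iff single_monom3)
  then show "\<phi> x = 0" using assms(2)[of a b c] by simp
qed

text \<open>Some variable divides every monomial of positive degree. This is what carries
  surjectivity from one degree to the next.\<close>

lemma homR_Suc_span:
  assumes "f \<in> homR (j + 1)" "j \<ge> 0"
  shows "f \<in> mp.span {var k * g | k g. k < 3 \<and> g \<in> homR j}"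
proof -
  have "(\<lambda>m. single m (1::'a)) ` mons (j + 1) \<subseteq> mp.span {var k * g | k g. k < 3 \<and> g \<in> homR j}"
  proof
    fix x :: "'a mpoly" assume "x \<in> (\<lambda>m. single m 1) ` mons (j + 1)"
    then obtain a b c where x: "x = var 0 ^ a * var 1 ^ b * var 2 ^ c" and s: "int (a + b + c) = j + 1"
      by (auto simp: mons_iff single_monom3)
    have h: "var 0 ^ a' * var 1 ^ b' * var 2 ^ c' \<in> homR j" if "int (a' + b' + c') = j" for a' b' c' :: nat
      using that single_homR[of "monom3 a' b' c'" j 1] unfolding single_monom3[symmetric] by (auto simp: mons_iff)
    have cs: "(\<exists>a'. a = Suc a') \<or> (\<exists>b'. b = Suc b') \<or> (\<exists>c'. c = Suc c')"
      using s assms(2) by (cases a; cases b; cases c) auto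
    have k: "(0::nat) < 3" "(1::nat) < 3" "(2::nat) < 3" by simp_all
    have "\<exists>k g. x = var k * g \<and> k < 3 \<and> g \<in> homR j"
      using cs
    proof (elim disjE exE)
      fix a' assume 1: "a = Suc a'"
      have "x = var 0 * (var 0 ^ a' * var 1 ^ b * var 2 ^ c)" by (simp add: x 1 mult_ac)
      moreover have "var 0 ^ a' * var 1 ^ b * var 2 ^ c \<in> homR j" by (rule h) (use s 1 in simp)
      ultimately show ?thesis using k by metis
    next
      fix b' assume 2: "b = Suc b'"
      have "x = var 1 * (var 0 ^ a * var 1 ^ b' * var 2 ^ c)" by (simp add: x 2 mult_ac)
      moreover have "var 0 ^ a * var 1 ^ b' * var 2 ^ c \<in> homR j" by (rule h) (use s 2 in simp)
      ultimately show ?thesis using k by metis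
    next
      fix c' assume 3: "c = Suc c'"
      have "x = var 2 * (var 0 ^ a * var 1 ^ b * var 2 ^ c')" by (simp add: x 3 mult_ac)
      moreover have "var 0 ^ a * var 1 ^ b * var 2 ^ c' \<in> homR j" by (rule h) (use s 3 in simp)
      ultimately show ?thesis using k by metis
    qed
    then show "x \<in> mp.span {var k * g | k g. k < 3 \<and> g \<in> homR j}"
      by (intro mp.span_base) blast
  qed
  then have "homR (j + 1) \<subseteq> mp.span {var k * g | k g. k < 3 \<and> g \<in> (homR j :: 'a mpoly set)}"
    unfolding homR_span[of "j + 1"] by (rule mp.span_minimal[OF _ mp.subspace_span])
  then show ?thesis using assms by blast
qed

subsection \<open>Homogeneous components of ideals\<close>

text \<open>Arbitrary index sets, not only initial segments, let generators be added and removed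
  singly. The powers of L and the auxiliary forms of the special configurations are then just
  further generators.\<close>

definition psum :: "nat set \<Rightarrow> (nat \<Rightarrow> 'k::field mpoly) \<Rightarrow> (nat \<Rightarrow> nat) \<Rightarrow> int \<Rightarrow> 'k mpoly set" where
  "psum X G e j = {f. \<exists>g. (\<forall>i\<in>X. g i \<in> homR (j - int (e i))) \<and> f = (\<Sum>i\<in>X. G i * g i)}"

lemma idealdeg_psum: "idealdeg s G e j = psum {..<s} G e j"
  by (simp add: idealdeg_def psum_def Ball_def)

lemma psum_empty: "psum {} G e j = {0}"
  by (auto simp: psum_def)

lemma psum_insert:
  assumes "finite X" "i \<notin> X"
  shows "psum (insert i X) G e j = sumF (psum X G e j) (G i) (homR (j - int (e i)))"
proof
  show "psum (insert i X) G e j \<subseteq> sumF (psum X G e j) (G i) (homR (j - int (e i)))"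
  proof
    fix x assume "x \<in> psum (insert i X) G e j"
    then obtain g where "\<forall>k\<in>insert i X. g k \<in> homR (j - int (e k))" "x = (\<Sum>k\<in>X. G k * g k) + G i * g i"
      using assms unfolding psum_def by (auto simp: add.commute)
    then show "x \<in> sumF (psum X G e j) (G i) (homR (j - int (e i)))"
      unfolding sumF_def psum_def by blast
  qed
  show "sumF (psum X G e j) (G i) (homR (j - int (e i))) \<subseteq> psum (insert i X) G e j"
  proof
    fix x assume "x \<in> sumF (psum X G e j) (G i) (homR (j - int (e i)))"
    then obtain g h where *: "x = (\<Sum>i\<in>X. G i * g i) + G i * h" "\<forall>i\<in>X. g i \<in> homR (j - int (e i))" "h \<in> homR (j - int (e i))"
      unfolding sumF_def psum_def by blast
    have "x = (\<Sum>k\<in>insert i X. G k * (g(i := h)) k)"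
      using assms * by (simp add: add.commute) (intro sum.cong, auto)
    then show "x \<in> psum (insert i X) G e j"
      unfolding psum_def using * assms by (intro CollectI exI[of _ "g(i := h)"]) auto
  qed
qed

lemma psum_cong:
  assumes "\<And>i. i \<in> X \<Longrightarrow> G i = H i" "\<And>i. i \<in> X \<Longrightarrow> e i = f i"
  shows "psum X G e j = psum X H f j"
  using assms by (simp add: psum_def cong: sum.cong)

lemma psum_basics:
  assumes "finite X"
  shows subspace_psum: "mp.subspace (psum X G e j)"
    and findim_psum: "findim (psum X G e j)"
    and kdim_psum_le: "kdim (psum X G e j) \<le> (\<Sum>i\<in>X. hdim (j - int (e i)))"
proof -
  have "mp.subspace (psum X G e j) \<and> findim (psum X G e j) \<and> kdim (psum X G e j) \<le> (\<Sum>i\<in>X. hdim (j - int (e i)))"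
    using assms
  proof (induction X rule: finite_induct)
    case empty
    have "findim {0::'a mpoly}" unfolding findim_def by (intro exI[of _ "{}"]) simp
    then show ?case by (simp add: psum_empty kdim_zero)
  next
    case (insert i X)
    then show ?case
      using kdim_sumF_le_sum[of "psum X G e j" "homR (j - int (e i))" "G i"]
      by (simp add: psum_insert kdim_homR subspace_sumF subspace_homR findim_sumF findim_homR)
  qed
  then show "mp.subspace (psum X G e j)" "findim (psum X G e j)" "kdim (psum X G e j) \<le> (\<Sum>i\<in>X. hdim (j - int (e i)))"
    by auto
qed

lemma kdim_psum_union_le:
  assumes "finite X" "finite Y" "X \<inter> Y = {}"
  shows "kdim (psum (X \<union> Y) G e j) \<le> kdim (psum X G e j) + (\<Sum>i\<in>Y. hdim (j - int (e i)))"
  using assms(2,3)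
proof (induction Y rule: finite_induct)
  case (insert i Y)
  have "kdim (sumF (psum (X \<union> Y) G e j) (G i) (homR (j - int (e i)))) \<le> kdim (psum (X \<union> Y) G e j) + hdim (j - int (e i))"
    using kdim_sumF_le_sum[of "psum (X \<union> Y) G e j" "homR (j - int (e i))" "G i"] insert assms
    by (simp add: subspace_homR findim_homR subspace_psum findim_psum kdim_homR)
  then show ?case using insert assms psum_insert[of "X \<union> Y" i G e j] by simp
qed simp

lemma psum_mono:
  assumes "X \<subseteq> Y" "finite Y" shows "psum X G e j \<subseteq> psum Y G e j"
proof
  fix f assume "f \<in> psum X G e j"
  then obtain g where g: "\<forall>i\<in>X. g i \<in> homR (j - int (e i))" "f = (\<Sum>i\<in>X. G i * g i)" unfolding psum_def by blast
  have "f = (\<Sum>i\<in>Y. G i * (if i \<in> X then g i else 0))"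
    unfolding g using assms by (intro sum.mono_neutral_cong_left) auto
  then show "f \<in> psum Y G e j"
    unfolding psum_def using g zero_homR
    by (intro CollectI exI[of _ "\<lambda>i. if i \<in> X then g i else 0"]) auto
qed

lemma psum_gen:
  assumes "finite X" "i \<in> X" "g \<in> homR (j - int (e i))" shows "G i * g \<in> psum X G e j"
  using psum_mono[of "{i}" X G e j] assms by (fastforce simp: psum_def)

lemma psum_homR:
  assumes "\<And>i. i \<in> X \<Longrightarrow> G i \<in> homR (int (e i))" shows "psum X G e j \<subseteq> homR j"
proof
  fix f assume "f \<in> psum X G e j"
  then obtain g where g: "\<forall>i\<in>X. g i \<in> homR (j - int (e i))" "f = (\<Sum>i\<in>X. G i * g i)" unfolding psum_def by blast
  then show "f \<in> homR j"
    unfolding g(2) using homR_mult[OF assms] by (intro mp.subspace_sum[OF subspace_homR]) fastforce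
qed

lemma psum_mult:
  assumes "f \<in> psum X G e j" "F \<in> homR k" shows "F * f \<in> psum X G e (j + k)"
proof -
  obtain g where g: "\<forall>i\<in>X. g i \<in> homR (j - int (e i))" "f = (\<Sum>i\<in>X. G i * g i)" using assms unfolding psum_def by blast
  have "F * g i \<in> homR (j + k - int (e i))" if "i \<in> X" for i
    using homR_mult[OF assms(2), of "g i" "j - int (e i)"] g that by (simp add: algebra_simps)
  then show ?thesis unfolding psum_def
    by (intro CollectI exI[of _ "\<lambda>i. F * g i"]) (auto simp: g sum_distrib_left algebra_simps)
qed

text \<open>This finite spanning family depends polynomially on the coefficients of the linear
  forms, which is what semicontinuity needs.\<close>

lemma psum_span:
  assumes "finite X"
  shows "psum X G e j = mp.span ((\<lambda>(i, m). G i * single m 1) ` (SIGMA i:X. mons (j - int (e i))))"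
    (is "_ = mp.span ?B")
proof
  show "psum X G e j \<subseteq> mp.span ?B"
  proof
    fix f assume "f \<in> psum X G e j"
    then obtain g where g: "\<forall>i\<in>X. g i \<in> homR (j - int (e i))" "f = (\<Sum>i\<in>X. G i * g i)" unfolding psum_def by blast
    have "G i * g i \<in> mp.span ?B" if "i \<in> X" for i
      by (rule mult_mem_span[of _ "(\<lambda>m. single m 1) ` mons (j - int (e i))"])
        (use g that in \<open>auto simp flip: homR_span intro!: mp.span_base image_eqI[of _ _ "(i, _)"]\<close>)
    then show "f \<in> mp.span ?B" unfolding g(2) by (rule mp.span_sum)
  qed
  show "mp.span ?B \<subseteq> psum X G e j"
    by (rule mp.span_minimal[OF _ subspace_psum[OF assms]]) (auto intro!: psum_gen assms single_homR)
qed

text \<open>A nonzero \<open>g i\<close> would give multiplication by \<open>G i\<close> modulo the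
  other generators a kernel of dimension at least one, so the piece would miss the maximal
  count.\<close>

lemma syzygy_trivial_if_kdim:
  assumes "finite X" "kdim (psum X G e j) \<ge> (\<Sum>i\<in>X. hdim (j - int (e i)))"
    "\<And>i. i \<in> X \<Longrightarrow> g i \<in> homR (j - int (e i))" "(\<Sum>i\<in>X. G i * g i) = 0" "i \<in> X"
  shows "g i = 0"
proof (rule ccontr)
  assume ne: "g i \<noteq> 0"
  let ?Y = "X - {i}"
  have X: "X = insert i ?Y" "finite ?Y" "i \<notin> ?Y" using assms by auto
  have "(\<Sum>k\<in>X. G k * g k) = G i * g i + (\<Sum>k\<in>?Y. G k * g k)"
    using assms by (meson sum.remove)
  then have "G i * g i = (\<Sum>k\<in>?Y. G k * - g k)" using assms by (simp add: sum_negf eq_neg_iff_add_eq_0)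
  then have "G i * g i \<in> psum ?Y G e j"
    unfolding psum_def using assms neg_homR by (intro CollectI exI[of _ "\<lambda>k. - g k"]) auto
  then have "kdim (sumF (psum ?Y G e j) (G i) (homR (j - int (e i)))) + kdim (mp.span {g i})
    \<le> kdim (psum ?Y G e j) + kdim (homR (j - int (e i)) :: 'a mpoly set)"
    using assms mp.subspace_span mp.span_minimal[of "{g i}", OF _ subspace_homR]
    by (intro kdim_sumF_le findim_psum subspace_psum findim_homR) (auto intro: mult_mem_span[OF _ _ subspace_psum])
  then have "kdim (psum X G e j) + 1 \<le> (\<Sum>k\<in>?Y. hdim (j - int (e k))) + hdim (j - int (e i))"
    using kdim_psum_le[OF X(2), of G e j] psum_insert[OF X(2,3), of G e j] X(1) ne
    by (simp add: kdim_span_singleton kdim_homR)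
  also have "\<dots> = (\<Sum>k\<in>X. hdim (j - int (e k)))"
    using sum.remove[OF assms(1,5), of "\<lambda>k. hdim (j - int (e k))"] by simp
  finally show False using assms(2) by simp
qed

text \<open>Generators are added one at a time; a kernel element at any stage would be a syzygy, so
  every stage contributes its full dimension.\<close>

lemma kdim_psum_if_syzygy_trivial:
  assumes "finite X"
    "\<And>g i. (\<And>i. i \<in> X \<Longrightarrow> g i \<in> homR (j - int (e i))) \<Longrightarrow> (\<Sum>i\<in>X. G i * g i) = 0 \<Longrightarrow> i \<in> X \<Longrightarrow> g i = 0"
  shows "kdim (psum X G e j) \<ge> (\<Sum>i\<in>X. hdim (j - int (e i)))"
  using assms
proof (induction X rule: finite_induct)
  case (insert i X)
  have triv: "g = 0" if g: "g \<in> homR (j - int (e i))" "G i * g \<in> psum X G e j" for g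
  proof -
    obtain h where h: "\<forall>k\<in>X. h k \<in> homR (j - int (e k))" "G i * g = (\<Sum>k\<in>X. G k * h k)"
      using g unfolding psum_def by blast
    have "(\<Sum>k\<in>insert i X. G k * (h(i := - g)) k) = - (G i * g) + (\<Sum>k\<in>X. G k * h k)"
      using insert.hyps by (simp) (intro sum.cong, auto)
    then have "(\<Sum>k\<in>insert i X. G k * (h(i := - g)) k) = 0" using h by simp
    moreover have "(h(i := - g)) k \<in> homR (j - int (e k))" if "k \<in> insert i X" for k
      using h(1) mp.subspace_neg[OF subspace_homR g(1)] that by auto
    ultimately have "(h(i := - g)) i = 0"
      by (intro insert.prems[of "h(i := - g)" i]) blast+
    then show ?thesis by simp
  qed
  have "kdim (psum X G e j) + kdim (homR (j - int (e i)) :: 'a mpoly set)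
     \<le> kdim (sumF (psum X G e j) (G i) (homR (j - int (e i)))) + kdim {0::'a mpoly}"
  proof (rule kdim_sumF_ge)
    show "findim {0::'a mpoly}" unfolding findim_def by (intro exI[of _ "{}"]) simp
  qed (use insert.hyps triv in \<open>auto simp: mp.subspace_single_0 subspace_psum findim_psum subspace_homR findim_homR\<close>)
  moreover have "(\<Sum>i\<in>X. hdim (j - int (e i))) \<le> kdim (psum X G e j)"
  proof (rule insert.IH)
    fix g k assume g: "\<And>i. i \<in> X \<Longrightarrow> g i \<in> homR (j - int (e i))" "(\<Sum>i\<in>X. G i * g i) = 0" "k \<in> X"
    have "(\<Sum>k\<in>insert i X. G k * (g(i := 0)) k) = (\<Sum>k\<in>X. G k * g k)"
      using insert.hyps by (simp) (intro sum.cong, auto)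
    then have "(\<Sum>k\<in>insert i X. G k * (g(i := 0)) k) = 0" using g by simp
    moreover have "(g(i := 0)) k \<in> homR (j - int (e k))" if "k \<in> insert i X" for k
      using g(1) that by (auto simp: zero_homR)
    ultimately have "(g(i := 0)) k = 0"
      using g(3) by (intro insert.prems[of "g(i := 0)" k]) blast+
    then show "g k = 0" using g(3) insert.hyps by (auto split: if_splits)
  qed
  ultimately show ?case using insert.hyps by (simp add: psum_insert kdim_homR kdim_zero)
qed simp

subsection \<open>Functionals on forms as univariate polynomials\<close>

lemma of_nat_mult_mpoly: "of_nat n * (f :: 'k::field mpoly) = msmult (of_nat n) f"
  by (simp add: Defs.smult_def single_of_nat)

lemma power_split: "m \<le> n \<Longrightarrow> x ^ n = x ^ m * (x ^ (n - m) :: 'a::monoid_mult)"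
  by (metis le_add_diff_inverse power_add)

lemma msmult_power: "msmult c f ^ n = msmult (c ^ n) (f ^ n)"
  by (induction n) (simp_all add: mult_msmult)

lemma linear_fun_simps:
  assumes "functional (\<phi> :: 'k::field mpoly \<Rightarrow> 'k)"
  shows "\<phi> (f + g) = \<phi> f + \<phi> g" "\<phi> (msmult c f) = c * \<phi> f" "\<phi> (sum h A) = (\<Sum>a\<in>A. \<phi> (h a))" "\<phi> 0 = 0"
  using mpk.linear_add[OF assms] mpk.linear_scale[OF assms] mpk.linear_sum[OF assms] mpk.linear_0[OF assms] by auto

lemma functional_binomial:
  assumes "functional (\<phi> :: 'k::field mpoly \<Rightarrow> 'k)"
  shows "\<phi> (h * (msmult q f + g) ^ n) = (\<Sum>l\<le>n. of_nat (n choose l) * q ^ l * \<phi> (h * (f ^ l * g ^ (n - l))))"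
proof -
  have "h * (msmult q f + g) ^ n = (\<Sum>l\<le>n. msmult (of_nat (n choose l) * q ^ l) (h * (f ^ l * g ^ (n - l))))"
    unfolding binomial_ring sum_distrib_left
  proof (rule sum.cong[OF refl])
    fix l
    have "h * (of_nat (n choose l) * msmult q f ^ l * g ^ (n - l)) = h * (msmult (of_nat (n choose l)) (msmult (q ^ l) (f ^ l)) * g ^ (n - l))"
      by (simp only: msmult_power of_nat_mult_mpoly)
    then show "h * (of_nat (n choose l) * msmult q f ^ l * g ^ (n - l)) = msmult (of_nat (n choose l) * q ^ l) (h * (f ^ l * g ^ (n - l)))"
      by (simp only: mult_msmult mp.scale_scale)
  qed
  then show ?thesis by (simp only: linear_fun_simps[OF assms])
qed

text \<open>The coefficient of z^k in the dehomogenised dual form (y, z) \<mapsto> \<phi> ((X + y Y + z Z)^j), where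
  X, Y, Z are the variables of R.\<close>
definition ufun :: "('k::field mpoly \<Rightarrow> 'k) \<Rightarrow> nat \<Rightarrow> nat \<Rightarrow> 'k poly" where
  "ufun \<phi> j k = (\<Sum>l\<le>j - k. monom (of_nat (j choose k) * of_nat ((j - k) choose l)
      * \<phi> (var 0 ^ (j - k - l) * var 1 ^ l * var 2 ^ k)) l)"

lemma coeff_ufun:
  "coeff (ufun \<phi> j k) n = (if n \<le> j - k then of_nat (j choose k) * of_nat ((j - k) choose n)
      * \<phi> (var 0 ^ (j - k - n) * var 1 ^ n * var 2 ^ k) else 0)"
  by (simp add: ufun_def coeff_sum)

lemma poly_ufun:
  assumes "functional \<phi>"
  shows "poly (ufun \<phi> j k) q = of_nat (j choose k) * \<phi> (var 2 ^ k * (msmult q (var 1) + var 0) ^ (j - k))"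
  unfolding functional_binomial[OF assms] ufun_def
  unfolding poly_sum poly_monom sum_distrib_left
  by (rule sum.cong[OF refl]) (simp only: mult_ac)

text \<open>Since z^3 is killed, the expansion in z stops at the square: the dual form is a conic
  bundle over the y-line.\<close>

lemma functional_point_power:
  assumes lin: "functional \<phi>"
    and z3: "\<And>g. g \<in> homR (int j - 3) \<Longrightarrow> \<phi> (var 2 ^ 3 * g) = 0"
  shows "\<phi> ((msmult q (var 2) + (msmult p (var 1) + var 0)) ^ j)
    = poly (ufun \<phi> j 0) p + q * poly (ufun \<phi> j 1) p + q\<^sup>2 * poly (ufun \<phi> j 2) p"
proof -
  let ?W = "msmult p (var 1) + var 0 :: 'a mpoly"
  define T where "T = (\<lambda>k. of_nat (j choose k) * q ^ k * \<phi> (var 2 ^ k * ?W ^ (j - k)))"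
  have "?W \<in> homR 1"
    by (intro add_homR scale_homR var_homR) auto
  then have W: "?W ^ n \<in> homR (int n)" for n
    using homR_power[of ?W 1 n] by simp
  have T0: "T k = 0" if "k \<le> j" "\<not> k \<le> 2" for k
  proof -
    have "var 2 ^ (k - 3) * ?W ^ (j - k) \<in> homR (int (k - 3) + int (j - k))"
      by (intro homR_mult var_power_homR W) simp
    moreover have "int (k - 3) + int (j - k) = int j - 3" using that by simp
    moreover have "3 \<le> k" using that by simp
    then have "var 2 ^ k * ?W ^ (j - k) = var 2 ^ 3 * (var 2 ^ (k - 3) * ?W ^ (j - k))"
      by (simp only: power_split[of 3 k] mult.assoc)
    ultimately have "\<phi> (var 2 ^ k * ?W ^ (j - k)) = 0" using z3 by metis
    then show ?thesis by (simp only: T_def mult_zero_right)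
  qed
  have "\<phi> ((msmult q (var 2) + ?W) ^ j) = (\<Sum>k\<le>j. T k)"
    using functional_binomial[OF lin, of 1 q "var 2" ?W j] by (simp add: T_def)
  \<comment> \<open>Padding with vanishing binomial coefficients makes the cut at k = 2 meaningful
    for j < 2 as well.\<close>
  also have "\<dots> = (\<Sum>k\<le>j + 2. T k)"
    by (intro sum.mono_neutral_left) (auto simp: T_def binomial_eq_0)
  also have "\<dots> = (\<Sum>k\<le>2. T k)"
  proof (intro sum.mono_neutral_right ballI)
    fix k assume "k \<in> {..j + 2} - {..2}"
    then show "T k = 0" using T0[of k] by (cases "k \<le> j") (simp_all add: T_def binomial_eq_0)
  qed auto
  also have "\<dots> = poly (ufun \<phi> j 0) p + q * poly (ufun \<phi> j 1) p + q\<^sup>2 * poly (ufun \<phi> j 2) p"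
  proof -
    have "(\<Sum>k\<le>2. T k) = T 0 + T 1 + T 2" by (simp add: numeral_2_eq_2)
    moreover have "T k = q ^ k * poly (ufun \<phi> j k) p" for k
      unfolding T_def poly_ufun[OF lin] by (simp only: mult_ac)
    ultimately show ?thesis by simp
  qed
  finally show ?thesis .
qed

text \<open>Killing the multiples of L^a means that the dual form vanishes to order j + 1 - a at the
  point (u, c). Its restriction to the line z = c + b (y - u) is therefore divisible by (y -
  u)^(j+1-a); the slopes b = 0, 1, -1 separate the three Taylor coefficients in z, which requires 2
  to be invertible.\<close>

lemma ufun_multiplicity:
  fixes u c :: "'k::field_char_0"
  assumes lin: "functional \<phi>"
    and z3: "\<And>g. g \<in> homR (int j - 3) \<Longrightarrow> \<phi> (var 2 ^ 3 * g) = 0"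
    and La: "\<And>g. g \<in> homR (int j - int a) \<Longrightarrow> \<phi> ((msmult c (var 2) + (msmult u (var 1) + var 0)) ^ a * g) = 0"
  shows "[:-u, 1:] ^ (j + 1 - a) dvd ufun \<phi> j 0 + Polynomial.smult c (ufun \<phi> j 1) + Polynomial.smult (c\<^sup>2) (ufun \<phi> j 2)" (is "?v ^ ?m dvd ?A0")
    and "[:-u, 1:] ^ (j - a) dvd ufun \<phi> j 1 + Polynomial.smult (2 * c) (ufun \<phi> j 2)" (is "_ dvd ?A1")
    and "[:-u, 1:] ^ (j - 1 - a) dvd ufun \<phi> j 2"
proof -
  let ?L = "msmult c (var 2) + (msmult u (var 1) + var 0) :: 'k mpoly"
  have L: "?L \<in> homR 1"
    by (intro add_homR scale_homR var_homR) auto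
  have main: "?v ^ ?m dvd ?A0 + Polynomial.smult b (?v * ?A1) + Polynomial.smult (b\<^sup>2) (?v\<^sup>2 * ufun \<phi> j 2)" (is "_ dvd ?E") for b
  proof -
    let ?M = "msmult b (var 2) + var 1 :: 'k mpoly"
    have M: "?M \<in> homR 1"
      by (intro add_homR scale_homR var_homR) auto
    \<comment> \<open>These are the Taylor coefficients at y = u along the line of slope b; those
      with k < j + 1 - a still contain the factor L^a.\<close>
    define T where "T = (\<lambda>k. of_nat (j choose k) * \<phi> (?L ^ (j - k) * ?M ^ k))"
    have T0: "T k = 0" if "k < ?m" "k \<le> j" for k
    proof -
      have "?L ^ (j - k - a) * ?M ^ k \<in> homR (int (j - k - a) * 1 + int k * 1)"
        by (intro homR_mult homR_power L M)
      moreover have "int (j - k - a) * 1 + int k * 1 = int j - int a" using that by simp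
      moreover have "a \<le> j - k" using that by simp
      then have "?L ^ (j - k) * ?M ^ k = ?L ^ a * (?L ^ (j - k - a) * ?M ^ k)"
        by (simp only: power_split[of a "j - k"] mult.assoc)
      ultimately have "\<phi> (?L ^ (j - k) * ?M ^ k) = 0" using La by metis
      then show ?thesis by (simp only: T_def mult_zero_right)
    qed
    have v: "poly ?v x = x - u" for x by simp
    have "poly ?E x = poly (\<Sum>k\<le>j. Polynomial.smult (T k) (?v ^ k)) x" for x
    proof -
      have "poly ?E x = poly (ufun \<phi> j 0) x + (c + (x - u) * b) * poly (ufun \<phi> j 1) x + (c + (x - u) * b)\<^sup>2 * poly (ufun \<phi> j 2) x"
        unfolding poly_add poly_smult poly_mult poly_power v by algebra
      also have "\<dots> = \<phi> ((msmult (c + (x - u) * b) (var 2) + (msmult x (var 1) + var 0)) ^ j)"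
        by (rule functional_point_power[OF lin z3, symmetric])
      also have "msmult (c + (x - u) * b) (var 2) + (msmult x (var 1) + var 0) = msmult (x - u) ?M + ?L"
        by (rule poly_mapping_eqI) (simp only: lookup_msmult lookup_add, simp only: ring_distribs add_ac mult_ac, simp)
      also have "\<phi> ((msmult (x - u) ?M + ?L) ^ j) = (\<Sum>k\<le>j. T k * (x - u) ^ k)"
        using functional_binomial[OF lin, of 1 "x - u" ?M ?L j]
        unfolding T_def mult_1 by (simp only: mult_ac)
      also have "\<dots> = poly (\<Sum>k\<le>j. Polynomial.smult (T k) (?v ^ k)) x"
        by (simp add: poly_sum)
      finally show ?thesis .
    qed
    then have "poly ?E = poly (\<Sum>k\<le>j. Polynomial.smult (T k) (?v ^ k))" by blast
    then have E: "?E = (\<Sum>k\<le>j. Polynomial.smult (T k) (?v ^ k))" using poly_eq_poly_eq_iff by blast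
    show ?thesis unfolding E
    proof (rule dvd_sum)
      fix k assume "k \<in> {..j}"
      then show "?v ^ ?m dvd Polynomial.smult (T k) (?v ^ k)"
        using T0[of k] by (cases "k < ?m") (simp_all only: atMost_iff smult_0_left dvd_0_right, simp only: not_less dvd_smult le_imp_power_dvd)
    qed
  qed
  have E0: "?v ^ ?m dvd ?A0" using main[of 0] by simp
  define D F where "D = ?v * ?A1" and "F = ?v\<^sup>2 * ufun \<phi> j 2"
  have E1: "?v ^ ?m dvd ?A0 + D + F" using main[of 1, folded D_def F_def] by simp
  have E2: "?v ^ ?m dvd ?A0 - D + F" using main[of "-1", folded D_def F_def] by simp
  have cancel: "?v ^ ?m dvd p" if "?v ^ ?m dvd p + p" for p
  proof -
    have "p + p = Polynomial.smult 2 p" by (metis one_add_one smult_1_left smult_add_left)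
    then show ?thesis using that dvd_smult_cancel[of _ 2 p] by simp
  qed
  have "(?A0 + D + F) - (?A0 - D + F) = D + D" "?A0 + D + F + (?A0 - D + F) - (?A0 + ?A0) = F + F"
    by (simp_all only: algebra_simps)
  then have DF: "?v ^ ?m dvd D" "?v ^ ?m dvd F"
    using cancel dvd_diff[OF E1 E2] dvd_diff[OF dvd_add[OF E1 E2] dvd_add[OF E0 E0]] by metis+
  show "?v ^ ?m dvd ?A0" by (rule E0)
  show "?v ^ (j - a) dvd ?A1"
  proof (cases "j \<le> a")
    case False
    then have "?v ^ ?m = ?v * ?v ^ (j - a)" by (simp add: Suc_diff_le flip: power_Suc)
    then show ?thesis using DF(1) unfolding D_def by (metis dvd_times_left_cancel_iff pCons_eq_0_iff zero_neq_one)
  qed simp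
  show "?v ^ (j - 1 - a) dvd ufun \<phi> j 2"
  proof (cases "j \<le> a + 1")
    case False
    then have "?m = 2 + (j - 1 - a)" by simp
    then have "?v ^ ?m = ?v\<^sup>2 * ?v ^ (j - 1 - a)" by (metis power_add)
    moreover have "?v\<^sup>2 \<noteq> 0" by simp
    ultimately show ?thesis using DF(2) unfolding F_def by (metis dvd_times_left_cancel_iff)
  qed simp
qed

lemma poly_zero_by_divisor:
  fixes p B :: "'k::field poly"
  assumes "B dvd p" "\<And>n. n \<ge> degree B \<Longrightarrow> coeff p n = 0" shows "p = 0"
  using assms by (metis dvd_imp_degree_le leading_coeff_0_iff)

lemma prod_powers_dvd:
  fixes u :: "'i \<Rightarrow> 'k::field"
  assumes "finite X" "inj_on u X" "\<And>i. i \<in> X \<Longrightarrow> [:- u i, 1:] ^ w i dvd f"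
  shows "(\<Prod>i\<in>X. [:- u i, 1:] ^ w i) dvd f"
  using assms
proof (induction X arbitrary: f rule: finite_induct)
  case (insert i X)
  obtain g where g: "f = [:- u i, 1:] ^ w i * g" using insert.prems by (meson dvdE insertI1)
  have "[:- u k, 1:] ^ w k dvd g" if k: "k \<in> X" for k
  proof (cases "g = 0")
    case False
    have "u i \<noteq> u k" using insert.hyps insert.prems(1) k by (auto simp: inj_on_def)
    then have "order (u k) ([:- u i, 1:] ^ w i) = 0" by (intro order_0I) simp
    moreover have "f \<noteq> 0" using g False by simp
    then have "w k \<le> order (u k) f" using insert.prems(2)[of k] k by (simp add: order_divides)
    ultimately have "w k \<le> order (u k) g"
      using order_mult[of "[:- u i, 1:] ^ w i" g "u k"] g \<open>f \<noteq> 0\<close> by simp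
    then show ?thesis using order_divides by blast
  qed simp
  then have "(\<Prod>i\<in>X. [:- u i, 1:] ^ w i) dvd g"
    using insert.IH insert.prems(1) by simp
  then show ?case using insert.hyps g by (simp add: mult_dvd_mono)
qed simp

lemma degree_prod_powers:
  fixes u :: "'i \<Rightarrow> 'k::field"
  shows "degree (\<Prod>i\<in>X. [:- u i, 1:] ^ w i) = (\<Sum>i\<in>X. w i)"
  by (subst degree_prod_eq_sum_degree) (simp_all add: degree_power_eq)

text \<open>In the basis (1-z)^2, z(1-z), z^2 the conic bundle f0 + f1 z + f2 z^2 has coefficients
  f0, f1 + 2 f0 and f0 + f1 + f2, and points at z = 0 and z = 1 impose divisibility conditions on
  each of them separately.\<close>
lemma conic_bundle_zero:
  fixes f0 f1 f2 :: "'k::field poly"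
  assumes c: "\<And>n. n > j \<Longrightarrow> coeff f0 n = 0" "\<And>n. n \<ge> j \<Longrightarrow> coeff f1 n = 0" "\<And>n. n + 1 \<ge> j \<Longrightarrow> coeff f2 n = 0"
    and B: "B0 dvd f0" "Bq dvd f1 + Polynomial.smult 2 f0" "B1 dvd f0 + f1 + f2"
    and d: "degree B0 \<ge> j + 1"
      "degree B1 \<ge> j \<and> degree Bq + 1 \<ge> j \<or> degree Bq \<ge> j \<and> degree B1 + 1 \<ge> j"
  shows "f0 = 0 \<and> f1 = 0 \<and> f2 = 0"
proof -
  have f0: "f0 = 0" by (rule poly_zero_by_divisor[OF B(1)]) (use c(1) d(1) in auto)
  have Bq: "Bq dvd f1" and B1: "B1 dvd f1 + f2" using B f0 by auto
  \<comment> \<open>Either f1 + f2 vanishes first, and then f1 = -f2 inherits the smaller degree of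
    f2, or f1 vanishes first and f2 alone remains. In both cases the second divisor may have one
    degree less.\<close>
  from d(2) show ?thesis
  proof
    assume d: "degree B1 \<ge> j \<and> degree Bq + 1 \<ge> j"
    have g: "f1 + f2 = 0" by (rule poly_zero_by_divisor[OF B1]) (use c d in auto)
    have "coeff f1 n = 0" if "n + 1 \<ge> j" for n
      using c(3)[OF that] arg_cong[OF g, of "\<lambda>p. coeff p n"] by simp
    then have "f1 = 0" by (intro poly_zero_by_divisor[OF Bq]) (use d in auto)
    then show ?thesis using g f0 by simp
  next
    assume d: "degree Bq \<ge> j \<and> degree B1 + 1 \<ge> j"
    have f1: "f1 = 0" by (rule poly_zero_by_divisor[OF Bq]) (use c d in auto)
    have "f2 = 0" by (rule poly_zero_by_divisor[of B1]) (use B1 f1 c d in auto)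
    then show ?thesis using f1 f0 by simp
  qed
qed

lemma functional_zero_if_ufun_zero:
  fixes \<phi> :: "'k::field_char_0 mpoly \<Rightarrow> 'k"
  assumes lin: "functional \<phi>"
    and z3: "\<And>g. g \<in> homR (int j - 3) \<Longrightarrow> \<phi> (var 2 ^ 3 * g) = 0"
    and "ufun \<phi> j 0 = 0 \<and> ufun \<phi> j 1 = 0 \<and> ufun \<phi> j 2 = 0" "f \<in> homR (int j)"
  shows "\<phi> f = 0"
proof (rule homR_functional_zero[OF lin _ assms(4)])
  fix a b c assume abc: "a + b + c = j"
  show "\<phi> (var 0 ^ a * var 1 ^ b * var 2 ^ c) = 0"
  proof (cases "c \<le> 2")
    case True
    then have "c = 0 \<or> c = 1 \<or> c = 2" by auto
    then have "ufun \<phi> j c = 0" using assms(3) by metis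
    then have "coeff (ufun \<phi> j c) b = 0" by simp
    moreover have "j - c - b = a" "b \<le> j - c" "c \<le> j" using abc by auto
    ultimately show ?thesis by (simp add: coeff_ufun)
  next
    case False
    then obtain c' where c: "c = c' + 3" by (metis add.commute le_add_diff_inverse not_less_eq_eq numeral_3_eq_3 numeral_2_eq_2)
    have "var 0 ^ a * var 1 ^ b * var 2 ^ c' \<in> homR (int j - 3)"
      unfolding single_monom3[symmetric] by (rule single_homR) (use abc c in \<open>auto simp: mons_iff intro!: exI\<close>)
    moreover have "var 0 ^ a * var 1 ^ b * var 2 ^ c = var 2 ^ 3 * (var 0 ^ a * var 1 ^ b * var 2 ^ c' :: 'k mpoly)"
      unfolding c by (simp only: power_add mult_ac)
    ultimately show ?thesis using z3 by metis
  qed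
qed

lemma linform_affine:
  "C 0 = 1 \<Longrightarrow> linform C = msmult (C 2) (var 2) + (msmult (C 1) (var 1) + var 0)"
  by (simp add: linform_eq add_ac)

lemma ufun_coeff_bounds:
  "n > j \<Longrightarrow> coeff (ufun \<phi> j 0) n = 0" "n \<ge> j \<Longrightarrow> coeff (ufun \<phi> j 1) n = 0"
  "n + 1 \<ge> j \<Longrightarrow> coeff (ufun \<phi> j 2) n = 0"
  by (cases j; auto simp: coeff_ufun binomial_eq_0)+

text \<open>With m = j + 1 - a i, a point on z = 0 contributes m, m - 1, m - 2 roots to the three
  coefficients in the adapted basis, and a point on z = 1 contributes m - 2, m - 1, m. The
  hypotheses \<open>b\<close> are the resulting degrees needed by
  \<open>conic_bundle_zero\<close>.\<close>

lemma functional_zero_triple: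
  fixes \<phi> :: "'k::field_char_0 mpoly \<Rightarrow> 'k"
  assumes lin: "functional \<phi>" and X: "finite X" "inj_on (\<lambda>i. C i 1) X"
    and C: "\<And>i. i \<in> X \<Longrightarrow> C i 0 = 1" "\<And>i. i \<in> X \<Longrightarrow> C i 2 = (if i \<in> Z then 0 else 1)"
    and z3: "\<And>g. g \<in> homR (int j - 3) \<Longrightarrow> \<phi> (var 2 ^ 3 * g) = 0"
    and La: "\<And>i g. i \<in> X \<Longrightarrow> g \<in> homR (int j - int (a i)) \<Longrightarrow> \<phi> (linform (C i) ^ a i * g) = 0"
    and b: "(\<Sum>i\<in>X. if i \<in> Z then j + 1 - a i else j - 1 - a i) \<ge> j + 1"
      "(\<Sum>i\<in>X. if i \<in> Z then j - 1 - a i else j + 1 - a i) \<ge> j \<and> (\<Sum>i\<in>X. j - a i) + 1 \<ge> j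
       \<or> (\<Sum>i\<in>X. j - a i) \<ge> j \<and> (\<Sum>i\<in>X. if i \<in> Z then j - 1 - a i else j + 1 - a i) + 1 \<ge> j"
    and f: "f \<in> homR (int j)"
  shows "\<phi> f = 0"
proof -
  let ?u = "\<lambda>i. C i 1" and ?f = "ufun \<phi> j"
  let ?P = "\<lambda>w. \<Prod>i\<in>X. [:- ?u i, 1:] ^ w i"
  define w0 wq w1 where "w0 = (\<lambda>i. if i \<in> Z then j + 1 - a i else j - 1 - a i)"
    and "wq = (\<lambda>i. j - a i)" and "w1 = (\<lambda>i. if i \<in> Z then j - 1 - a i else j + 1 - a i)"
  have "[:- ?u i, 1:] ^ w0 i dvd ?f 0 \<and> [:- ?u i, 1:] ^ wq i dvd ?f 1 + Polynomial.smult 2 (?f 0)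
      \<and> [:- ?u i, 1:] ^ w1 i dvd ?f 0 + ?f 1 + ?f 2" if i: "i \<in> X" for i
  proof -
    let ?v = "[:- ?u i, 1:]"
    have L: "linform (C i) = msmult (C i 2) (var 2) + (msmult (C i 1) (var 1) + var 0)"
      using linform_affine C(1)[OF i] by blast
    note m = ufun_multiplicity[where j = j and a = "a i" and c = "C i 2" and u = "C i 1", OF lin z3 La[OF i, unfolded L]]
    have le: "?v ^ (j - a i) dvd ?v ^ (j + 1 - a i)" "?v ^ (j - 1 - a i) dvd ?v ^ (j - a i)"
      by (auto intro!: le_imp_power_dvd)
    show ?thesis
    proof (cases "i \<in> Z")
      case True
      then have A: "?v ^ (j + 1 - a i) dvd ?f 0" "?v ^ (j - a i) dvd ?f 1" "?v ^ (j - 1 - a i) dvd ?f 2"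
        using m C(2)[OF i] by simp_all
      have "?v ^ (j - a i) dvd ?f 0" using dvd_trans[OF le(1) A(1)] .
      moreover have "?v ^ (j - 1 - a i) dvd ?f 0" "?v ^ (j - 1 - a i) dvd ?f 1"
        using dvd_trans[OF le(2)] calculation A(2) by blast+
      ultimately show ?thesis using A True by (simp add: w0_def wq_def w1_def dvd_smult)
    next
      case False
      then have A: "?v ^ (j + 1 - a i) dvd ?f 0 + ?f 1 + ?f 2" "?v ^ (j - a i) dvd ?f 1 + Polynomial.smult 2 (?f 2)" "?v ^ (j - 1 - a i) dvd ?f 2"
        using m C(2)[OF i] by simp_all
      \<comment> \<open>Both are rewritten in the Taylor coefficients at z = 1, namely f0 + f1 + f2,
        f1 + 2 f2 and f2.\<close>
      have q: "?f 1 + Polynomial.smult 2 (?f 0) = Polynomial.smult 2 (?f 0 + ?f 1 + ?f 2) - (?f 1 + Polynomial.smult 2 (?f 2))"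
        "?f 0 = (?f 0 + ?f 1 + ?f 2) + ?f 2 - (?f 1 + Polynomial.smult 2 (?f 2))"
        by (rule poly_eqI, simp only: coeff_add coeff_diff coeff_smult, simp only: algebra_simps, simp)+
      have B: "?v ^ (j - a i) dvd ?f 0 + ?f 1 + ?f 2" using dvd_trans[OF le(1) A(1)] .
      then have "?v ^ (j - a i) dvd ?f 1 + Polynomial.smult 2 (?f 0)"
        unfolding q(1) using A(2) by (intro dvd_diff dvd_smult)
      moreover have "?v ^ (j - 1 - a i) dvd ?f 0"
        by (subst q(2)) (intro dvd_diff dvd_add A(3) dvd_trans[OF le(2)] B A(2))
      ultimately show ?thesis using A False by (simp add: w0_def wq_def w1_def)
    qed
  qed
  then have dv: "?P w0 dvd ?f 0" "?P wq dvd ?f 1 + Polynomial.smult 2 (?f 0)" "?P w1 dvd ?f 0 + ?f 1 + ?f 2"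
    using prod_powers_dvd[of X ?u, OF X] by blast+
  have "?f 0 = 0 \<and> ?f 1 = 0 \<and> ?f 2 = 0"
    by (rule conic_bundle_zero[OF ufun_coeff_bounds dv])
      (use b in \<open>auto simp: degree_prod_powers w0_def wq_def w1_def\<close>)
  then show ?thesis using functional_zero_if_ufun_zero[OF lin z3 _ f] by blast
qed

text \<open>The case of two variables: modulo z only the coefficient f0 survives, of degree at most
  j, and it has more than j prescribed roots counted with multiplicity.\<close>

lemma functional_zero_simple:
  fixes \<phi> :: "'k::field_char_0 mpoly \<Rightarrow> 'k"
  assumes lin: "functional \<phi>" and X: "finite X" "inj_on (\<lambda>i. C i 1) X"
    and C: "\<And>i. i \<in> X \<Longrightarrow> C i 0 = 1"
    and z1: "\<And>g. g \<in> homR (int j - 1) \<Longrightarrow> \<phi> (var 2 * g) = 0"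
    and La: "\<And>i g. i \<in> X \<Longrightarrow> g \<in> homR (int j - int (a i)) \<Longrightarrow> \<phi> (linform (C i) ^ a i * g) = 0"
    and b: "(\<Sum>i\<in>X. j + 1 - a i) \<ge> j + 1" and f: "f \<in> homR (int j)"
  shows "\<phi> f = 0"
proof -
  let ?u = "\<lambda>i. C i 1" and ?f = "ufun \<phi> j"
  have z3: "\<phi> (var 2 ^ 3 * g) = 0" if "g \<in> homR (int j - 3)" for g
  proof -
    have "var 2 ^ 2 * g \<in> homR (int 2 + (int j - 3))" by (intro homR_mult var_power_homR that) simp
    then have "\<phi> (var 2 * (var 2 ^ 2 * g)) = 0" by (intro z1) simp
    then show ?thesis by (simp add: power3_eq_cube power2_eq_square mult_ac)
  qed
  have z: "?f k = 0" if k: "k > 0" for k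
  proof (rule poly_eqI)
    fix n
    have "\<phi> (var 0 ^ (j - k - n) * var 1 ^ n * var 2 ^ k) = 0" if nk: "n \<le> j - k" "k \<le> j"
    proof -
      have "var 0 ^ (j - k - n) * var 1 ^ n * var 2 ^ (k - 1) \<in> homR (int j - 1)"
        unfolding single_monom3[symmetric] by (rule single_homR) (use nk k in \<open>auto simp: mons_iff intro!: exI\<close>)
      moreover have "var 0 ^ (j - k - n) * var 1 ^ n * var 2 ^ k = var 2 * (var 0 ^ (j - k - n) * var 1 ^ n * var 2 ^ (k - 1) :: 'k mpoly)"
        using k by (cases k) (simp_all only: power_Suc mult_ac diff_Suc_1)
      ultimately show ?thesis using z1 by metis
    qed
    then show "coeff (?f k) n = coeff 0 n" by (cases "k \<le> j") (auto simp: coeff_ufun binomial_eq_0 simp del: diff_diff_left)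
  qed
  have "[:- ?u i, 1:] ^ (j + 1 - a i) dvd ?f 0" if i: "i \<in> X" for i
  proof -
    have L: "linform (C i) = msmult (C i 2) (var 2) + (msmult (C i 1) (var 1) + var 0)"
      using linform_affine C(1)[OF i] by blast
    have "?f 1 = 0" "?f 2 = 0" using z by simp_all
    then show ?thesis
      using ufun_multiplicity(1)[where j = j and a = "a i" and c = "C i 2" and u = "C i 1", OF lin z3 La[OF i, unfolded L]]
      by (simp only: smult_0_right add_0_right)
  qed
  then have dv: "(\<Prod>i\<in>X. [:- ?u i, 1:] ^ (j + 1 - a i)) dvd ?f 0" by (rule prod_powers_dvd[of X ?u, OF X])
  have "coeff (?f 0) n = 0" if "n \<ge> degree (\<Prod>i\<in>X. [:- ?u i, 1:] ^ (j + 1 - a i))" for n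
  proof (rule ufun_coeff_bounds(1))
    show "j < n" using that b unfolding degree_prod_powers by linarith
  qed
  then have "?f 0 = 0" by (rule poly_zero_by_divisor[OF dv])
  then show ?thesis using functional_zero_if_ufun_zero[OF lin z3 _ f] z by simp
qed

subsection \<open>Configurations on two sections\<close>

definition pwr :: "(nat \<Rightarrow> nat \<Rightarrow> 'k::field) \<Rightarrow> (nat \<Rightarrow> nat) \<Rightarrow> nat \<Rightarrow> 'k mpoly" where
  "pwr C a i = linform (C i) ^ a i"

definition zvec :: "nat \<Rightarrow> 'k::field" where
  "zvec k = (if k = 2 then 1 else 0)"

lemma linform_zvec: "linform zvec = var 2"
  by (simp add: linform_eq zvec_def)

lemma pwr_homR: "pwr C a i \<in> homR (int (a i))"
  by (simp add: pwr_def linform_power_homR)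

lemma psum_pwr_homR: "psum X (pwr C a) a j \<subseteq> homR j"
  by (rule psum_homR) (rule pwr_homR)

lemma psum_pwr_cong:
  assumes "\<And>i. i \<in> X \<Longrightarrow> C i = D i" "\<And>i. i \<in> X \<Longrightarrow> a i = b i"
  shows "psum X (pwr C a) a j = psum X (pwr D b) b j"
  by (rule psum_cong) (simp_all add: pwr_def assms)

lemma full_if_functionals_zero:
  fixes V :: "'k::field mpoly set"
  assumes "mp.subspace V"
    "\<And>(\<phi> :: 'k mpoly \<Rightarrow> 'k) w. functional \<phi> \<Longrightarrow> (\<And>v. v \<in> V \<Longrightarrow> \<phi> v = 0) \<Longrightarrow> w \<in> homR j \<Longrightarrow> \<phi> w = 0"
  shows "homR j \<subseteq> V"
proof
  fix w :: "'k mpoly" assume w: "w \<in> homR j"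
  show "w \<in> V"
  proof (rule ccontr)
    assume "w \<notin> V"
    then obtain \<phi> where "functional \<phi>" "\<And>v. v \<in> V \<Longrightarrow> \<phi> v = 0" "\<phi> w = 1"
      using separating_functional[OF assms(1)] by metis
    then show False using assms(2)[of \<phi> w] w by simp
  qed
qed

text \<open>The lines through the point of \<open>q\<close> account for the sum of the j - 1 - a i,
  and \<open>d\<close> is the residual degree. \<open>S0\<close> and \<open>S1\<close> are the
  residual double points on the sections z = 0 and z = 1, \<open>P0\<close> and \<open>P1\<close>
  the simple ones.\<close>

lemma psum_full_triple:
  fixes C :: "nat \<Rightarrow> nat \<Rightarrow> 'k::field_char_0"
  assumes Y: "finite Y" "q \<notin> Y"
    and C: "\<And>i. i \<in> Y \<Longrightarrow> C i 0 = 1" "\<And>i. i \<in> Y \<Longrightarrow> C i 1 = of_nat i"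
      "\<And>i. i \<in> Y \<Longrightarrow> C i 2 = (if i \<in> Z then 0 else 1)" "C q = zvec"
    and a: "a q = 3" "\<And>i. i \<in> Y \<Longrightarrow> a i \<le> j"
    and d: "d + (\<Sum>i\<in>Y. j - 1 - a i) = j"
    and s: "S0 = {i\<in>Y. i \<in> Z \<and> a i < j}" "S1 = {i\<in>Y. i \<notin> Z \<and> a i < j}"
      "P0 = {i\<in>Y. i \<in> Z \<and> a i = j}" "P1 = {i\<in>Y. i \<notin> Z \<and> a i = j}"
    and b: "2 * card S0 + card P0 \<ge> d + 1"
      "2 * card S1 + card P1 \<ge> d \<and> card S0 + card S1 + 1 \<ge> d
        \<or> card S0 + card S1 \<ge> d \<and> 2 * card S1 + card P1 + 1 \<ge> d"
  shows "(homR (int j) :: 'k mpoly set) \<subseteq> psum (insert q Y) (pwr C a) a (int j)"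
proof (rule full_if_functionals_zero)
  let ?V = "psum (insert q Y) (pwr C a) a (int j)"
  show "mp.subspace ?V" using Y by (intro subspace_psum) simp
  fix \<phi> :: "'k mpoly \<Rightarrow> 'k" and w :: "'k mpoly"
  assume lin: "functional \<phi>" and V: "\<And>v. v \<in> ?V \<Longrightarrow> \<phi> v = 0" and w: "w \<in> homR (int j)"
  have gen: "pwr C a i * g \<in> ?V" if "i \<in> insert q Y" "g \<in> homR (int j - int (a i))" for i g
    using psum_gen[of "insert q Y" i g "int j" a "pwr C a"] Y that by simp
  have card: "card S0 = (\<Sum>i\<in>Y. if i \<in> Z \<and> a i < j then 1 else 0)" "card S1 = (\<Sum>i\<in>Y. if i \<notin> Z \<and> a i < j then 1 else 0)"
    "card P0 = (\<Sum>i\<in>Y. if i \<in> Z \<and> a i = j then 1 else 0)" "card P1 = (\<Sum>i\<in>Y. if i \<notin> Z \<and> a i = j then 1 else 0)"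
    unfolding s using Y(1) by (simp_all add: sum.If_cases Int_def conj_commute)
  have "(\<Sum>i\<in>Y. if i \<in> Z then j + 1 - a i else j - 1 - a i) = (\<Sum>i\<in>Y. j - 1 - a i) + 2 * card S0 + card P0"
    unfolding card sum_distrib_left sum.distrib[symmetric]
    by (rule sum.cong) (use a(2) in \<open>force+\<close>)
  moreover have "(\<Sum>i\<in>Y. if i \<in> Z then j - 1 - a i else j + 1 - a i) = (\<Sum>i\<in>Y. j - 1 - a i) + 2 * card S1 + card P1"
    unfolding card sum_distrib_left sum.distrib[symmetric]
    by (rule sum.cong) (use a(2) in \<open>force+\<close>)
  moreover have "(\<Sum>i\<in>Y. j - a i) = (\<Sum>i\<in>Y. j - 1 - a i) + card S0 + card S1"
    unfolding card sum.distrib[symmetric] by (rule sum.cong) auto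
  ultimately have bb: "(\<Sum>i\<in>Y. if i \<in> Z then j + 1 - a i else j - 1 - a i) \<ge> j + 1"
      "(\<Sum>i\<in>Y. if i \<in> Z then j - 1 - a i else j + 1 - a i) \<ge> j \<and> (\<Sum>i\<in>Y. j - a i) + 1 \<ge> j
       \<or> (\<Sum>i\<in>Y. j - a i) \<ge> j \<and> (\<Sum>i\<in>Y. if i \<in> Z then j - 1 - a i else j + 1 - a i) + 1 \<ge> j"
    using b d by linarith+
  show "\<phi> w = 0"
  proof (rule functional_zero_triple[OF lin Y(1) _ C(1) C(3) _ _ bb w])
    show "inj_on (\<lambda>i. C i 1) Y" by (rule inj_onI) (simp add: C(2) del: One_nat_def)
    show "\<phi> (var 2 ^ 3 * g) = 0" if "g \<in> homR (int j - 3)" for g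
      using V[OF gen[of q g]] that a C(4) by (simp add: pwr_def linform_zvec)
    show "\<phi> (linform (C i) ^ a i * g) = 0" if "i \<in> Y" "g \<in> homR (int j - int (a i))" for i g
      using V[OF gen[of i g]] that by (simp add: pwr_def)
  qed
qed

text \<open>The bound is the dimension of the system of degree d curves with a (d-2)-fold point and
  A double points, left over after splitting off the lines through the (d-2)-fold point.\<close>
definition excess :: "nat \<Rightarrow> nat \<Rightarrow> nat" where
  "excess d A = (if d > A then 3 * (d - A) else if d = A \<and> even A then 1 else 0)"

lemma fresh_indices:
  assumes "finite X" obtains E :: "nat set" where "finite E" "card E = n" "E \<inter> X = {}"
proof -
  have "infinite (- X)" using assms by simp
  then obtain E where "finite E" "card E = n" "E \<subseteq> - X" using infinite_arbitrarily_large by blast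
  then show ?thesis using that by blast
qed

text \<open>Forms are added until the system is full. An extra exponent j - 1, a double point,
  raises the dimension by at most dim R_1 = 3, and an extra exponent j, a simple point, by at most
  1; removing them again costs at most \<open>excess\<close>.\<close>

lemma exists_triple_config:
  assumes X: "finite X" "q \<notin> X" and a: "a q = 3" "\<And>i. i \<in> X \<Longrightarrow> a i < j"
    and d: "d + (\<Sum>i\<in>X. j - 1 - a i) = j"
  obtains C :: "nat \<Rightarrow> nat \<Rightarrow> 'k::field_char_0" where
    "\<And>i. i \<in> X \<Longrightarrow> C i 0 = 1 \<and> C i 1 = of_nat i" "C q = zvec"
    "hdim (int j) \<le> kdim (psum (insert q X) (pwr C a) a (int j)) + excess d (card X)"
proof -
  let ?A = "card X"
  \<comment> \<open>There are x new double points and \<open>p0\<close>, \<open>p1\<close> new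
    simple points on z = 0 and z = 1, so that 3 x + p0 + p1 is the excess. For even d > A the double
    points stop at d - 1, because d of them would leave the double curve; the last three conditions
    are spent on simple points.\<close>
  define x where "x = (if d \<le> ?A then 0 else if even d then d - 1 - ?A else d - ?A)"
  define p0 where "p0 = (if even d \<and> ?A \<le> d then 1 else 0::nat)"
  define p1 where "p1 = (if even d \<and> ?A < d then 2 else 0::nat)"
  obtain E where E: "finite E" "card E = x" "E \<inter> insert q X = {}"
    using fresh_indices[of "insert q X" x] X by auto
  obtain F where F: "finite F" "card F = p0" "F \<inter> insert q (X \<union> E) = {}"
    using fresh_indices[of "insert q (X \<union> E)" p0] X E by auto
  obtain H where H: "finite H" "card H = p1" "H \<inter> insert q (X \<union> E \<union> F) = {}"
    using fresh_indices[of "insert q (X \<union> E \<union> F)" p1] X E F by auto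
  let ?D = "X \<union> E"
  have cD: "card ?D = ?A + x" using E X by (subst card_Un_disjoint) auto
  have half: "(?A + x + 1) div 2 \<le> ?A + x" by (cases "?A + x") auto
  \<comment> \<open>The double points are shared evenly by the two sections; an odd one goes to z =
    0, where the degree of f0 to be exceeded is the largest.\<close>
  obtain Z0 where Z0: "Z0 \<subseteq> ?D" "card Z0 = (?A + x + 1) div 2"
    using obtain_subset_with_card_n[of "(?A + x + 1) div 2" ?D] cD half by metis
  define Z where "Z = Z0 \<union> F"
  define b where "b = (\<lambda>i. if i \<in> E then j - 1 else if i \<in> F \<union> H then j else a i)"
  define C :: "nat \<Rightarrow> nat \<Rightarrow> 'k" where
    "C = (\<lambda>i. if i = q then zvec else (\<lambda>k. if k = 0 then 1 else if k = 1 then of_nat i else if i \<in> Z then 0 else 1))"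
  let ?Y = "?D \<union> (F \<union> H)"
  have jpos: "j > 0" if "E \<noteq> {}" using that E d unfolding x_def by (auto split: if_splits)
  have bX: "b i = a i" if "i \<in> insert q X" for i using that E F H by (auto simp: b_def)
  have blt: "b i < j" if "i \<in> ?D" for i
  proof (cases "i \<in> E")
    case True
    then have "j > 0" using jpos by auto
    then show ?thesis using True by (simp add: b_def)
  next
    case False then show ?thesis using that a(2)[of i] bX[of i] by simp
  qed
  have beq: "b i = j" if "i \<in> F \<union> H" for i using that E F H by (auto simp: b_def)
  have dis: "?D \<inter> (F \<union> H) = {}" "F \<inter> H = {}" "q \<notin> ?Y" using E F H X by auto
  have "(\<Sum>i\<in>?Y. j - 1 - b i) = (\<Sum>i\<in>X. j - 1 - b i)"
    by (rule sum.mono_neutral_right) (use X E F H beq in \<open>auto simp: b_def\<close>)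
  also have "\<dots> = (\<Sum>i\<in>X. j - 1 - a i)" by (rule sum.cong) (use bX in auto)
  finally have dY: "d + (\<Sum>i\<in>?Y. j - 1 - b i) = j" using d by simp
  have full: "(homR (int j) :: 'k mpoly set) \<subseteq> psum (insert q ?Y) (pwr C b) b (int j)"
  proof (rule psum_full_triple[where Z = Z and d = d and ?S0.0 = Z0 and ?S1.0 = "?D - Z0" and ?P0.0 = F and ?P1.0 = H, OF _ dis(3)])
    show "finite ?Y" using X E F H by simp
    have "i \<noteq> q" if "i \<in> ?Y" for i using that dis(3) by auto
    then show "C i 0 = 1" "C i 1 = of_nat i" "C i 2 = (if i \<in> Z then 0 else 1)" if "i \<in> ?Y" for i
      using that by (simp_all add: C_def)
    show "C q = zvec" by (simp add: C_def)
    show "b q = 3" using bX[of q] a by simp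
    show "b i \<le> j" if "i \<in> ?Y" for i using that blt[of i] beq[of i] by (auto simp: less_imp_le)
    show "d + (\<Sum>i\<in>?Y. j - 1 - b i) = j" by (rule dY)
    show "Z0 = {i \<in> ?Y. i \<in> Z \<and> b i < j}" "?D - Z0 = {i \<in> ?Y. i \<notin> Z \<and> b i < j}"
      "F = {i \<in> ?Y. i \<in> Z \<and> b i = j}" "H = {i \<in> ?Y. i \<notin> Z \<and> b i = j}"
      using Z0 blt beq dis F by (auto simp: Z_def)
    have c1: "card (?D - Z0) = ?A + x - (?A + x + 1) div 2"
      using Z0 cD X E by (subst card_Diff_subset) (auto intro: finite_subset)
    show "2 * card Z0 + card F \<ge> d + 1"
      unfolding Z0(2) F(2) x_def p0_def by (cases "even d"; cases "d \<le> ?A") (auto, presburger+)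
    show "2 * card (?D - Z0) + card H \<ge> d \<and> card Z0 + card (?D - Z0) + 1 \<ge> d
        \<or> card Z0 + card (?D - Z0) \<ge> d \<and> 2 * card (?D - Z0) + card H + 1 \<ge> d"
      unfolding c1 Z0(2) H(2) x_def p1_def by (cases "even d"; cases "d \<le> ?A") (simp_all, presburger+)
  qed
  let ?EE = "E \<union> (F \<union> H)"
  have un: "insert q ?Y = insert q X \<union> ?EE" by auto
  have "hdim (int j) \<le> kdim (psum (insert q X \<union> ?EE) (pwr C b) b (int j))"
    using kdim_mono[OF full findim_psum] X E F H unfolding un by (simp add: kdim_homR)
  also have "\<dots> \<le> kdim (psum (insert q X) (pwr C b) b (int j)) + (\<Sum>i\<in>?EE. hdim (int j - int (b i)))"
    by (rule kdim_psum_union_le) (use X E F H dis in auto)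
  also have "psum (insert q X) (pwr C b) b (int j) = psum (insert q X) (pwr C a) a (int j)"
    by (rule psum_pwr_cong) (use bX in auto)
  also have "(\<Sum>i\<in>?EE. hdim (int j - int (b i))) = (\<Sum>i\<in>E. hdim (int j - int (b i))) + (\<Sum>i\<in>F \<union> H. hdim (int j - int (b i)))"
    by (rule sum.union_disjoint) (use E F H in auto)
  also have "(\<Sum>i\<in>E. hdim (int j - int (b i))) = (\<Sum>i\<in>E. 3)"
  proof (rule sum.cong[OF refl])
    fix i assume i: "i \<in> E"
    then have "j > 0" using jpos by auto
    then have "int j - int (j - 1) = 1" by simp
    then show "hdim (int j - int (b i)) = 3" using i by (simp add: b_def hdim_1)
  qed
  also have "(\<Sum>i\<in>F \<union> H. hdim (int j - int (b i))) = (\<Sum>i\<in>F \<union> H. 1)"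
    by (rule sum.cong) (use beq in \<open>auto simp: hdim_0\<close>)
  also have "(\<Sum>i\<in>E. 3) + (\<Sum>i\<in>F \<union> H. 1) = excess d ?A"
    using E F H card_Un_disjoint[OF F(1) H(1) dis(2)] unfolding excess_def x_def p0_def p1_def
    by (auto elim!: evenE)
  finally have fin: "hdim (int j) \<le> kdim (psum (insert q X) (pwr C a) a (int j)) + excess d ?A" .
  show ?thesis
  proof (rule that[of C])
    show "C i 0 = 1 \<and> C i 1 = of_nat i" if "i \<in> X" for i using that X by (auto simp: C_def)
    show "C q = zvec" by (simp add: C_def)
  qed (rule fin)
qed

text \<open>The missing roots are supplied by new forms of exponent j, each of which raises the
  dimension by at most one.\<close>

lemma coker_line_bound:
  fixes C :: "nat \<Rightarrow> nat \<Rightarrow> 'k::field_char_0"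
  assumes X: "finite X" "q \<notin> X" and C: "\<And>i. i \<in> X \<Longrightarrow> C i 0 = 1 \<and> C i 1 = of_nat i" "C q = zvec" and a: "a q = 1"
  shows "hdim (int j) \<le> kdim (psum (insert q X) (pwr C a) a (int j)) + (j + 1 - (\<Sum>i\<in>X. j + 1 - a i))"
proof -
  let ?x = "j + 1 - (\<Sum>i\<in>X. j + 1 - a i)"
  obtain E where E: "finite E" "card E = ?x" "E \<inter> insert q X = {}"
    using fresh_indices[of "insert q X" ?x] X by auto
  define b where "b = (\<lambda>i. if i \<in> E then j else a i)"
  define D where "D = (\<lambda>i. if i \<in> E then (\<lambda>k. if k = 0 then 1 else if k = 1 then of_nat i else (0::'k)) else C i)"
  let ?V = "psum (insert q X \<union> E) (pwr D b) b (int j)"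
  have bX: "b i = a i" "D i = C i" if "i \<in> insert q X" for i using that E by (auto simp: b_def D_def)
  have full: "(homR (int j) :: 'k mpoly set) \<subseteq> ?V"
  proof (rule full_if_functionals_zero)
    show "mp.subspace ?V" using X E by (intro subspace_psum) simp
    fix \<phi> :: "'k mpoly \<Rightarrow> 'k" and w :: "'k mpoly"
    assume lin: "functional \<phi>" and V: "\<And>v. v \<in> ?V \<Longrightarrow> \<phi> v = 0" and w: "w \<in> homR (int j)"
    have gen: "pwr D b i * g \<in> ?V" if "i \<in> insert q X \<union> E" "g \<in> homR (int j - int (b i))" for i g
      using psum_gen[of "insert q X \<union> E" i g "int j" b "pwr D b"] X E that by simp
    have D: "D i 0 = 1" "D i 1 = of_nat i" if "i \<in> X \<union> E" for i
      using that C bX(2)[of i] by (auto simp: D_def)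
    show "\<phi> w = 0"
    proof (rule functional_zero_simple[of \<phi> "X \<union> E" D j b, OF lin _ _ D(1) _ _ _ w])
      show "finite (X \<union> E)" using X E by simp
      show "inj_on (\<lambda>i. D i 1) (X \<union> E)" by (rule inj_onI) (simp add: D(2) del: One_nat_def)
      show "\<phi> (var 2 * g) = 0" if "g \<in> homR (int j - 1)" for g
        using V[OF gen[of q g]] that bX[of q] a C(2) by (simp add: pwr_def linform_zvec)
      show "\<phi> (linform (D i) ^ b i * g) = 0" if "i \<in> X \<union> E" "g \<in> homR (int j - int (b i))" for i g
        using V[OF gen[of i g]] that by (auto simp: pwr_def)
      have "(\<Sum>i\<in>X \<union> E. j + 1 - b i) = (\<Sum>i\<in>X. j + 1 - b i) + (\<Sum>i\<in>E. j + 1 - b i)"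
        by (rule sum.union_disjoint) (use X E in auto)
      also have "(\<Sum>i\<in>X. j + 1 - b i) = (\<Sum>i\<in>X. j + 1 - a i)"
        by (rule sum.cong) (use bX in auto)
      also have "(\<Sum>i\<in>E. j + 1 - b i) = card E" by (simp add: b_def)
      finally show "j + 1 \<le> (\<Sum>i\<in>X \<union> E. j + 1 - b i)" using E by simp
    qed
  qed
  have "hdim (int j) \<le> kdim ?V"
    using kdim_mono[OF full findim_psum] X E by (simp add: kdim_homR)
  also have "\<dots> \<le> kdim (psum (insert q X) (pwr D b) b (int j)) + (\<Sum>i\<in>E. hdim (int j - int (b i)))"
    by (rule kdim_psum_union_le) (use X E in auto)
  also have "psum (insert q X) (pwr D b) b (int j) = psum (insert q X) (pwr C a) a (int j)"
    by (rule psum_pwr_cong) (use bX in auto)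
  also have "(\<Sum>i\<in>E. hdim (int j - int (b i))) = card E" by (simp add: b_def hdim_0)
  finally show ?thesis using E by simp
qed

text \<open>A functional vanishing on all j-th powers gives a polynomial function of the point that
  is identically zero. In characteristic zero its coefficients vanish, and these are nonzero
  binomial multiples of the values on monomials.\<close>

lemma powers_span:
  fixes V :: "'k::field_char_0 mpoly set"
  assumes V: "mp.subspace V" "\<And>M. linform M ^ j \<in> V"
  shows "homR (int j) \<subseteq> V"
proof (rule full_if_functionals_zero[OF V(1)])
  fix \<phi> :: "'k mpoly \<Rightarrow> 'k" and w :: "'k mpoly"
  assume lin: "functional \<phi>" and k: "\<And>v. v \<in> V \<Longrightarrow> \<phi> v = 0" and w: "w \<in> homR (int j)"
  have "ufun \<phi> j k = 0" if kj: "k \<le> j" for k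
  proof -
    have "poly (ufun \<phi> j k) p = 0" for p
    proof -
      let ?W = "msmult p (var 1) + var 0 :: 'k mpoly"
      let ?g = "\<Sum>k\<le>j. monom (of_nat (j choose k) * \<phi> (var 2 ^ k * ?W ^ (j - k))) k"
      have "poly ?g q = poly 0 q" for q
      proof -
        let ?M = "\<lambda>k. if k = 0 then 1 else if k = 1 then p else q"
        have "linform ?M = msmult q (var 2) + ?W" by (simp add: linform_eq add_ac)
        then have "0 = \<phi> (1 * (msmult q (var 2) + ?W) ^ j)" using k[OF V(2)[of ?M]] by simp
        also have "\<dots> = poly ?g q"
          unfolding functional_binomial[OF lin, of 1 q "var 2" ?W] poly_sum poly_monom unfolding mult_1
          by (rule sum.cong[OF refl]) (simp only: mult_ac)
        finally show ?thesis by simp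
      qed
      then have "?g = 0" using poly_eq_poly_eq_iff by blast
      then have "coeff ?g k = 0" by simp
      then have "of_nat (j choose k) * \<phi> (var 2 ^ k * ?W ^ (j - k)) = 0" using kj by (simp add: coeff_sum)
      then show ?thesis by (simp only: poly_ufun[OF lin])
    qed
    then show ?thesis using poly_all_0_iff_0 by blast
  qed
  then have "\<phi> (var 0 ^ a * var 1 ^ b * var 2 ^ c) = 0" if "a + b + c = j" for a b c
  proof -
    have "coeff (ufun \<phi> j c) b = 0" using \<open>\<And>k. k \<le> j \<Longrightarrow> ufun \<phi> j k = 0\<close> that by simp
    moreover have "j - c - b = a" "b \<le> j - c" "c \<le> j" using that by auto
    ultimately show ?thesis by (simp add: coeff_ufun)
  qed
  then show "\<phi> w = 0" using homR_functional_zero[OF lin _ w] by blast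
qed

text \<open>As j-th powers span R_j, some power lies outside any proper subspace and raises the
  dimension by one. This accounts for the forms whose exponent equals the degree, which the
  specialization onto two sections leaves out.\<close>

lemma exists_general_powers:
  fixes C :: "nat \<Rightarrow> nat \<Rightarrow> 'k::field_char_0"
  assumes "finite X" "finite Y" "X \<inter> Y = {}" "\<And>i. i \<in> Y \<Longrightarrow> a i = j"
  shows "\<exists>D. (\<forall>i\<in>X. D i = C i) \<and>
    min (hdim (int j)) (kdim (psum X (pwr C a) a (int j)) + card Y) \<le> kdim (psum (X \<union> Y) (pwr D a) a (int j))"
  using assms(2-4)
proof (induction Y rule: finite_induct)
  case empty
  then show ?case by (intro exI[of _ C]) simp
next
  case (insert y Y)
  then obtain D where D: "\<forall>i\<in>X. D i = C i"
    "min (hdim (int j)) (kdim (psum X (pwr C a) a (int j)) + card Y) \<le> kdim (psum (X \<union> Y) (pwr D a) a (int j))"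
    by auto
  let ?V = "psum (X \<union> Y) (pwr D a) a (int j)"
  have fin: "finite (X \<union> Y)" "finite (X \<union> insert y Y)" using assms(1) insert.hyps by auto
  show ?case
  proof (cases "homR (int j) \<subseteq> ?V")
    case True
    have "?V \<subseteq> psum (X \<union> insert y Y) (pwr D a) a (int j)"
      by (rule psum_mono) (use fin in auto)
    then have "homR (int j) \<subseteq> psum (X \<union> insert y Y) (pwr D a) a (int j)" using True by blast
    then have "hdim (int j) \<le> kdim (psum (X \<union> insert y Y) (pwr D a) a (int j))"
      using kdim_mono[OF _ findim_psum[OF fin(2)], of "homR (int j)"] by (simp add: kdim_homR)
    then show ?thesis using D(1) by (intro exI[of _ D]) auto
  next
    case False
    then obtain M where M: "linform M ^ j \<notin> ?V" using powers_span[OF subspace_psum[OF fin(1)]] by blast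
    let ?D = "D(y := M)"
    let ?W = "psum (X \<union> insert y Y) (pwr ?D a) a (int j)"
    have "?V = psum (X \<union> Y) (pwr ?D a) a (int j)"
      by (rule psum_pwr_cong) (use insert in auto)
    also have "\<dots> \<subseteq> ?W" by (rule psum_mono) (use fin in auto)
    finally have VW: "?V \<subseteq> ?W" .
    have "pwr ?D a y * 1 \<in> ?W"
      by (rule psum_gen) (use fin insert.prems homR_one in auto)
    then have "insert (linform M ^ j) ?V \<subseteq> ?W" using VW insert.prems by (simp add: pwr_def)
    then have "mp.span (insert (linform M ^ j) ?V) \<subseteq> ?W"
      by (rule mp.span_minimal[OF _ subspace_psum[OF fin(2)]])
    then have "kdim ?V + 1 \<le> kdim ?W"
      using kdim_mono[OF _ findim_psum[OF fin(2)]] kdim_span_insert[OF findim_psum[OF fin(1)] subspace_psum[OF fin(1)] M] by metis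
    moreover have "card (insert y Y) = card Y + 1" using insert.hyps by simp
    ultimately have "min (hdim (int j)) (kdim (psum X (pwr C a) a (int j)) + card (insert y Y)) \<le> kdim ?W"
      using D(2) by linarith
    moreover have "\<forall>i\<in>X. ?D i = C i" using D(1) insert.prems by auto
    ultimately show ?thesis by blast
  qed
qed

subsection \<open>General points\<close>

definition mval :: "(nat \<Rightarrow>\<^sub>0 nat) \<Rightarrow> (nat \<Rightarrow> 'k::field) \<Rightarrow> 'k" where
  "mval m t = (\<Prod>v\<in>keys m. t v ^ lookup m v)"

lemma mval_eq:
  assumes "finite A" "keys m \<subseteq> A"
  shows "mval m t = (\<Prod>v\<in>A. t v ^ lookup m v)"
  unfolding mval_def by (rule prod.mono_neutral_left) (use assms in \<open>auto simp: in_keys_iff\<close>)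

lemma mval_add: "mval (m + n) t = mval m t * mval n t"
proof -
  let ?A = "keys m \<union> keys n"
  have "mval (m + n) t = (\<Prod>v\<in>?A. t v ^ lookup (m + n) v)"
    by (rule mval_eq) (use keys_add[of m n] in auto)
  also have "\<dots> = (\<Prod>v\<in>?A. t v ^ lookup m v) * (\<Prod>v\<in>?A. t v ^ lookup n v)"
    by (simp add: lookup_add power_add prod.distrib)
  also have "\<dots> = mval m t * mval n t"
    using mval_eq[of ?A m t] mval_eq[of ?A n t] by simp
  finally show ?thesis .
qed

lemma mpeval_eq:
  assumes "finite A" "keys P \<subseteq> A"
  shows "mpeval P t = (\<Sum>m\<in>A. lookup P m * mval m t)"
  unfolding mpeval_def mval_def by (rule sum.mono_neutral_left) (use assms in \<open>auto simp: in_keys_iff\<close>)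

lemma mpeval_single: "mpeval (single m c) t = c * mval m t"
  using mpeval_eq[of "{m}" "single m c" t] by simp

lemma mpeval_add: "mpeval (P + Q) t = mpeval P t + mpeval Q t"
proof -
  let ?A = "keys P \<union> keys Q"
  have "mpeval (P + Q) t = (\<Sum>m\<in>?A. lookup (P + Q) m * mval m t)"
    by (rule mpeval_eq) (use keys_add[of P Q] in auto)
  also have "\<dots> = (\<Sum>m\<in>?A. lookup P m * mval m t) + (\<Sum>m\<in>?A. lookup Q m * mval m t)"
    by (simp add: lookup_add sum.distrib algebra_simps)
  also have "\<dots> = mpeval P t + mpeval Q t"
    using mpeval_eq[of ?A P t] mpeval_eq[of ?A Q t] by simp
  finally show ?thesis .
qed

lemma mpeval_zero: "mpeval 0 t = 0"
  by (simp add: mpeval_def)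

lemma mpeval_sum: "mpeval (sum f A) t = (\<Sum>a\<in>A. mpeval (f a) t)"
  by (induction A rule: infinite_finite_induct) (simp_all add: mpeval_zero mpeval_add)

lemma mpoly_sum_single: "(P :: 'k::field mpoly) = (\<Sum>m\<in>keys P. single m (lookup P m))"
  using mpoly_sum_monomials[of "keys P" P] by (simp add: Defs.smult_def mult_single)

lemma mpeval_mult: "mpeval (P * Q) t = mpeval P t * mpeval Q t"
proof -
  let ?s = "\<lambda>P :: 'a mpoly. \<Sum>m\<in>keys P. single m (lookup P m)"
  have "P * Q = ?s P * ?s Q"
    by (rule arg_cong2[of _ _ _ _ "(*)"]) (rule mpoly_sum_single)+
  also have "\<dots> = (\<Sum>m\<in>keys P. \<Sum>n\<in>keys Q.
      single (m + n) (lookup P m * lookup Q n))"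
    by (simp only: sum_product mult_single)
  finally have PQ: "P * Q = (\<Sum>m\<in>keys P. \<Sum>n\<in>keys Q.
      single (m + n) (lookup P m * lookup Q n))" .
  have "mpeval (P * Q) t = (\<Sum>m\<in>keys P. \<Sum>n\<in>keys Q.
      (lookup P m * mval m t) * (lookup Q n * mval n t))"
    unfolding PQ mpeval_sum mpeval_single mval_add by (simp only: mult_ac)
  also have "\<dots> = mpeval P t * mpeval Q t"
    by (simp add: mpeval_eq[OF finite_keys order_refl] sum_product)
  finally show ?thesis .
qed

definition polyfun :: "nat \<Rightarrow> ((nat \<Rightarrow> 'k::field) \<Rightarrow> 'k) \<Rightarrow> bool" where
  "polyfun n f \<longleftrightarrow> (\<exists>P :: 'k mpoly. (\<forall>m\<in>keys P. keys m \<subseteq> {..<n}) \<and> (\<forall>t. f t = mpeval P t))"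

lemma polyfun_const: "polyfun n (\<lambda>t. c)"
  unfolding polyfun_def by (rule exI[of _ "single 0 c"]) (simp add: mpeval_single mval_def)

lemma polyfun_var: assumes "k < n" shows "polyfun n (\<lambda>t. t k)"
  unfolding polyfun_def
  by (rule exI[of _ "single (single k 1) 1"]) (use assms in \<open>simp add: mpeval_single mval_def\<close>)

lemma polyfun_add: assumes "polyfun n f" "polyfun n g" shows "polyfun n (\<lambda>t. f t + g t)"
proof -
  obtain P Q where "\<forall>m\<in>keys P. keys m \<subseteq> {..<n}" "\<forall>t. f t = mpeval P t"
    "\<forall>m\<in>keys Q. keys m \<subseteq> {..<n}" "\<forall>t. g t = mpeval Q t"
    using assms unfolding polyfun_def by blast
  moreover have "\<forall>m\<in>keys (P + Q). keys m \<subseteq> {..<n}"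
    using calculation keys_add[of P Q] by blast
  ultimately show ?thesis unfolding polyfun_def
    by (intro exI[of _ "P + Q"]) (simp add: mpeval_add)
qed

lemma keys_mult_vars:
  assumes "\<forall>m\<in>keys P. keys m \<subseteq> S" "\<forall>m\<in>keys Q. keys m \<subseteq> S"
  shows "\<forall>m\<in>keys (P * Q :: 'k::field mpoly). keys m \<subseteq> S"
proof
  fix m assume "m \<in> keys (P * Q)"
  then obtain a b where "m = a + b" "a \<in> keys P" "b \<in> keys Q"
    using keys_mult[of P Q] by blast
  then show "keys m \<subseteq> S" using keys_add[of a b] assms by blast
qed

lemma polyfun_mult: assumes "polyfun n f" "polyfun n g" shows "polyfun n (\<lambda>t. f t * g t)"
proof -
  obtain P Q where "\<forall>m\<in>keys P. keys m \<subseteq> {..<n}" "\<forall>t. f t = mpeval P t"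
    "\<forall>m\<in>keys Q. keys m \<subseteq> {..<n}" "\<forall>t. g t = mpeval Q t"
    using assms unfolding polyfun_def by blast
  then show ?thesis unfolding polyfun_def using keys_mult_vars[of P "{..<n}" Q]
    by (intro exI[of _ "P * Q"]) (auto simp: mpeval_mult)
qed

lemma general_polyfun:
  assumes "polyfun n f" "f t0 \<noteq> 0" "\<And>t. f t \<noteq> 0 \<Longrightarrow> Q t" shows "general n Q"
proof -
  obtain P where P: "\<forall>m\<in>keys P. keys m \<subseteq> {..<n}" "\<forall>t. f t = mpeval P t"
    using assms(1) unfolding polyfun_def by blast
  then have "P \<noteq> 0" using assms(2) mpeval_zero by metis
  then show ?thesis unfolding general_def using P assms(3) by metis
qed

lemma general_mono: "general n P \<Longrightarrow> (\<And>t. P t \<Longrightarrow> Q t) \<Longrightarrow> general n Q"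
  unfolding general_def by blast

text \<open>The product of two nonzero polynomials over a field is nonzero, so two nonempty open
  sets meet.\<close>

lemma general_conj:
  assumes "general n P" "general n Q" shows "general n (\<lambda>t. P t \<and> Q t)"
proof -
  obtain A B where *: "A \<noteq> 0" "\<forall>m\<in>keys A. keys m \<subseteq> {..<n}" "\<forall>t. mpeval A t \<noteq> 0 \<longrightarrow> P t"
    "B \<noteq> 0" "\<forall>m\<in>keys B. keys m \<subseteq> {..<n}" "\<forall>t. mpeval B t \<noteq> 0 \<longrightarrow> Q t"
    using assms unfolding general_def by metis
  then show ?thesis unfolding general_def using keys_mult_vars[of A "{..<n}" B]
    by (intro exI[of _ "A * B"]) (auto simp: mpeval_mult)
qed

lemma general_True: "general n (\<lambda>t. True)"
  by (rule general_polyfun[OF polyfun_const, of 1]) auto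

lemma general_ball:
  assumes "finite A" "\<And>a. a \<in> A \<Longrightarrow> general n (Q a)" shows "general n (\<lambda>t. \<forall>a\<in>A. Q a t)"
  using assms
proof (induction A rule: finite_induct)
  case empty then show ?case using general_True by simp
next
  case (insert a A)
  then have "general n (\<lambda>t. Q a t \<and> (\<forall>a\<in>A. Q a t))" by (intro general_conj) auto
  then show ?case by (rule general_mono) auto
qed

section \<open>Semicontinuity of the rank of a polynomial family\<close>

inductive mpoly_family :: "nat \<Rightarrow> ((nat \<Rightarrow> 'k::field) \<Rightarrow> 'k mpoly) \<Rightarrow> bool" for n where
  mpoly_family_single: "polyfun n c \<Longrightarrow> mpoly_family n (\<lambda>t. single m (c t))"
| mpoly_family_add: "mpoly_family n V \<Longrightarrow> mpoly_family n W \<Longrightarrow> mpoly_family n (\<lambda>t. V t + W t)"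

lemma mpoly_family_const_single: "mpoly_family n (\<lambda>t. single m c)"
  by (rule mpoly_family_single) (rule polyfun_const)

lemma mpoly_family_mult:
  assumes "mpoly_family n V" "mpoly_family n W" shows "mpoly_family n (\<lambda>t. V t * W t)"
  using assms(1)
proof induction
  case (mpoly_family_single c m)
  note c = this
  show ?case using assms(2)
  proof induction
    case (mpoly_family_single d m')
    show ?case unfolding mult_single
      by (rule mpoly_family.mpoly_family_single) (rule polyfun_mult[OF c mpoly_family_single])
  next
    case (mpoly_family_add V W)
    then show ?case unfolding distrib_left by (intro mpoly_family.mpoly_family_add)
  qed
next
  case (mpoly_family_add V W)
  then show ?case unfolding distrib_right by (intro mpoly_family.mpoly_family_add)
qed

lemma mpoly_family_power: "mpoly_family n V \<Longrightarrow> mpoly_family n (\<lambda>t. V t ^ k)"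
proof (induction k)
  case 0
  show ?case using mpoly_family_const_single[of n 0 1] by simp
next
  case (Suc k)
  then show ?case unfolding power_Suc by (intro mpoly_family_mult)
qed

lemma mpoly_family_lookup: "mpoly_family n V \<Longrightarrow> polyfun n (\<lambda>t. lookup (V t) m)"
proof (induction rule: mpoly_family.induct)
  case (mpoly_family_single c m')
  then show ?case using polyfun_const[of n 0] by (cases "m' = m") (simp_all add: lookup_single_not_eq)
next
  case (mpoly_family_add V W)
  show ?case unfolding lookup_add by (rule polyfun_add[OF mpoly_family_add.IH])
qed

lemma mpoly_family_msmult:
  assumes "polyfun n c" "mpoly_family n V" shows "mpoly_family n (\<lambda>t. msmult (c t) (V t))"
  unfolding Defs.smult_def by (rule mpoly_family_mult[OF mpoly_family_single[OF assms(1)] assms(2)])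

lemma mpoly_family_diff:
  assumes "mpoly_family n V" "mpoly_family n W" shows "mpoly_family n (\<lambda>t. V t - W t)"
proof -
  have "mpoly_family n (\<lambda>t. V t + msmult (-1) (W t))"
    by (intro mpoly_family_add assms mpoly_family_msmult polyfun_const)
  then show ?thesis by simp
qed

text \<open>Independence of an indexed family, not of its image: members may coincide at special
  parameters, and this has to count as a dependence.\<close>

definition indep_family :: "'i set \<Rightarrow> ('i \<Rightarrow> 'k::field mpoly) \<Rightarrow> bool" where
  "indep_family X v \<longleftrightarrow> (\<forall>x. (\<Sum>k\<in>X. msmult (x k) (v k)) = 0 \<longrightarrow> (\<forall>k\<in>X. x k = 0))"

lemma elimination_sum:
  "(\<Sum>k\<in>X. msmult (x k) (msmult a (v k) - msmult (c k) w)) = msmult a (\<Sum>k\<in>X. msmult (x k) (v k)) - msmult (\<Sum>k\<in>X. x k * c k) w"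
  by (induction X rule: infinite_finite_induct)
    (simp_all add: mp.scale_right_distrib mp.scale_left_distrib mp.scale_right_diff_distrib mult.commute)

text \<open>Fraction-free Gaussian elimination replaces minors. A coefficient of \<open>V r\<close>
  that is nonzero at \<open>t0\<close> serves as pivot; the eliminated family is again polynomial in
  the parameters and is one member shorter.\<close>

lemma general_indep_family:
  assumes "finite X" "\<And>k. k \<in> X \<Longrightarrow> mpoly_family n (V k)" "indep_family X (\<lambda>k. V k t0)"
  shows "general n (\<lambda>t. indep_family X (\<lambda>k. V k t))"
  using assms
proof (induction X arbitrary: V rule: finite_induct)
  case empty
  show ?case using general_True by (simp add: indep_family_def)
next
  case (insert r X)
  have ind: "\<forall>k\<in>insert r X. x k = 0" if "(\<Sum>k\<in>insert r X. msmult (x k) (V k t0)) = 0" for x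
    using insert.prems(2) that unfolding indep_family_def by blast
  have sum_ins: "(\<Sum>k\<in>insert r X. msmult (x k) (V k t)) = msmult (x r) (V r t) + (\<Sum>k\<in>X. msmult (x k) (V k t))" for x t
    using insert.hyps by simp
  have "V r t0 \<noteq> 0"
  proof
    assume "V r t0 = 0"
    then have "(\<Sum>k\<in>insert r X. msmult (if k = r then 1 else 0) (V k t0)) = 0" by (intro sum.neutral) auto
    from ind[OF this] show False by auto
  qed
  then obtain m where m: "lookup (V r t0) m \<noteq> 0" by (metis poly_mapping_eqI lookup_zero)
  let ?a = "\<lambda>t. lookup (V r t) m" and ?c = "\<lambda>k t. lookup (V k t) m"
  let ?W = "\<lambda>k t. msmult (?a t) (V k t) - msmult (?c k t) (V r t)"
  have Vf: "mpoly_family n (V k)" if "k \<in> insert r X" for k using insert.prems(1) that by blast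
  have "general n (\<lambda>t. indep_family X (\<lambda>k. ?W k t))"
  proof (rule insert.IH)
    show "mpoly_family n (?W k)" if "k \<in> X" for k
      using Vf[of r] Vf[of k] that by (intro mpoly_family_diff mpoly_family_msmult mpoly_family_lookup) auto
    show "indep_family X (\<lambda>k. ?W k t0)"
      unfolding indep_family_def elimination_sum
    proof (intro allI impI)
      fix x assume 0: "msmult (?a t0) (\<Sum>k\<in>X. msmult (x k) (V k t0)) - msmult (\<Sum>k\<in>X. x k * ?c k t0) (V r t0) = 0"
      let ?y = "\<lambda>k. if k = r then - (\<Sum>k\<in>X. x k * ?c k t0) else ?a t0 * x k"
      have "(\<Sum>k\<in>X. msmult (?y k) (V k t0)) = msmult (?a t0) (\<Sum>k\<in>X. msmult (x k) (V k t0))"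
        unfolding mp.scale_sum_right by (rule sum.cong) (use insert.hyps in auto)
      then have "(\<Sum>k\<in>insert r X. msmult (?y k) (V k t0)) = 0"
        unfolding sum_ins using 0 by simp
      from ind[OF this] show "\<forall>k\<in>X. x k = 0" using m insert.hyps by (metis insert_iff mult_eq_0_iff)
    qed
  qed
  moreover have "general n (\<lambda>t. ?a t \<noteq> 0)"
    by (rule general_polyfun[of n ?a t0]) (use mpoly_family_lookup Vf m in auto)
  ultimately have "general n (\<lambda>t. indep_family X (\<lambda>k. ?W k t) \<and> ?a t \<noteq> 0)" by (rule general_conj)
  then show ?case
  proof (rule general_mono)
    fix t assume t: "indep_family X (\<lambda>k. ?W k t) \<and> ?a t \<noteq> 0"
    show "indep_family (insert r X) (\<lambda>k. V k t)"
      unfolding indep_family_def sum_ins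
    proof (intro allI impI)
      fix x assume 0: "msmult (x r) (V r t) + (\<Sum>k\<in>X. msmult (x k) (V k t)) = 0"
      then have S: "(\<Sum>k\<in>X. msmult (x k) (V k t)) = msmult (- x r) (V r t)" by (simp add: eq_neg_iff_add_eq_0 add.commute)
      have "(\<Sum>k\<in>X. x k * ?c k t) = lookup (\<Sum>k\<in>X. msmult (x k) (V k t)) m"
        by (simp add: lookup_sum lookup_msmult)
      also have "\<dots> = - x r * ?a t" unfolding S by (simp add: lookup_msmult)
      finally have "(\<Sum>k\<in>X. msmult (x k) (?W k t)) = 0"
        unfolding elimination_sum S by (simp add: mult.commute)
      then have X0: "\<forall>k\<in>X. x k = 0" using t unfolding indep_family_def by blast
      then have "msmult (x r) (V r t) = 0" using 0 by simp
      then have "x r * ?a t = 0" by (metis lookup_msmult lookup_zero)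
      then show "\<forall>k\<in>insert r X. x k = 0" using t X0 by auto
    qed
  qed
qed

lemma indep_family_from_kdim:
  assumes "finite K" "r \<le> kdim (mp.span (f ` K))"
  obtains Y where "Y \<subseteq> K" "card Y = r" "indep_family Y f"
proof -
  obtain B where B: "B \<subseteq> f ` K" "mp.independent B" "f ` K \<subseteq> mp.span B" "card B = mp.dim (f ` K)"
    using mp.basis_exists[of "f ` K"] by metis
  then have "r \<le> card B" using assms by (simp add: kdim_eq)
  then obtain B' where B': "B' \<subseteq> B" "card B' = r" by (metis obtain_subset_with_card_n)
  have finB: "finite B'" using B B' assms(1) by (meson finite_imageI finite_subset)
  have indB': "mp.independent B'" using mp.independent_mono B B' by blast
  let ?g = "inv_into K f"
  have g: "?g b \<in> K" "f (?g b) = b" if "b \<in> B'" for b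
    using that B B' by (auto intro: inv_into_into f_inv_into_f)
  have inj: "inj_on ?g B'" by (rule inj_on_inverseI[of _ f]) (use g in auto)
  show ?thesis
  proof (rule that[of "?g ` B'"])
    show "?g ` B' \<subseteq> K" using g by auto
    show "card (?g ` B') = r" using card_image[OF inj] B' by simp
    show "indep_family (?g ` B') f"
      unfolding indep_family_def
    proof (intro allI impI)
      fix x assume "(\<Sum>k\<in>?g ` B'. msmult (x k) (f k)) = 0"
      then have "(\<Sum>b\<in>B'. msmult (x (?g b)) b) = 0"
        unfolding sum.reindex[OF inj] using g by (simp add: o_def)
      then have "\<forall>b\<in>B'. x (?g b) = 0"
        using mp.independentD[OF indB' finB subset_refl, of "\<lambda>b. x (?g b)"] by blast
      then show "\<forall>k\<in>?g ` B'. x k = 0" by blast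
    qed
  qed
qed

lemma kdim_ge_indep_family:
  fixes f :: "'i \<Rightarrow> 'k::field mpoly"
  assumes "finite Y" "indep_family Y f" "f ` Y \<subseteq> W" "findim W"
  shows "card Y \<le> kdim W"
proof -
  have inj: "inj_on f Y"
  proof (rule inj_onI, rule ccontr)
    fix a b assume ab: "a \<in> Y" "b \<in> Y" "f a = f b" "a \<noteq> b"
    let ?x = "\<lambda>k. if k = a then 1 else if k = b then -1 else 0 :: 'k"
    have "(\<Sum>k\<in>Y. msmult (?x k) (f k)) = (\<Sum>k\<in>{a, b}. msmult (?x k) (f k))"
      by (rule sum.mono_neutral_right) (use assms ab in auto)
    also have "\<dots> = 0" using ab by simp
    finally have "\<forall>k\<in>Y. ?x k = 0"
      using assms(2)[unfolded indep_family_def, THEN spec, of ?x] by blast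
    then show False using ab(1) by auto
  qed
  have "mp.independent (f ` Y)"
  proof (rule mp.independent_if_scalars_zero)
    show "finite (f ` Y)" using assms by simp
    fix g x assume s: "(\<Sum>x\<in>f ` Y. msmult (g x) x) = 0" and x: "x \<in> f ` Y"
    then have "(\<Sum>k\<in>Y. msmult (g (f k)) (f k)) = 0" unfolding sum.reindex[OF inj] by (simp add: o_def)
    then have "\<forall>k\<in>Y. g (f k) = 0"
      using assms(2)[unfolded indep_family_def, THEN spec, of "\<lambda>k. g (f k)"] by blast
    then show "g x = 0" using x by blast
  qed
  obtain B where B: "finite B" "W \<subseteq> mp.span B" "card B = kdim W" using findim_basis[OF assms(4)] by metis
  have "card (f ` Y) \<le> card B"
    using mp.independent_span_bound[OF B(1) \<open>mp.independent (f ` Y)\<close>] assms(3) B by blast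
  then show ?thesis using card_image[OF inj] B by simp
qed

text \<open>Three consecutive parameters per linear form; in the theorem the block with index s
  belongs to L.\<close>

definition cfg :: "(nat \<Rightarrow> 'k) \<Rightarrow> nat \<Rightarrow> nat \<Rightarrow> 'k" where
  "cfg t i k = t (3 * i + k)"

text \<open>At the given configuration \<open>r\<close> of the products generator times monomial are
  independent, and the same products stay independent for general parameters.\<close>

lemma general_kdim_psum:
  fixes C :: "nat \<Rightarrow> nat \<Rightarrow> 'k::field"
  assumes X: "finite X" "\<And>i. i \<in> X \<Longrightarrow> 3 * i + 3 \<le> n"
    and r: "r \<le> kdim (psum X (pwr C a) a j)"
  shows "general n (\<lambda>t :: nat \<Rightarrow> 'k. r \<le> kdim (psum X (pwr (cfg t) a) a j))"
proof -
  let ?K = "SIGMA i:X. mons (j - int (a i))"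
  let ?V = "\<lambda>(i, m) t. pwr (cfg t) a i * single m (1::'k)"
  have fin: "finite ?K" using X finite_mons by blast
  have sp: "psum X (pwr (cfg t) a) a j = mp.span ((\<lambda>k. ?V k t) ` ?K)" for t
    using psum_span[OF X(1), of "pwr (cfg t) a" a j] by (simp add: case_prod_unfold)
  \<comment> \<open>The parameter point at which the polynomial family specializes to the
    configuration \<open>C\<close>.\<close>
  define t0 where "t0 = (\<lambda>m. C (m div 3) (m mod 3))"
  have "linform (cfg t0 i) = linform (C i)" for i
  proof (rule linform_cong)
    have "(3 * i + 1) div 3 = i" "(3 * i + 1) mod 3 = 1" "(3 * i + 2) div 3 = i" "(3 * i + 2) mod 3 = 2" by presburger+
    then show "cfg t0 i 0 = C i 0" "cfg t0 i 1 = C i 1" "cfg t0 i 2 = C i 2"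
      by (simp_all only: cfg_def t0_def) simp
  qed
  then have "psum X (pwr C a) a j = psum X (pwr (cfg t0) a) a j"
    by (intro psum_cong) (simp_all add: pwr_def)
  then have "r \<le> kdim (mp.span ((\<lambda>k. ?V k t0) ` ?K))" using r sp by metis
  then obtain Y where Y: "Y \<subseteq> ?K" "card Y = r" "indep_family Y (\<lambda>k. ?V k t0)"
    using indep_family_from_kdim[OF fin] by blast
  have finY: "finite Y" using Y fin finite_subset by blast
  have "general n (\<lambda>t. indep_family Y (\<lambda>k. ?V k t))"
  proof (rule general_indep_family[of Y n ?V t0, OF finY _ Y(3)])
    fix k assume "k \<in> Y"
    then obtain i m where k: "k = (i, m)" "i \<in> X" using Y by auto
    have "mpoly_family n (\<lambda>t. linform (cfg t i))"
      unfolding linform_def numeral_3_eq_3 lessThan_Suc cfg_def using X(2)[OF k(2)]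
      by (simp) (intro mpoly_family_add mpoly_family_single polyfun_var, auto)
    then show "mpoly_family n (?V k)"
      unfolding k(1) pwr_def prod.case
      by (intro mpoly_family_mult mpoly_family_power mpoly_family_const_single)
  qed
  then show ?thesis
  proof (rule general_mono)
    fix t assume t: "indep_family Y (\<lambda>k. ?V k t)"
    have "(\<lambda>k. ?V k t) ` Y \<subseteq> psum X (pwr (cfg t) a) a j"
      unfolding sp by (rule order_trans[OF image_mono[OF Y(1)] mp.span_superset])
    then show "r \<le> kdim (psum X (pwr (cfg t) a) a j)"
      using kdim_ge_indep_family[OF finY t _ findim_psum[OF X(1)]] Y(2) by simp
  qed
qed

subsection \<open>Derivations and syzygies\<close>

definition pderiv_var :: "nat \<Rightarrow> 'k::field mpoly \<Rightarrow> 'k mpoly" where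
  "pderiv_var k f = (\<Sum>m\<in>keys f.
     single (m - single k 1) (of_nat (lookup m k) * lookup f m))"

lemma lookup_pderiv_var:
  "lookup (pderiv_var k f) m
    = of_nat (lookup m k + 1) * lookup f (m + single k 1)"
proof -
  let ?e = "single k (1::nat)"
  have shift: "m' - ?e = m \<longleftrightarrow> m' = m + ?e" if "lookup m' k \<noteq> 0" for m'
  proof
    assume "m' - ?e = m"
    then have "lookup m' v = lookup (m + ?e) v" for v
      using that by (auto simp: lookup_add lookup_minus lookup_single when_def)
    then show "m' = m + ?e" by (rule poly_mapping_eqI)
  qed simp
  have "lookup (pderiv_var k f) m = (\<Sum>m'\<in>keys f.
      if m' = m + ?e then of_nat (lookup m k + 1) * lookup f (m + ?e) else 0)"
    unfolding pderiv_var_def lookup_sum lookup_single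
  proof (rule sum.cong[OF refl])
    fix m'
    show "(of_nat (lookup m' k) * lookup f m' when m' - ?e = m)
      = (if m' = m + ?e then of_nat (lookup m k + 1) * lookup f (m + ?e) else 0)"
      using shift[of m'] by (cases "lookup m' k = 0") (auto simp: when_def lookup_add)
  qed
  also have "\<dots> = of_nat (lookup m k + 1) * lookup f (m + ?e)"
    by (simp add: in_keys_iff)
  finally show ?thesis .
qed

lemma mpoly_induct:
  fixes f :: "'k::field mpoly"
  assumes "\<And>m c. P (single m c)" "\<And>f g. P f \<Longrightarrow> P g \<Longrightarrow> P (f + g)"
  shows "P f"
proof -
  have "P (\<Sum>m\<in>A. single m (c m))" if "finite A" for A :: "(nat \<Rightarrow>\<^sub>0 nat) set" and c :: "_ \<Rightarrow> 'k"
    using that assms(1)[of 0 0] by (induction A rule: finite_induct) (simp_all add: assms)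
  from this[of "keys f" "lookup f", OF finite_keys] show ?thesis
    by (rule back_subst[of P]) (rule mpoly_sum_single[symmetric])
qed

lemma pderiv_var_add: "pderiv_var k (f + g) = pderiv_var k f + pderiv_var k g"
  by (rule poly_mapping_eqI) (simp only: lookup_pderiv_var lookup_add distrib_left)

lemma pderiv_var_msmult: "pderiv_var k (msmult c f) = msmult c (pderiv_var k f)"
  by (rule poly_mapping_eqI) (simp only: lookup_pderiv_var lookup_msmult mult_ac)

lemma pderiv_var_single: "pderiv_var k (single m c)
    = single (m - single k 1) (of_nat (lookup m k) * c)"
  by (cases "c = 0") (simp_all add: pderiv_var_def)

lemma pderiv_var_mult: "pderiv_var k (f * g) = pderiv_var k f * g + f * pderiv_var k g"
proof (induction f rule: mpoly_induct)
  case (1 m c)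
  show ?case
  proof (induction g rule: mpoly_induct)
    case (1 n d)
    let ?e = "single k (1::nat)"
    have *: "m - ?e + n = m + n - ?e" if "lookup m k \<noteq> 0" for m n
      using that by (intro poly_mapping_eqI) (auto simp: lookup_add lookup_minus lookup_single when_def)
    have "single (m - ?e + n) (of_nat (lookup m k) * c * d)
        = single (m + n - ?e) (of_nat (lookup m k) * c * d)"
      by (cases "lookup m k = 0") (simp_all add: * del: One_nat_def)
    moreover have "single (m + (n - ?e)) (c * (of_nat (lookup n k) * d))
        = single (m + n - ?e) (c * (of_nat (lookup n k) * d))"
      using *[of n m] by (cases "lookup n k = 0") (simp_all add: add.commute del: One_nat_def)
    moreover have "of_nat (lookup m k + lookup n k) * (c * d)
        = of_nat (lookup m k) * c * d + c * (of_nat (lookup n k) * d)"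
      by (simp only: of_nat_add distrib_right distrib_left mult_ac)
    ultimately show ?case
      by (simp only: mult_single pderiv_var_single lookup_add single_add)
  next
    case (2 f g)
    then show ?case by (simp add: distrib_left pderiv_var_add)
  qed
next
  case (2 f h)
  then show ?case by (simp add: distrib_right pderiv_var_add)
qed

lemma pderiv_var_homR: assumes "f \<in> homR j" "k < 3" shows "pderiv_var k f \<in> homR (j - 1)"
proof -
  have "m \<in> mons (j - 1)" if "m \<in> keys (pderiv_var k f)" for m
  proof -
    have "m + single k 1 \<in> keys f"
      using that by (auto simp: in_keys_iff lookup_pderiv_var)
    then have mm: "m + single k 1 \<in> mons j" using assms by (auto simp: homR_iff)
    have "keys m \<subseteq> keys (m + single k 1)"
      by (auto simp: in_keys_iff lookup_add)
    then have km: "keys m \<subseteq> {0,1,2}" using mm by (auto simp: mons_def)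
    have "k = 0 \<or> k = 1 \<or> k = 2" using assms(2) by auto
    then have "mdeg (m + single k 1) = mdeg m + 1"
      using mm mdeg_eq[OF km] mdeg_eq[of "m + single k 1"]
      by (auto simp: mons_def lookup_add lookup_single when_def)
    then show ?thesis using mm km by (auto simp: mons_def)
  qed
  then show ?thesis by (auto simp: homR_iff)
qed

definition dirderiv :: "(nat \<Rightarrow> 'k::field) \<Rightarrow> 'k mpoly \<Rightarrow> 'k mpoly" where
  "dirderiv v f = msmult (v 0) (pderiv_var 0 f) + msmult (v 1) (pderiv_var 1 f) + msmult (v 2) (pderiv_var 2 f)"

definition dot3 :: "(nat \<Rightarrow> 'k::field) \<Rightarrow> (nat \<Rightarrow> 'k) \<Rightarrow> 'k" where
  "dot3 c v = c 0 * v 0 + c 1 * v 1 + c 2 * v 2"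

lemma dirderiv_add: "dirderiv v (f + g) = dirderiv v f + dirderiv v g"
  by (simp add: dirderiv_def pderiv_var_add mp.scale_right_distrib add_ac)

lemma dirderiv_msmult: "dirderiv v (msmult c f) = msmult c (dirderiv v f)"
  by (simp add: dirderiv_def pderiv_var_msmult mp.scale_right_distrib mult.commute[of c])

lemma dirderiv_zero: "dirderiv v 0 = 0"
  by (simp add: dirderiv_def pderiv_var_def)

lemma dirderiv_sum: "dirderiv v (sum f A) = (\<Sum>a\<in>A. dirderiv v (f a))"
  by (induction A rule: infinite_finite_induct) (simp_all add: dirderiv_zero dirderiv_add)

lemma dirderiv_mult: "dirderiv v (f * g) = dirderiv v f * g + f * dirderiv v g"
  unfolding dirderiv_def pderiv_var_mult mp.scale_right_distrib mult_msmult distrib_left distrib_right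
  by (simp only: add_ac)

lemma dirderiv_homR: "f \<in> homR j \<Longrightarrow> dirderiv v f \<in> homR (j - 1)"
  unfolding dirderiv_def
  by (intro add_homR scale_homR pderiv_var_homR) auto

lemma dirderiv_var: "dirderiv v (var k) = (if k < 3 then msmult (v k) 1 else 0)"
proof -
  have "pderiv_var i (var k) = (if i = k then 1 else 0 :: 'a mpoly)" for i
    unfolding var_def pderiv_var_single by (simp add: lookup_single when_def single_one[symmetric] del: single_one)
  then show ?thesis by (auto simp: dirderiv_def numeral_3_eq_3 less_Suc_eq numeral_2_eq_2)
qed

lemma dirderiv_linform: "dirderiv v (linform c) = msmult (dot3 c v) 1"
  by (simp add: linform_eq dirderiv_add dirderiv_msmult dirderiv_var dot3_def mp.scale_left_distrib)

lemma dirderiv_power: "dirderiv v (f ^ Suc n) = of_nat (Suc n) * (f ^ n * dirderiv v f)"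
proof (induction n)
  case (Suc n)
  have "dirderiv v (f ^ Suc (Suc n)) = dirderiv v f * f ^ Suc n + f * dirderiv v (f ^ Suc n)"
    by (simp only: power_Suc[of f "Suc n"] dirderiv_mult)
  also have "\<dots> = of_nat (Suc (Suc n)) * (f ^ Suc n * dirderiv v f)"
    unfolding Suc by (simp add: algebra_simps)
  finally show ?case .
qed simp

lemma dirderiv_linform_power_mult:
  "dirderiv v (linform c ^ Suc e * g) = linform c ^ e * (msmult (of_nat (Suc e) * dot3 c v) g + linform c * dirderiv v g)"
proof -
  have "dirderiv v (linform c ^ Suc e) = msmult (of_nat (Suc e) * dot3 c v) (linform c ^ e)"
    unfolding dirderiv_power dirderiv_linform of_nat_mult_mpoly mult_msmult by simp
  then show ?thesis
    unfolding dirderiv_mult by (simp add: distrib_left mult_msmult mult_ac)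
qed

text \<open>By the product rule the derivative is L^e (s g + L D g) with s = (e + 1) (c . v), which
  is nonzero in characteristic zero; hence g is a multiple of L.\<close>

lemma linform_factor_if_dirderiv:
  fixes g :: "'k::field_char_0 mpoly"
  assumes "g \<in> homR j" "dirderiv v (linform c ^ Suc e * g) = 0" "dot3 c v \<noteq> 0"
  obtains h where "h \<in> homR (j - 1)" "g = linform c * h"
proof -
  let ?s = "of_nat (Suc e) * dot3 c v"
  have s: "?s \<noteq> 0" using assms(3) by (simp del: of_nat_Suc)
  have "linform c \<noteq> 0"
    using dirderiv_linform[of v c] assms(3) dirderiv_zero[of v] by (metis mp.scale_eq_0_iff zero_neq_one)
  then have "msmult ?s g + linform c * dirderiv v g = 0"
    using assms(2) unfolding dirderiv_linform_power_mult by simp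
  then have "msmult ?s g = linform c * - dirderiv v g" by (simp add: eq_neg_iff_add_eq_0)
  then have "msmult (1 / ?s) (msmult ?s g) = linform c * msmult (1 / ?s) (- dirderiv v g)"
    by (simp only: mult_msmult)
  then have "g = linform c * msmult (1 / ?s) (- dirderiv v g)" using s by simp
  then show ?thesis
    by (rule that[rotated]) (intro scale_homR neg_homR dirderiv_homR assms(1))
qed

text \<open>Each factor L found in g is moved into the power, so e grows while the degree of g
  drops, until no degree is left.\<close>

lemma zero_if_dirderiv_linform_power:
  fixes g :: "'k::field_char_0 mpoly"
  assumes "g \<in> homR (int n)" "dirderiv v (linform c ^ Suc e * g) = 0" "dot3 c v \<noteq> 0"
  shows "g = 0"
  using assms(1,2)
proof (induction n arbitrary: g e)
  case (0 g e)
  then show ?case using linform_factor_if_dirderiv[OF 0 assms(3)] by (auto simp: homR_neg)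
next
  case (Suc n g e)
  obtain h where h: "h \<in> homR (int n)" "g = linform c * h"
    using linform_factor_if_dirderiv[OF Suc.prems assms(3)] by auto
  have "linform c ^ Suc e * g = linform c ^ Suc (Suc e) * h"
    unfolding h(2) by (simp only: power_Suc mult_ac)
  then have "dirderiv v (linform c ^ Suc (Suc e) * h) = 0" using Suc.prems(2) by metis
  with h(1) have "h = 0" by (rule Suc.IH)
  then show ?case using h(2) by simp
qed

section \<open>Absence of syzygies by induction on the degree\<close>

lemma hdim_Suc: "hdim (int (Suc t) - int a) = hdim (int t - int a) + (Suc t + 1 - a)"
proof -
  have "int (hdim (int (Suc t) - int a)) = int (hdim (int t - int a)) + max 0 (int t + 2 - int a)"
    using hdim_diff[of "int (Suc t) - int a"] by (simp add: algebra_simps)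
  also have "max 0 (int t + 2 - int a) = int (Suc t + 1 - a)" by simp
  finally show ?thesis by linarith
qed

lemma kdim_sumF_ideal_le:
  fixes F :: "'k::field mpoly"
  assumes "finite X" "\<And>i. i \<in> X \<Longrightarrow> G i \<in> homR (int (a i))" "F \<in> homR k"
  shows "kdim (sumF (psum X G a j) F (homR (j - k))) + kdim (psum X G a (j - k)) \<le> kdim (psum X G a j) + hdim (j - k)"
  unfolding kdim_homR[symmetric, where 'k = 'k]
proof (rule kdim_sumF_le)
  show "F * g \<in> psum X G a j" if "g \<in> psum X G a (j - k)" for g
    using psum_mult[OF that assms(3)] by simp
qed (use assms in \<open>auto simp: findim_psum findim_homR subspace_psum subspace_homR psum_homR\<close>)

text \<open>The growth of dim R/I from degree t - 1 to t is at most the dimension of R/(I, F) in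
  degree t. With the bound \<open>b\<close>, the ideal piece grows at least as fast as the
  syzygy-free count; \<open>e\<close> makes the truncated subtraction in \<open>b\<close>
  exact.\<close>

lemma line_induction:
  fixes F :: "'k::field mpoly"
  assumes X: "finite X" "\<And>i. i \<in> X \<Longrightarrow> G i \<in> homR (int (a i))"
    and F: "F \<in> homR 1"
    and b: "\<And>t. t \<le> T \<Longrightarrow> hdim (int t) \<le> kdim (sumF (psum X G a (int t)) F (homR (int t - 1))) + (t + 1 - (\<Sum>i\<in>X. t + 1 - a i))"
    and e: "\<And>t. t \<le> T \<Longrightarrow> (\<Sum>i\<in>X. t + 1 - a i) \<le> t + 1"
    and t: "t \<le> T"
  shows "(\<Sum>i\<in>X. hdim (int t - int (a i))) \<le> kdim (psum X G a (int t))"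
  using t
proof (induction t)
  case 0
  have "1 \<le> kdim (psum X G a 0) + (1 - (\<Sum>i\<in>X. 1 - a i))"
    using b[of 0] kdim_sumF_ideal_le[of X G a F 1 0, OF X F] by (simp add: hdim_neg hdim_0)
  moreover have "(\<Sum>i\<in>X. hdim (- int (a i))) = (\<Sum>i\<in>X. 1 - a i)"
  proof (rule sum.cong[OF refl])
    fix i show "hdim (- int (a i)) = 1 - a i" by (cases "a i") (simp_all add: hdim_0 hdim_neg)
  qed
  ultimately show ?case using e[of 0] by simp
next
  case (Suc t)
  have "(\<Sum>i\<in>X. hdim (int (Suc t) - int (a i))) = (\<Sum>i\<in>X. hdim (int t - int (a i))) + (\<Sum>i\<in>X. Suc t + 1 - a i)"
    unfolding hdim_Suc sum.distrib ..
  moreover have "hdim (int (Suc t)) = hdim (int t) + (Suc t + 1)" using hdim_Suc[of t 0] by simp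
  moreover have "int (Suc t) - 1 = int t" by simp
  then have "kdim (sumF (psum X G a (int (Suc t))) F (homR (int (Suc t) - 1))) + kdim (psum X G a (int t))
      \<le> kdim (psum X G a (int (Suc t))) + hdim (int t)"
    using kdim_sumF_ideal_le[of X G a F 1 "int (Suc t)", OF X F] by metis
  moreover have "(\<Sum>i\<in>X. hdim (int t - int (a i))) \<le> kdim (psum X G a (int t))" using Suc by simp
  ultimately show ?case using b[OF Suc.prems] e[OF Suc.prems] by linarith
qed

text \<open>The ratio (t + 1 - a) / (t + 1) increases with t; the denominators are cleared. Thus
  slack in degree T passes to all lower degrees.\<close>

lemma slack_mono:
  fixes a :: "nat \<Rightarrow> nat"
  assumes "(\<Sum>i\<in>X. T + 1 - a i) \<le> S" "t \<le> T"
  shows "(\<Sum>i\<in>X. t + 1 - a i) * (T + 1) \<le> (t + 1) * S"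
proof -
  have "(t + 1 - a i) * (T + 1) \<le> (t + 1) * (T + 1 - a i)" for i
  proof (cases "a i \<le> t + 1")
    case True
    have "int (t + 1 - a i) * int (T + 1) \<le> int (t + 1) * int (T + 1 - a i)"
      using True assms(2) mult_left_mono[of "int t" "int T" "int (a i)"] by (simp add: of_nat_diff algebra_simps)
    then show ?thesis by (metis of_nat_le_iff of_nat_mult)
  qed simp
  then have "(\<Sum>i\<in>X. (t + 1 - a i) * (T + 1)) \<le> (\<Sum>i\<in>X. (t + 1) * (T + 1 - a i))"
    by (intro sum_mono) blast
  also have "\<dots> \<le> (t + 1) * S" using assms(1) unfolding sum_distrib_left[symmetric] by (rule mult_left_mono) simp
  finally show ?thesis by (simp only: sum_distrib_right)
qed

text \<open>Three obvious vectors orthogonal to c show that all 2 by 2 minors of c and d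
  vanish.\<close>

lemma orthogonal_separating:
  fixes c d :: "nat \<Rightarrow> 'k::field"
  assumes "\<And>v. dot3 c v = 0 \<Longrightarrow> dot3 d v = 0" "linform c \<noteq> 0"
  shows "\<exists>\<kappa>. linform d = msmult \<kappa> (linform c)"
proof -
  let ?v = "\<lambda>x y z k. if k = 0 then x else if k = 1 then y else (z::'k)"
  have c: "c 0 * d 1 = c 1 * d 0" "c 0 * d 2 = c 2 * d 0" "c 1 * d 2 = c 2 * d 1"
    using assms(1)[of "?v (c 1) (- c 0) 0"] assms(1)[of "?v (c 2) 0 (- c 0)"] assms(1)[of "?v 0 (c 2) (- c 1)"]
    by (simp_all add: dot3_def algebra_simps)
  have "c 0 \<noteq> 0 \<or> c 1 \<noteq> 0 \<or> c 2 \<noteq> 0"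
    using assms(2) by (auto simp: linform_eq)
  then obtain \<kappa> where "d 0 = \<kappa> * c 0 \<and> d 1 = \<kappa> * c 1 \<and> d 2 = \<kappa> * c 2"
  proof (elim disjE)
    assume "c 0 \<noteq> 0" then show ?thesis using c that[of "d 0 / c 0"] by (simp add: field_simps)
  next
    assume "c 1 \<noteq> 0" then show ?thesis using c that[of "d 1 / c 1"] by (simp add: field_simps)
  next
    assume "c 2 \<noteq> 0" then show ?thesis using c that[of "d 2 / c 2"] by (simp add: field_simps)
  qed
  then show ?thesis by (intro exI[of _ \<kappa>]) (simp add: linform_eq mp.scale_right_distrib)
qed

lemma sum_square_bound:
  fixes n :: "'i \<Rightarrow> nat"
  assumes "finite S" "\<And>i. i \<in> S \<Longrightarrow> n i \<ge> 1"
  shows "(\<Sum>i\<in>S. (n i)\<^sup>2) + card S * (card S - 1) \<le> (\<Sum>i\<in>S. n i)\<^sup>2"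
  using assms
proof (induction S rule: finite_induct)
  case (insert i S)
  let ?s = "\<Sum>i\<in>S. n i"
  have c: "card S \<le> ?s" using sum_mono[of S "\<lambda>_. 1" n] insert.prems by simp
  have "card S * 1 \<le> ?s * n i" using insert.prems by (intro mult_mono c) auto
  moreover have "(n i + ?s)\<^sup>2 = (n i)\<^sup>2 + ?s\<^sup>2 + 2 * (?s * n i)" by (simp add: power2_eq_square algebra_simps)
  moreover have "(\<Sum>i\<in>S. (n i)\<^sup>2) + card S * (card S - 1) \<le> ?s\<^sup>2" using insert by simp
  moreover have "(card S + 1) * card S = card S * (card S - 1) + 2 * card S"
    by (cases "card S") (simp_all add: algebra_simps)
  ultimately have "(n i)\<^sup>2 + (\<Sum>i\<in>S. (n i)\<^sup>2) + (card S + 1) * card S \<le> (n i + ?s)\<^sup>2" by linarith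
  then show ?case using insert.hyps by simp
qed simp

text \<open>Used to see that the forms do not fill the degree in question, so that a power M^d
  remains outside. With two parts the inequality can fail: 3 + 3 = 6 for n = 1, 1.\<close>

lemma sum_hdim_less:
  assumes "finite S" "\<And>i. i \<in> S \<Longrightarrow> n i \<ge> (1::nat)" "card S \<ge> 3"
  shows "(\<Sum>i\<in>S. hdim (int (n i))) < hdim (int (\<Sum>i\<in>S. n i))"
proof -
  let ?s = "\<Sum>i\<in>S. n i"
  have h: "2 * hdim (int k) = k\<^sup>2 + 3 * k + 2" for k
  proof -
    have "int (2 * hdim (int k)) = int (k\<^sup>2 + 3 * k + 2)"
      using hdim_formula[of "int k"] by (simp add: power2_eq_square algebra_simps)
    then show ?thesis by (simp only: of_nat_eq_iff)
  qed
  have "2 * (\<Sum>i\<in>S. hdim (int (n i))) = (\<Sum>i\<in>S. (n i)\<^sup>2) + 3 * ?s + 2 * card S"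
    unfolding sum_distrib_left h sum.distrib by simp
  moreover have "2 * hdim (int ?s) = ?s\<^sup>2 + 3 * ?s + 2" by (rule h)
  moreover have "2 * card S < card S * (card S - 1) + 2"
  proof -
    obtain k where "card S = k + 3" using assms(3) by (metis add.commute le_Suc_ex)
    then show ?thesis by (simp add: algebra_simps)
  qed
  ultimately show ?thesis using sum_square_bound[of S n, OF assms(1,2)] by linarith
qed

text \<open>Differentiating a syzygy of the forms L_i^(e_i + m + 1), M^d in a direction killing M yields a
  syzygy of L_i^(e_i + m), M^d, with the degree of the coefficient of M lowered by one.\<close>
lemma syzygy_lift:
  fixes C :: "nat \<Rightarrow> nat \<Rightarrow> 'k::field_char_0"
  assumes X: "finite X" and M: "\<forall>\<gamma> c. (\<forall>i\<in>X. \<gamma> i \<in> homR (int (n i))) \<longrightarrow>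
      (\<Sum>i\<in>X. linform (C i) ^ e i * \<gamma> i) = msmult c (linform M ^ d) \<longrightarrow> c = 0 \<and> (\<forall>i\<in>X. \<gamma> i = 0)"
    and np: "\<And>i. i \<in> X \<Longrightarrow> \<exists>v. dot3 M v = 0 \<and> dot3 (C i) v \<noteq> 0" and M0: "linform M \<noteq> 0"
  shows "(\<And>i. i \<in> X \<Longrightarrow> \<gamma> i \<in> homR (int (n i))) \<Longrightarrow> \<gamma>0 \<in> homR (int m) \<Longrightarrow>
     (\<Sum>i\<in>X. linform (C i) ^ (e i + m) * \<gamma> i) + linform M ^ d * \<gamma>0 = 0 \<Longrightarrow> \<gamma>0 = 0 \<and> (\<forall>i\<in>X. \<gamma> i = 0)"
proof (induction m arbitrary: \<gamma> \<gamma>0)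
  case 0
  have "mons 0 = {0}"
    using mons_nat[of 0] by (simp add: monom3_def)
  then have "\<gamma>0 = msmult (lookup \<gamma>0 0) (single 0 1)"
    using mpoly_sum_monomials[of "{0}" \<gamma>0] 0(2) by (simp add: homR_iff)
  then obtain c where c: "\<gamma>0 = msmult c 1" by (metis single_one)
  have "(\<Sum>i\<in>X. linform (C i) ^ e i * \<gamma> i) = msmult (- c) (linform M ^ d)"
    using 0(3) by (simp add: c mult_msmult eq_neg_iff_add_eq_0)
  then have "- c = 0 \<and> (\<forall>i\<in>X. \<gamma> i = 0)" using M 0(1) by blast
  then show ?case unfolding c by simp
next
  case (Suc m)
  have step: "dirderiv v (linform (C i) ^ (e i + Suc m) * \<gamma> i) = 0" if v: "dot3 M v = 0" and i: "i \<in> X" for v i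
  proof -
    let ?h = "\<lambda>i. msmult (of_nat (Suc (e i + m)) * dot3 (C i) v) (\<gamma> i) + linform (C i) * dirderiv v (\<gamma> i)"
    have D: "dirderiv v (linform (C i) ^ (e i + Suc m) * \<gamma> i) = linform (C i) ^ (e i + m) * ?h i" for i
      unfolding add_Suc_right dirderiv_linform_power_mult ..
    have DM: "dirderiv v (linform M ^ d) = 0"
    proof (cases d)
      case 0
      then show ?thesis using dirderiv_mult[of v 1 1] by simp
    next
      case (Suc d')
      then show ?thesis using v by (simp only: dirderiv_power dirderiv_linform) simp
    qed
    have "?h i \<in> homR (int (n i))" if "i \<in> X" for i
    proof -
      have "linform (C i) * dirderiv v (\<gamma> i) \<in> homR (1 + (int (n i) - 1))"
        by (intro homR_mult linform_homR dirderiv_homR Suc.prems that)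
      then show ?thesis using Suc.prems(1)[OF that]
        by (intro add_homR scale_homR) simp_all
    qed
    moreover have "dirderiv v \<gamma>0 \<in> homR (int m)" using dirderiv_homR[OF Suc.prems(2)] by simp
    moreover have "(\<Sum>i\<in>X. linform (C i) ^ (e i + m) * ?h i) + linform M ^ d * dirderiv v \<gamma>0 = 0"
    proof -
      have "dirderiv v ((\<Sum>i\<in>X. linform (C i) ^ (e i + Suc m) * \<gamma> i) + linform M ^ d * \<gamma>0) = 0"
        unfolding Suc.prems(3) by (rule dirderiv_zero)
      then show ?thesis unfolding dirderiv_add dirderiv_sum D dirderiv_mult[of v "linform M ^ d"] DM by simp
    qed
    ultimately have "\<forall>i\<in>X. ?h i = 0" using Suc.IH[of ?h "dirderiv v \<gamma>0"] by blast
    then show ?thesis using i unfolding D by simp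
  qed
  \<comment> \<open>Every summand has zero derivative in all directions killing M; one such
    direction that does not kill L_i is enough.\<close>
  have z: "\<gamma> i = 0" if i: "i \<in> X" for i
  proof -
    obtain v where v: "dot3 M v = 0" "dot3 (C i) v \<noteq> 0" using np[OF i] by blast
    show ?thesis
      by (rule zero_if_dirderiv_linform_power[OF Suc.prems(1)[OF i] _ v(2), of "e i + m"])
        (use step[OF v(1) i] in simp)
  qed
  then have "linform M ^ d * \<gamma>0 = 0" using Suc.prems(3) by simp
  then show ?case using z M0 by simp
qed

lemma psum_insert_line:
  assumes "finite X" "q \<notin> X"
  shows "psum (insert q X) (pwr C (a(q := k))) (a(q := k)) j
    = sumF (psum X (pwr C a) a j) (linform (C q) ^ k) (homR (j - int k))"
proof -
  have "psum X (pwr C (a(q := k))) (a(q := k)) j = psum X (pwr C a) a j"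
    by (rule psum_pwr_cong) (use assms in auto)
  then show ?thesis using psum_insert[OF assms, of "pwr C (a(q := k))" "a(q := k)" j]
    by (simp add: pwr_def)
qed

lemma psum_atMost_line:
  "psum {..s} (pwr C (a(s := k))) (a(s := k)) j
    = sumF (psum {..<s} (pwr C a) a j) (linform (C s) ^ k) (homR (j - int k))"
  using psum_insert_line[of "{..<s}" s] by (simp add: lessThan_Suc_atMost[symmetric] lessThan_Suc)

text \<open>For an odd number of forms with sum of the n i equal to d the cubic cokernel vanishes in
  degree d, so dim I_d is at least dim I_(d-3) plus dim R_d - dim R_(d-3). In degree d - 3 the
  syzygy-free count is supplied by \<open>line_induction\<close>.\<close>

lemma exists_odd_config:
  assumes X: "finite X" "odd (card X)" "card X \<ge> 3" "\<And>i. i \<in> X \<Longrightarrow> n i \<ge> 1"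
    and d: "d = (\<Sum>i\<in>X. n i)" and a: "\<And>i. i \<in> X \<Longrightarrow> a i = d - n i"
  shows "\<exists>C :: nat \<Rightarrow> nat \<Rightarrow> 'k::field_char_0. (\<Sum>i\<in>X. hdim (int (n i))) \<le> kdim (psum X (pwr C a) a (int d))"
proof -
  have nd: "n i \<le> d" if "i \<in> X" for i unfolding d using member_le_sum[OF that, of n] X by simp
  have d3: "3 \<le> d" using sum_mono[of X "\<lambda>_. 1" n] X unfolding d by simp
  obtain q where q: "q \<notin> X" using X(1) ex_new_if_finite infinite_UNIV_nat by blast
  define b where "b = a(q := 3)"
  have bX: "b i = d - n i" if "i \<in> X" for i using that q a by (auto simp: b_def)
  \<comment> \<open>The line of index i splits off n i - 1 times, so the residual degree equals the
    number of double points and the excess depends only on parity.\<close>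
  have "(\<Sum>i\<in>X. d - 1 - b i) + card X = (\<Sum>i\<in>X. (d - 1 - b i) + 1)" by (simp only: sum.distrib card_eq_sum)
  also have "\<dots> = d" unfolding d(1)
  proof (rule sum.cong[OF refl])
    fix i assume i: "i \<in> X"
    show "(\<Sum>i\<in>X. n i) - 1 - b i + 1 = n i" using bX[OF i] nd[OF i] X(4)[OF i] unfolding d[symmetric] by simp
  qed
  finally have dd: "card X + (\<Sum>i\<in>X. d - 1 - b i) = d" by simp
  have bq: "b q = 3" by (simp add: b_def)
  have blt: "b i < d" if "i \<in> X" for i using bX[OF that] X(4)[OF that] d3 by simp
  obtain C :: "nat \<Rightarrow> nat \<Rightarrow> 'k" where C: "\<And>i. i \<in> X \<Longrightarrow> C i 0 = 1 \<and> C i 1 = of_nat i" "C q = zvec"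
    "hdim (int d) \<le> kdim (psum (insert q X) (pwr C b) b (int d)) + excess (card X) (card X)"
    using exists_triple_config[OF X(1) q bq blt dd, where 'k = 'k] by blast
  have full: "hdim (int d) \<le> kdim (sumF (psum X (pwr C a) a (int d)) (var 2 ^ 3) (homR (int d - 3)))"
    using C(3) X(2) psum_insert_line[OF X(1) q, of C a 3 "int d"] C(2) by (simp add: excess_def b_def linform_zvec)
  \<comment> \<open>At t = d - 1 this is an equality, the sum of the n i being d; lower degrees
    follow by monotonicity.\<close>
  have slack: "(\<Sum>i\<in>X. t + 1 - a i) \<le> t + 1" if t: "t \<le> d - 1" for t
  proof -
    have "(\<Sum>i\<in>X. d - 1 + 1 - a i) = (\<Sum>i\<in>X. n i)"
      by (rule sum.cong[OF refl]) (use a nd d3 in auto)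
    then have "(\<Sum>i\<in>X. d - 1 + 1 - a i) \<le> d" using d by simp
    from slack_mono[OF this t] have "(\<Sum>i\<in>X. t + 1 - a i) * d \<le> (t + 1) * d" using d3 by simp
    then show ?thesis using d3 by (simp only: mult_le_cancel2)
  qed
  have "(\<Sum>i\<in>X. hdim (int (d - 3) - int (a i))) \<le> kdim (psum X (pwr C a) a (int (d - 3)))"
  proof (rule line_induction[of X "pwr C a" a "var 2" "d - 1", OF X(1) pwr_homR _ _ slack])
    show "var 2 \<in> homR 1" by (rule var_homR) simp
    show "hdim (int t) \<le> kdim (sumF (psum X (pwr C a) a (int t)) (var 2) (homR (int t - 1))) + (t + 1 - (\<Sum>i\<in>X. t + 1 - a i))"
      if "t \<le> d - 1" for t
    proof -
      have "(\<Sum>i\<in>X. t + 1 - (a(q := 1)) i) = (\<Sum>i\<in>X. t + 1 - a i)" by (rule sum.cong[OF refl]) (use q in auto)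
      then show ?thesis
        using coker_line_bound[OF X(1) q C(1,2), of "a(q := 1)" t] psum_insert_line[OF X(1) q, of C a 1 "int t"] C(2) by (simp add: linform_zvec)
    qed
  qed auto
  moreover have "int (d - 3) = int d - 3" using d3 by simp
  moreover have "kdim (sumF (psum X (pwr C a) a (int d)) (var 2 ^ 3) (homR (int d - 3))) + kdim (psum X (pwr C a) a (int d - 3))
     \<le> kdim (psum X (pwr C a) a (int d)) + hdim (int d - 3)"
    using kdim_sumF_ideal_le[of X "pwr C a" a "var 2 ^ 3" 3 "int d", OF X(1) pwr_homR] var_power_homR[of 2 3] by simp
  ultimately have le: "hdim (int d) + (\<Sum>i\<in>X. hdim (int d - 3 - int (a i))) \<le> kdim (psum X (pwr C a) a (int d)) + hdim (int d - 3)"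
    using full by simp
  \<comment> \<open>The third difference is linear, so its values at the n i add up to its value at
    d, and the count is exact.\<close>
  have h3: "hdim (int k) = hdim (int k - 3) + 3 * k" if "k \<ge> 1" for k
    using hdim_diff[of "int k"] hdim_diff[of "int k - 1"] hdim_diff[of "int k - 2"] that by simp
  have "(\<Sum>i\<in>X. hdim (int (n i))) = (\<Sum>i\<in>X. hdim (int d - 3 - int (a i)) + 3 * n i)"
  proof (rule sum.cong[OF refl])
    fix i assume i: "i \<in> X"
    have e: "int d - 3 - int (a i) = int (n i) - 3" using a[OF i] nd[OF i] by simp
    show "hdim (int (n i)) = hdim (int d - 3 - int (a i)) + 3 * n i" unfolding e by (rule h3[OF X(4)[OF i]])
  qed
  also have "\<dots> = (\<Sum>i\<in>X. hdim (int d - 3 - int (a i))) + 3 * d"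
    unfolding sum.distrib d sum_distrib_left ..
  finally show ?thesis using le h3[of d] d3 by (intro exI[of _ C]) linarith
qed

text \<open>One form i0 is set aside. The exponents \<open>a'\<close> of the others belong to an odd
  system in degree d' = d - n i0. Raising each of them by n i0 gives \<open>a\<close>, while the
  power of the form M put in place of i0 keeps the exponent d' = a i0; this is the situation of
  \<open>syzygy_lift\<close>.\<close>

lemma exists_no_syzygy_config:
  assumes X: "finite X" "even (card X)" "card X \<ge> 4" "\<And>i. i \<in> X \<Longrightarrow> n i \<ge> 1"
    and d: "d = (\<Sum>i\<in>X. n i)" and a: "\<And>i. i \<in> X \<Longrightarrow> a i = d - n i"
  shows "\<exists>C :: nat \<Rightarrow> nat \<Rightarrow> 'k::field_char_0. (\<Sum>i\<in>X. hdim (int (n i))) \<le> kdim (psum X (pwr C a) a (int d))"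
proof -
  have "X \<noteq> {}" using X(3) by auto
  then obtain i0 where i0: "i0 \<in> X" by blast
  let ?Y = "X - {i0}"
  define d' where "d' = (\<Sum>i\<in>?Y. n i)"
  have dd: "d = d' + n i0" unfolding d d'_def using sum.remove[OF X(1) i0, of n] by simp
  define a' where "a' = (\<lambda>i. d' - n i)"
  have Y: "finite ?Y" "card ?Y = card X - 1" using X i0 by auto
  have nd: "n i \<le> d'" if "i \<in> ?Y" for i unfolding d'_def using member_le_sum[OF that, of n] Y by simp
  obtain C :: "nat \<Rightarrow> nat \<Rightarrow> 'k" where C: "(\<Sum>i\<in>?Y. hdim (int (n i))) \<le> kdim (psum ?Y (pwr C a') a' (int d'))"
  proof -
    have "odd (card ?Y)" "card ?Y \<ge> 3" using X(2,3) Y(2) by auto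
    then have "\<exists>C :: nat \<Rightarrow> nat \<Rightarrow> 'k. (\<Sum>i\<in>?Y. hdim (int (n i))) \<le> kdim (psum ?Y (pwr C a') a' (int d'))"
      by (intro exists_odd_config[OF Y(1) _ _ _ d'_def]) (use X(4) in \<open>auto simp: a'_def\<close>)
    then show ?thesis using that by blast
  qed
  let ?I = "psum ?Y (pwr C a') a' (int d')"
  have hY: "(\<Sum>i\<in>?Y. hdim (int d' - int (a' i))) = (\<Sum>i\<in>?Y. hdim (int (n i)))"
    by (rule sum.cong[OF refl]) (use nd in \<open>simp add: a'_def of_nat_diff\<close>)
  have "kdim ?I \<le> (\<Sum>i\<in>?Y. hdim (int (n i)))" using kdim_psum_le[OF Y(1)] hY by metis
  also have "\<dots> < hdim (int d')" unfolding d'_def by (rule sum_hdim_less) (use X Y in auto)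
  finally have lt: "kdim ?I < hdim (int d')" .
  have "\<not> homR (int d') \<subseteq> ?I"
  proof
    assume "homR (int d') \<subseteq> ?I"
    from kdim_mono[OF this findim_psum[OF Y(1)]] show False using lt by (simp add: kdim_homR)
  qed
  then obtain M where M: "linform M ^ d' \<notin> ?I" using powers_span[OF subspace_psum[OF Y(1)]] by blast
  have "card ?Y \<le> d'" using sum_mono[of ?Y "\<lambda>_. 1" n] X(4) unfolding d'_def by simp
  then have "d' > 0" using Y(2) X(3) by simp
  then have M0: "linform M \<noteq> 0"
    using M mp.subspace_0[OF subspace_psum[OF Y(1)], of "pwr C a'" a' "int d'"] by (auto simp: power_0_left)
  have triv: "c = 0 \<and> (i \<in> ?Y \<longrightarrow> \<gamma> i = 0)" if \<gamma>: "\<And>i. i \<in> ?Y \<Longrightarrow> \<gamma> i \<in> homR (int (n i))"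
    "(\<Sum>i\<in>?Y. linform (C i) ^ a' i * \<gamma> i) = msmult c (linform M ^ d')" for \<gamma> c i
  proof -
    have \<gamma>': "\<gamma> i \<in> homR (int d' - int (a' i))" if "i \<in> ?Y" for i
      using \<gamma>(1)[OF that] nd[OF that] by (simp add: a'_def of_nat_diff)
    have "(\<Sum>i\<in>?Y. pwr C a' i * \<gamma> i) \<in> ?I"
      unfolding psum_def using \<gamma>' by blast
    then have cI: "msmult c (linform M ^ d') \<in> ?I" using \<gamma>(2) by (simp add: pwr_def)
    have c: "c = 0"
    proof (rule ccontr)
      assume "c \<noteq> 0"
      then have "linform M ^ d' = msmult (1 / c) (msmult c (linform M ^ d'))" by simp
      then show False using M mp.subspace_scale[OF subspace_psum[OF Y(1)] cI, of "1 / c"] by simp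
    qed
    have "\<gamma> i = 0" if "i \<in> ?Y"
      by (rule syzygy_trivial_if_kdim[OF Y(1) _ \<gamma>' _ that, where G = "pwr C a'"])
        (use C hY \<gamma>(2) c in \<open>auto simp: pwr_def\<close>)
    then show ?thesis using c by blast
  qed
  have triv': "\<forall>\<gamma> c. (\<forall>i\<in>?Y. \<gamma> i \<in> homR (int (n i))) \<longrightarrow>
      (\<Sum>i\<in>?Y. linform (C i) ^ a' i * \<gamma> i) = msmult c (linform M ^ d') \<longrightarrow> c = 0 \<and> (\<forall>i\<in>?Y. \<gamma> i = 0)"
    using triv by blast
  \<comment> \<open>If L_i were \<kappa> M, then L_i^(a' i) M^(n i) would be a multiple of M^d' and
    contradict the choice of M.\<close>
  have np: "\<exists>v. dot3 M v = 0 \<and> dot3 (C i) v \<noteq> 0" if i: "i \<in> ?Y" for i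
  proof (rule ccontr)
    assume "\<not> ?thesis"
    then obtain \<kappa> where \<kappa>: "linform (C i) = msmult \<kappa> (linform M)"
      using orthogonal_separating[of M "C i"] M0 by auto
    define \<gamma> where "\<gamma> = (\<lambda>k. if k = i then linform M ^ n i else 0)"
    have "(\<Sum>k\<in>?Y. linform (C k) ^ a' k * \<gamma> k) = linform (C i) ^ a' i * linform M ^ n i"
      using i Y(1) by (subst sum.remove[OF Y(1) i]) (simp add: \<gamma>_def)
    also have "\<dots> = msmult (\<kappa> ^ a' i) (linform M ^ (a' i + n i))"
      by (simp add: \<kappa> msmult_power mult_msmult power_add)
    also have "a' i + n i = d'" using nd[OF i] by (simp add: a'_def)
    finally have "\<gamma> i = 0"
      using triv[of \<gamma> "\<kappa> ^ a' i" i] i by (auto simp: \<gamma>_def linform_power_homR zero_homR)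
    then show False using M0 by (simp add: \<gamma>_def)
  qed
  let ?C = "C(i0 := M)"
  have aX: "a i = a' i + n i0" if "i \<in> ?Y" for i using a[of i] that nd[OF that] dd by (simp add: a'_def)
  have a0: "a i0 = d'" using a[OF i0] dd by simp
  have n: "int d - int (a i) = int (n i)" if "i \<in> X" for i
    using a[OF that] member_le_sum[OF that, of n] X(1) d by simp
  then have hX: "(\<Sum>i\<in>X. hdim (int d - int (a i))) = (\<Sum>i\<in>X. hdim (int (n i)))" by simp
  have "(\<Sum>i\<in>X. hdim (int d - int (a i))) \<le> kdim (psum X (pwr ?C a) a (int d))"
  proof (rule kdim_psum_if_syzygy_trivial[OF X(1)])
    fix \<gamma> i
    assume \<gamma>: "\<And>i. i \<in> X \<Longrightarrow> \<gamma> i \<in> homR (int d - int (a i))" "(\<Sum>i\<in>X. pwr ?C a i * \<gamma> i) = 0" and i: "i \<in> X"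
    have s: "(\<Sum>i\<in>X. pwr ?C a i * \<gamma> i) = (\<Sum>i\<in>?Y. linform (C i) ^ (a' i + n i0) * \<gamma> i) + linform M ^ d' * \<gamma> i0"
      unfolding sum.remove[OF X(1) i0] using aX a0 by (simp add: pwr_def add.commute)
    have "\<gamma> i0 = 0 \<and> (\<forall>i\<in>?Y. \<gamma> i = 0)"
      by (rule syzygy_lift[where X = ?Y and n = n and C = C and e = a' and M = M and d = d' and m = "n i0", OF Y(1) triv' np M0])
        (use \<gamma> n i0 s in auto)
    then show "\<gamma> i = 0" using i by auto
  qed
  then show ?thesis using hX by (intro exI[of _ ?C]) simp
qed

subsection \<open>The apolarity pairing and the double curve\<close>

definition mfact :: "(nat \<Rightarrow>\<^sub>0 nat) \<Rightarrow> nat" where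
  "mfact m = (\<Prod>v\<in>keys m. fact (lookup m v))"

text \<open>The apolarity pairing: monomials are orthogonal, and the factorial weights make
  multiplication by a linear form adjoint to differentiation in its direction.\<close>

definition apolar :: "'k::field mpoly \<Rightarrow> 'k mpoly \<Rightarrow> 'k" where
  "apolar F g = (\<Sum>m\<in>keys F. lookup F m * of_nat (mfact m) * lookup g m)"

lemma mfact_shift: "mfact (m + single k 1) = (lookup m k + 1) * mfact m"
proof -
  let ?A = "insert k (keys m)"
  have eq: "mfact n = (\<Prod>v\<in>?A. fact (lookup n v))" if "keys n \<subseteq> ?A" for n
    unfolding mfact_def by (rule prod.mono_neutral_left) (use that in \<open>auto simp: in_keys_iff\<close>)
  have "mfact (m + single k 1) = (\<Prod>v\<in>?A. fact (lookup (m + single k 1) v))"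
    by (rule eq) (use keys_add[of m "single k 1"] in auto)
  also have "\<dots> = fact (lookup m k + 1) * (\<Prod>v\<in>?A - {k}. fact (lookup (m + single k 1) v))"
    by (subst prod.remove[of _ k]) (simp_all add: lookup_add)
  also have "(\<Prod>v\<in>?A - {k}. fact (lookup (m + single k 1) v)) = (\<Prod>v\<in>?A - {k}. fact (lookup m v) :: nat)"
    by (rule prod.cong) (auto simp: lookup_add lookup_single when_def)
  also have "fact (lookup m k + 1) * \<dots> = (lookup m k + 1) * (\<Prod>v\<in>?A. fact (lookup m v))"
    by (subst (2) prod.remove[of _ k]) (simp_all add: algebra_simps)
  also have "(\<Prod>v\<in>?A. fact (lookup m v)) = mfact m" by (rule eq[symmetric]) auto
  finally show ?thesis .
qed

lemma mfact_nonzero: "mfact m \<noteq> 0"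
  by (simp add: mfact_def)

lemma apolar_linear: "functional (apolar F)"
proof (rule Vector_Spaces.linear_iff[THEN iffD2], intro conjI allI)
  show "vector_space (msmult :: 'a \<Rightarrow> 'a mpoly \<Rightarrow> 'a mpoly)" by (rule mp.vector_space_axioms)
  show "vector_space ((*) :: 'a \<Rightarrow> 'a \<Rightarrow> 'a)" by (rule mpk.vs2.vector_space_axioms)
  show "apolar F (x + y) = apolar F x + apolar F y" for x y
    by (simp only: apolar_def lookup_add distrib_left sum.distrib)
  show "apolar F (msmult c x) = c * apolar F x" for c x
    unfolding apolar_def lookup_msmult sum_distrib_left by (rule sum.cong[OF refl]) (simp only: mult_ac)
qed

lemma apolar_single: "apolar F (single m c) = lookup F m * of_nat (mfact m) * c"
proof -
  have "apolar F (single m c) = (\<Sum>m'\<in>keys F. if m' = m then lookup F m * of_nat (mfact m) * c else 0)"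
    unfolding apolar_def by (rule sum.cong[OF refl]) (auto simp: lookup_single when_def)
  then show ?thesis by (simp add: in_keys_iff)
qed

lemma apolar_var_single:
  "apolar F (var k * single m c) = lookup (pderiv_var k F) m * of_nat (mfact m) * c"
proof -
  have "var k * single m c = single (m + single k 1) c"
    unfolding var_def mult_single by (simp add: add.commute)
  then show ?thesis unfolding apolar_single lookup_pderiv_var mfact_shift by (simp only: apolar_single mfact_shift of_nat_mult mult_ac)
qed

lemma apolar_linform: "apolar F (linform c * g) = apolar (dirderiv c F) g"
proof (induction g rule: mpoly_induct)
  case (1 m x)
  show ?case
    unfolding linform_eq distrib_right mult_msmult linear_fun_simps[OF apolar_linear] apolar_var_single
      apolar_single dirderiv_def lookup_add lookup_msmult
    by (simp only: distrib_right distrib_left mult_ac)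
next
  case (2 f g)
  then show ?case by (simp only: distrib_left linear_fun_simps[OF apolar_linear])
qed

lemma apolar_linform_power: "apolar F (linform c ^ a * g) = apolar ((dirderiv c ^^ a) F) g"
proof (induction a arbitrary: F)
  case (Suc a)
  show ?case unfolding power_Suc mult.assoc apolar_linform Suc funpow_Suc_right o_apply ..
qed simp

lemma dirderiv_one: "dirderiv v 1 = 0"
  by (simp add: dirderiv_def pderiv_var_def)

lemma dirderiv_funpow_zero: "(dirderiv v ^^ a) 0 = 0"
  by (induction a) (simp_all add: dirderiv_zero)

lemma dirderiv_funpow_add: "(dirderiv v ^^ a) (f + g) = (dirderiv v ^^ a) f + (dirderiv v ^^ a) g"
  by (induction a) (simp_all add: dirderiv_add)

lemma dirderiv_funpow_msmult: "(dirderiv v ^^ a) (msmult c f) = msmult c ((dirderiv v ^^ a) f)"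
  by (induction a) (simp_all add: dirderiv_msmult)

lemma dirderiv_funpow_homR: "f \<in> homR j \<Longrightarrow> (dirderiv v ^^ a) f \<in> homR (j - int a)"
proof (induction a)
  case (Suc a)
  then show ?case using dirderiv_homR[of "(dirderiv v ^^ a) f" "j - int a" v] by (simp add: algebra_simps)
qed simp

text \<open>Degrees in the direction v add under multiplication, by the Leibniz rule; degree p means
  being killed by the derivative of order p + 1.\<close>

lemma dirderiv_nilpotent_mult:
  "(dirderiv v ^^ Suc p) f = 0 \<Longrightarrow> (dirderiv v ^^ Suc q) g = 0 \<Longrightarrow> (dirderiv v ^^ Suc (p + q)) (f * g) = 0"
proof (induction "p + q" arbitrary: p q f g rule: less_induct)
  case less
  have "(dirderiv v ^^ (p + q)) (dirderiv v f * g) = 0"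
  proof (cases p)
    case 0
    then show ?thesis using less.prems by (simp add: dirderiv_funpow_zero)
  next
    case (Suc p')
    have "(dirderiv v ^^ Suc p') (dirderiv v f) = 0" using less.prems(1) unfolding Suc by (simp only: funpow_Suc_right o_apply)
    then have "(dirderiv v ^^ Suc (p' + q)) (dirderiv v f * g) = 0" using less.prems(2) Suc by (intro less.hyps) auto
    then show ?thesis using Suc by simp
  qed
  moreover have "(dirderiv v ^^ (p + q)) (f * dirderiv v g) = 0"
  proof (cases q)
    case 0
    then show ?thesis using less.prems by (simp add: dirderiv_funpow_zero)
  next
    case (Suc q')
    have "(dirderiv v ^^ Suc q') (dirderiv v g) = 0" using less.prems(2) unfolding Suc by (simp only: funpow_Suc_right o_apply)
    then have "(dirderiv v ^^ Suc (p + q')) (f * dirderiv v g) = 0" using less.prems(1) Suc by (intro less.hyps) auto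
    then show ?thesis using Suc by simp
  qed
  ultimately show ?case
    unfolding funpow_Suc_right o_apply dirderiv_mult dirderiv_funpow_add by simp
qed

lemma dirderiv_nilpotent_power:
  "(dirderiv v ^^ Suc p) f = 0 \<Longrightarrow> (dirderiv v ^^ Suc (n * p)) (f ^ n) = 0"
proof (induction n)
  case 0
  have "dirderiv v 1 = 0" by (rule dirderiv_one)
  then show ?case by simp
next
  case (Suc n)
  then show ?case using dirderiv_nilpotent_mult[of p v f "n * p" "f ^ n"] by simp
qed

lemma dirderiv_nilpotent_prod:
  assumes "finite S" "\<And>k. k \<in> S \<Longrightarrow> (dirderiv v ^^ Suc (r k)) (f k) = 0"
  shows "(dirderiv v ^^ Suc (\<Sum>k\<in>S. r k)) (\<Prod>k\<in>S. f k) = 0"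
  using assms
proof (induction S rule: finite_induct)
  case empty
  have "dirderiv v 1 = 0" by (rule dirderiv_one)
  then show ?case by simp
next
  case (insert k S)
  then have "(dirderiv v ^^ Suc (r k + (\<Sum>k\<in>S. r k))) (f k * (\<Prod>k\<in>S. f k)) = 0"
    by (intro dirderiv_nilpotent_mult) auto
  then show ?case using insert.hyps by simp
qed

section \<open>Curves with prescribed multiplicities\<close>

lemma common_zero_of_functionals:
  assumes "finite K" "\<And>k. k \<in> K \<Longrightarrow> functional (\<psi> k)"
    "mp.subspace V" "findim V" "card K < kdim V"
  shows "\<exists>f\<in>V. f \<noteq> 0 \<and> (\<forall>k\<in>K. \<psi> k f = 0)"
  using assms
proof (induction K arbitrary: V rule: finite_induct)
  case empty
  then have "V \<noteq> {0}" by (auto simp: kdim_zero)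
  then show ?case using mp.subspace_0[OF empty.prems(2)] by auto
next
  case (insert k K)
  note lin = linear_fun_simps[OF insert.prems(1)[OF insertI1]]
  let ?W = "{f \<in> V. \<psi> k f = 0}"
  have W: "mp.subspace ?W"
    using insert.prems(2) by (auto intro!: mp.subspaceI simp: lin mp.subspace_0 mp.subspace_add mp.subspace_scale)
  have fW: "findim ?W" by (rule findim_subset[OF insert.prems(3)]) auto
  have "kdim V \<le> kdim ?W + 1"
  proof (cases "\<exists>w\<in>V. \<psi> k w \<noteq> 0")
    case True
    then obtain w where w: "w \<in> V" "\<psi> k w \<noteq> 0" by blast
    have "V \<subseteq> mp.span (insert w ?W)"
    proof
      fix f assume f: "f \<in> V"
      let ?c = "\<psi> k f / \<psi> k w"
      have "\<psi> k (f + msmult (- ?c) w) = 0" unfolding lin using w by simp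
      moreover have "f + msmult (- ?c) w \<in> V"
        using f w insert.prems(2) by (intro mp.subspace_add mp.subspace_scale)
      ultimately have "f + msmult (- ?c) w \<in> mp.span (insert w ?W)" by (intro mp.span_base) simp
      moreover have "msmult ?c w \<in> mp.span (insert w ?W)" by (intro mp.span_scale mp.span_base) simp
      ultimately have "(f + msmult (- ?c) w) + msmult ?c w \<in> mp.span (insert w ?W)" by (rule mp.span_add)
      then show "f \<in> mp.span (insert w ?W)" by simp
    qed
    moreover have "findim (mp.span (insert w ?W))"
      using findim_subset[OF insert.prems(3) mp.span_minimal[of "insert w ?W" V]] w insert.prems(2) by blast
    ultimately have "kdim V \<le> kdim (mp.span (insert w ?W))" by (rule kdim_mono)
    also have "\<dots> = kdim ?W + 1" by (rule kdim_span_insert[OF fW W]) (use w in auto)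
    finally show ?thesis .
  next
    case False
    then have "?W = V" by auto
    then show ?thesis by simp
  qed
  then have "card K < kdim ?W" using insert.prems(4) insert.hyps by simp
  then have "\<exists>f\<in>?W. f \<noteq> 0 \<and> (\<forall>k\<in>K. \<psi> k f = 0)"
    by (intro insert.IH W fW) (use insert.prems in auto)
  then show ?case by auto
qed

lemma lookup_dirderiv_linear:
  "functional (\<lambda>f. lookup ((dirderiv v ^^ a) f) m)"
proof (rule Vector_Spaces.linear_iff[THEN iffD2], intro conjI allI)
  show "vector_space (msmult :: 'a \<Rightarrow> 'a mpoly \<Rightarrow> 'a mpoly)" by (rule mp.vector_space_axioms)
  show "vector_space ((*) :: 'a \<Rightarrow> 'a \<Rightarrow> 'a)" by (rule mpk.vs2.vector_space_axioms)
qed (simp_all add: dirderiv_funpow_add dirderiv_funpow_msmult lookup_add lookup_msmult)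

lemma homR_zero_if_lookup: "f \<in> homR j \<Longrightarrow> (\<And>m. m \<in> mons j \<Longrightarrow> lookup f m = 0) \<Longrightarrow> f = 0"
  by (rule poly_mapping_eqI) (metis homR_iff in_keys_iff lookup_zero subset_iff)

text \<open>Being killed by the r-th derivative in direction v means multiplicity at least e - r + 1
  at v; this is one linear condition for each coefficient of a form of degree e - r.\<close>

lemma exists_form_killed:
  assumes "finite K" "(\<Sum>k\<in>K. hdim (int e - int (r k))) < hdim (int e)"
  obtains h :: "'k::field mpoly" where "h \<in> homR (int e)" "h \<noteq> 0" "\<And>k. k \<in> K \<Longrightarrow> (dirderiv (v k) ^^ r k) h = 0"
proof -
  let ?K = "SIGMA k:K. mons (int e - int (r k))"
  have "card ?K < kdim (homR (int e) :: 'k mpoly set)"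
    using assms by (simp add: card_SigmaI finite_mons card_mons kdim_homR)
  then have "\<exists>h\<in>homR (int e). h \<noteq> 0 \<and> (\<forall>x\<in>?K. lookup ((dirderiv (v (fst x)) ^^ r (fst x)) h) (snd x) = (0::'k))"
    by (intro common_zero_of_functionals lookup_dirderiv_linear subspace_homR findim_homR)
      (use assms(1) finite_mons in auto)
  then obtain h :: "'k mpoly" where h: "h \<in> homR (int e)" "h \<noteq> 0"
    "\<And>k m. k \<in> K \<Longrightarrow> m \<in> mons (int e - int (r k)) \<Longrightarrow> lookup ((dirderiv (v k) ^^ r k) h) m = 0"
    by fastforce
  show ?thesis
    by (rule that[OF h(1,2)]) (rule homR_zero_if_lookup[OF dirderiv_funpow_homR[OF h(1)] h(3)])
qed

text \<open>The witness is the form h^2 times powers of the lines through the point C q and the points C i,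
  where h is a curve of degree e with an (e-1)-fold point at C q through the 2e points C i.\<close>
lemma double_curve_not_full:
  fixes C :: "nat \<Rightarrow> nat \<Rightarrow> 'k::field_char_0"
  assumes X: "finite X" "card X = 2 * e" "e \<ge> 1" "\<And>i. i \<in> X \<Longrightarrow> n i \<ge> 1" "q \<notin> X"
    and d: "d = (\<Sum>i\<in>X. n i)" and a: "\<And>i. i \<in> X \<Longrightarrow> a i = d - n i" "a q = 3"
    and Y: "finite Y" "\<And>i. i \<in> Y \<Longrightarrow> i \<in> X \<or> i = q \<or> a i > d"
  shows "\<not> homR (int d) \<subseteq> psum Y (pwr C a) a (int d)"
proof
  assume full: "homR (int d) \<subseteq> psum Y (pwr C a) a (int d)"
  have he: "hdim (int e) = hdim (int e - 2) + 2 * e + 1"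
    using hdim_diff[of "int e"] hdim_diff[of "int e - 1"] X(3) by simp
  \<comment> \<open>Order 2 forces an (e-1)-fold point at \<open>C q\<close>, order e only a passage
    through \<open>C i\<close>. The conditions number one less than dim R_e.\<close>
  let ?r = "\<lambda>i. if i = q then 2 else e"
  have "(\<Sum>i\<in>insert q X. hdim (int e - int (?r i))) = hdim (int e - 2) + (\<Sum>i\<in>X. 1)"
  proof -
    have "(\<Sum>i\<in>X. hdim (int e - int (?r i))) = (\<Sum>i\<in>X. 1)"
      by (rule sum.cong[OF refl]) (use X(5) in \<open>auto simp: hdim_0\<close>)
    then show ?thesis using X(1,5) by simp
  qed
  also have "\<dots> < hdim (int e)" using he X(2) by simp
  finally have "(\<Sum>i\<in>insert q X. hdim (int e - int (?r i))) < hdim (int e)" .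
  then obtain h :: "'k mpoly" where h: "h \<in> homR (int e)" "h \<noteq> 0"
    "\<And>i. i \<in> insert q X \<Longrightarrow> (dirderiv (C i) ^^ ?r i) h = 0"
    using exists_form_killed[of "insert q X" e ?r C] X(1) by blast
  have "\<exists>l :: 'k mpoly. l \<in> homR 1 \<and> l \<noteq> 0 \<and> dirderiv (C q) l = 0 \<and> dirderiv (C i) l = 0" if i: "i \<in> X" for i
  proof -
    have "i \<noteq> q" using X(5) i by auto
    then have "(\<Sum>k\<in>{q, i}. hdim (int 1 - int 1)) < hdim (int 1)" by (simp add: hdim_0 hdim_1)
    then obtain l :: "'k mpoly" where "l \<in> homR (int 1)" "l \<noteq> 0" "\<And>k. k \<in> {q, i} \<Longrightarrow> (dirderiv (C k) ^^ 1) l = 0"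
      using exists_form_killed[of "{q, i}" 1 "\<lambda>_. 1" C] by blast
    then show ?thesis by auto
  qed
  then obtain l :: "nat \<Rightarrow> 'k mpoly" where
    l: "\<And>i. i \<in> X \<Longrightarrow> l i \<in> homR 1 \<and> l i \<noteq> 0 \<and> dirderiv (C q) (l i) = 0 \<and> dirderiv (C i) (l i) = 0"
    by metis
  \<comment> \<open>The degree is 2 e plus the sum of the n k - 1, and this is d because X has 2 e
    elements.\<close>
  define F where "F = h\<^sup>2 * (\<Prod>k\<in>X. l k ^ (n k - 1))"
  have F0: "F \<noteq> 0" unfolding F_def using h(2) l X(1) by simp
  have "(\<Prod>k\<in>S. l k ^ (n k - 1)) \<in> homR (int (\<Sum>k\<in>S. n k - 1))" if "finite S" "S \<subseteq> X" for S
    using that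
  proof (induction S rule: finite_induct)
    case empty then show ?case by (simp add: homR_one)
  next
    case (insert k S)
    have "l k ^ (n k - 1) \<in> homR (int (n k - 1) * 1)" by (rule homR_power) (use l insert.prems in auto)
    from homR_mult[OF this, of "\<Prod>k\<in>S. l k ^ (n k - 1)" "int (\<Sum>k\<in>S. n k - 1)"]
    show ?case using insert by simp
  qed
  then have "F \<in> homR (int 2 * int e + int (\<Sum>k\<in>X. n k - 1))"
    unfolding F_def using X(1) by (intro homR_mult homR_power h) auto
  moreover have s1: "(\<Sum>k\<in>X. n k - 1) + 2 * e = d"
  proof -
    have "(\<Sum>k\<in>X. n k - 1) + card X = (\<Sum>k\<in>X. (n k - 1) + 1)" by (simp only: sum.distrib card_eq_sum)
    also have "\<dots> = d" unfolding d
    proof (rule sum.cong[OF refl])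
      show "(n k - 1) + 1 = n k" if "k \<in> X" for k using X(4)[OF that] by simp
    qed
    finally show ?thesis using X(2) by simp
  qed
  then have "int 2 * int e + int (\<Sum>k\<in>X. n k - 1) = int d" by (metis add.commute of_nat_add of_nat_mult)
  ultimately have FR: "F \<in> homR (int d)" by simp
  have lsuc: "(dirderiv v ^^ Suc 1) (l k) = 0" if "k \<in> X" for v k
    using dirderiv_funpow_homR[of "l k" 1 2 v] l[OF that] by (simp add: homR_neg numeral_2_eq_2)
  have Dq: "(dirderiv (C q) ^^ 3) F = 0"
  proof -
    have "(dirderiv (C q) ^^ Suc (2 * 1)) (h\<^sup>2) = 0"
      by (rule dirderiv_nilpotent_power) (use h(3)[of q] in \<open>simp add: numeral_2_eq_2\<close>)
    moreover have "(dirderiv (C q) ^^ Suc (\<Sum>k\<in>X. 0)) (\<Prod>k\<in>X. l k ^ (n k - 1)) = 0"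
    proof (rule dirderiv_nilpotent_prod[OF X(1)])
      show "(dirderiv (C q) ^^ Suc 0) (l k ^ (n k - 1)) = 0" if "k \<in> X" for k
        using dirderiv_nilpotent_power[of 0 "C q" "l k" "n k - 1"] l[OF that] by simp
    qed
    ultimately have "(dirderiv (C q) ^^ Suc (2 * 1 + (\<Sum>k\<in>X. 0))) F = 0"
      unfolding F_def by (rule dirderiv_nilpotent_mult)
    then show ?thesis by (simp add: numeral_3_eq_3 numeral_2_eq_2)
  qed
  have Di: "(dirderiv (C i) ^^ a i) F = 0" if i: "i \<in> X" for i
  proof -
    have "i \<noteq> q" using i X(5) by auto
    then have "(dirderiv (C i) ^^ Suc (e - 1)) h = 0" using h(3)[of i] i X(3) by simp
    then have "(dirderiv (C i) ^^ Suc (2 * (e - 1))) (h\<^sup>2) = 0" by (rule dirderiv_nilpotent_power)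
    moreover have "(dirderiv (C i) ^^ Suc (\<Sum>k\<in>X. if k = i then 0 else n k - 1)) (\<Prod>k\<in>X. l k ^ (n k - 1)) = 0"
    proof (rule dirderiv_nilpotent_prod[OF X(1)])
      show "(dirderiv (C i) ^^ Suc (if k = i then 0 else n k - 1)) (l k ^ (n k - 1)) = 0" if k: "k \<in> X" for k
        using dirderiv_nilpotent_power[of 0 "C i" "l k" "n k - 1"] l[OF k]
          dirderiv_nilpotent_power[OF lsuc[OF k], of "n k - 1" "C i"] by (cases "k = i") auto
    qed
    ultimately have "(dirderiv (C i) ^^ Suc (2 * (e - 1) + (\<Sum>k\<in>X. if k = i then 0 else n k - 1))) F = 0"
      unfolding F_def by (rule dirderiv_nilpotent_mult)
    \<comment> \<open>In the direction \<open>C i\<close> the form h has degree at most e - 1, the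
      line l i degree 0 and every other line at most 1; the total falls one short of a i.\<close>
    moreover have "Suc (2 * (e - 1) + (\<Sum>k\<in>X. if k = i then 0 else n k - 1)) = a i"
    proof -
      have "(\<Sum>k\<in>X. n k - 1) = (n i - 1) + (\<Sum>k\<in>X - {i}. n k - 1)" using X(1) i by (rule sum.remove)
      moreover have "(\<Sum>k\<in>X. if k = i then 0 else n k - 1) = (\<Sum>k\<in>X - {i}. n k - 1)"
        by (rule sum.mono_neutral_cong_right) (use X(1) i in auto)
      ultimately show ?thesis using a(1)[OF i] s1 X(3) X(4)[OF i] by simp
    qed
    ultimately show ?thesis by (simp only:)
  qed
  have "apolar F f = 0" if f: "f \<in> psum Y (pwr C a) a (int d)" for f
  proof -
    obtain g where g: "\<forall>i\<in>Y. g i \<in> homR (int d - int (a i))" "f = (\<Sum>i\<in>Y. pwr C a i * g i)"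
      using f unfolding psum_def by blast
    have "apolar F (pwr C a i * g i) = 0" if i: "i \<in> Y" for i
    proof (cases "a i > d")
      case True
      then have "g i = 0" using g(1) i homR_neg[of "int d - int (a i)"] by auto
      then show ?thesis by (simp add: linear_fun_simps[OF apolar_linear])
    next
      case False
      then have "(dirderiv (C i) ^^ a i) F = 0" using Y(2)[OF i] Di Dq a(2) by auto
      then show ?thesis unfolding pwr_def apolar_linform_power by (simp add: apolar_def)
    qed
    then show ?thesis unfolding g(2) linear_fun_simps[OF apolar_linear] by simp
  qed
  moreover obtain m where m: "m \<in> keys F" using F0 by (metis lookup_zero poly_mapping_eqI in_keys_iff)
  moreover have "m \<in> mons (int d)" using m FR by (auto simp: homR_iff)
  then have "single m 1 \<in> psum Y (pwr C a) a (int d)" using full single_homR by blast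
  ultimately have "apolar F (single m 1) = 0" by blast
  then show False using m mfact_nonzero[of m] by (simp add: apolar_single in_keys_iff)
qed

subsection \<open>Numerical conditions\<close>

lemma sum_slack_Suc:
  fixes a :: "nat \<Rightarrow> nat"
  shows "(\<Sum>i<s. Suc j + 1 - a i) = (\<Sum>i<s. j + 1 - a i) + card {i. i < s \<and> a i \<le> j + 1}"
proof -
  have "(\<Sum>i<s. Suc j + 1 - a i) = (\<Sum>i<s. (j + 1 - a i) + (if a i \<le> j + 1 then 1 else 0))"
    by (rule sum.cong) auto
  also have "\<dots> = (\<Sum>i<s. j + 1 - a i) + card {i. i < s \<and> a i \<le> j + 1}"
    by (simp add: sum.distrib sum.If_cases Int_def)
  finally show ?thesis .
qed

lemma sum_slack_restrict:
  fixes a :: "nat \<Rightarrow> nat"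
  shows "(\<Sum>i\<in>{i. i < s \<and> a i \<le> j}. j + 1 - a i) = (\<Sum>i<s. j + 1 - a i)"
  by (rule sum.mono_neutral_left) auto

text \<open>With at least two forms the sum outgrows j, so the admissible j are bounded by a 0 + a 1
  and the greatest one exists; positivity of the a i makes 0 admissible.\<close>

lemma pnum_properties:
  assumes "s \<ge> 2" "\<forall>i<s. a i > 0"
  shows "(\<Sum>i<s. pnum s a + 1 - a i) \<le> pnum s a" "j > pnum s a \<Longrightarrow> (\<Sum>i<s. j + 1 - a i) > j"
proof -
  let ?P = "\<lambda>j. (\<Sum>i<s. j + 1 - a i) \<le> j"
  have P: "pnum s a = (GREATEST j. ?P j)" unfolding pnum_def sum_slack_restrict ..
  have P0: "?P 0" using assms(2) by (simp add: Suc_le_eq)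
  have bd: "j \<le> a 0 + a 1" if "?P j" for j
  proof -
    have "(\<Sum>i\<in>{0, 1}. j + 1 - a i) \<le> (\<Sum>i<s. j + 1 - a i)"
      by (rule sum_mono2) (use assms(1) in auto)
    then show ?thesis using that by simp
  qed
  show "(\<Sum>i<s. pnum s a + 1 - a i) \<le> pnum s a"
    unfolding P by (rule GreatestI_nat[of ?P 0 "a 0 + a 1"]) (use P0 bd in auto)
  show "(\<Sum>i<s. j + 1 - a i) > j" if "j > pnum s a"
  proof (rule ccontr)
    assume "\<not> ?thesis"
    then have "j \<le> (GREATEST j. ?P j)" by (intro Greatest_le_nat[of ?P j "a 0 + a 1"]) (use bd in auto)
    then show False using that P by simp
  qed
qed

text \<open>These two inequalities are all that is needed of \<open>p\<close>: slack in degree p and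
  none in degree p + 1.\<close>

locale exponents =
  fixes s :: nat and a :: "nat \<Rightarrow> nat" and p :: nat
  assumes slack_p: "(\<Sum>i<s. p + 1 - a i) \<le> p"
    and slack_p1: "p + 2 \<le> (\<Sum>i<s. p + 2 - a i)"
begin

text \<open>The bound for the dimension of R/(I, L) in degree p, the last degree where that bound is
  positive. The criterion of the theorem reads N = \<delta> + 1.\<close>

definition "\<delta> = p + 1 - (\<Sum>i<s. p + 1 - a i)"
definition "N = card {i. i < s \<and> a i \<le> p + 1}"
definition "nA = card {i. i < s \<and> a i \<le> p}"
definition "n1 = card {i. i < s \<and> a i = p + 1}"
definition "n2 = card {i. i < s \<and> a i = p + 2}"
text \<open>The dimension of I_j if there are no syzygies in degree j, and an upper bound in any
  case.\<close>

definition "w j = (\<Sum>i<s. hdim (j - int (a i)))"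

lemma slack_0: "(\<Sum>i<s. p + 1 - a i) + \<delta> = p + 1" "\<delta> \<ge> 1"
  using slack_p by (auto simp: \<delta>_def)

lemma N_split: "N = nA + n1"
proof -
  have "{i. i < s \<and> a i \<le> p + 1} = {i. i < s \<and> a i \<le> p} \<union> {i. i < s \<and> a i = p + 1}" by auto
  moreover have "card ({i. i < s \<and> a i \<le> p} \<union> {i. i < s \<and> a i = p + 1}) = nA + n1"
    unfolding nA_def n1_def by (rule card_Un_disjoint) auto
  ultimately show ?thesis unfolding N_def by (simp only:)
qed

lemma slack_1: "(\<Sum>i<s. p + 2 - a i) = (\<Sum>i<s. p + 1 - a i) + N"
  using sum_slack_Suc[of p a s] by (simp add: N_def)

lemma slack_2: "(\<Sum>i<s. p + 3 - a i) = (\<Sum>i<s. p + 2 - a i) + N + n2"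
proof -
  have "{i. i < s \<and> a i \<le> p + 2} = {i. i < s \<and> a i \<le> p + 1} \<union> {i. i < s \<and> a i = p + 2}" by auto
  moreover have "card ({i. i < s \<and> a i \<le> p + 1} \<union> {i. i < s \<and> a i = p + 2}) = N + n2"
    unfolding N_def n2_def by (rule card_Un_disjoint) auto
  ultimately have "card {i. i < s \<and> a i \<le> p + 2} = N + n2" by (simp only:)
  then show ?thesis using sum_slack_Suc[of "p + 1" a s] by (simp add: numeral_3_eq_3 numeral_2_eq_2)
qed

lemma slack_m1: "(\<Sum>i<s. p - a i) + nA = (\<Sum>i<s. p + 1 - a i)"
proof -
  have "(\<Sum>i<s. p + 1 - a i) = (\<Sum>i<s. (p - a i) + (if a i \<le> p then 1 else 0))"
    by (rule sum.cong) auto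
  then show ?thesis by (simp add: sum.distrib sum.If_cases Int_def nA_def)
qed

lemma N_ge: "\<delta> + 1 \<le> N"
  using slack_p1 slack_1 slack_0 by linarith

lemma w_Suc: "int (w j) = int (w (j - 1)) + (\<Sum>i<s. max 0 (j + 1 - int (a i)))"
proof -
  have "int (hdim (j - int (a i))) = int (hdim (j - 1 - int (a i))) + max 0 (j + 1 - int (a i))" for i
    using hdim_diff[of "j - int (a i)"] by (simp add: algebra_simps)
  then show ?thesis by (simp add: w_def sum.distrib)
qed

lemma w_nat: "w (int j) = w (int j - 1) + (\<Sum>i<s. j + 1 - a i)"
proof -
  have "(\<Sum>i<s. max 0 (int j + 1 - int (a i))) = int (\<Sum>i<s. j + 1 - a i)"
    unfolding of_nat_sum by (rule sum.cong) auto
  then show ?thesis using w_Suc[of "int j"] by linarith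
qed

lemma w_neg: "j < 0 \<Longrightarrow> w j = 0"
  by (simp add: w_def hdim_neg)

lemma w_pm1: "w (int p - 1) = w (int p - 2) + (\<Sum>i<s. p - a i)"
proof -
  have "(\<Sum>i<s. max 0 (int p - int (a i))) = int (\<Sum>i<s. p - a i)"
    unfolding of_nat_sum by (rule sum.cong) auto
  then show ?thesis using w_Suc[of "int p - 1"] by (simp del: of_nat_sum)
qed

text \<open>Together with \<open>hdim_3\<close>, the predicted dimensions of R/I in degrees p + 1
  and p - 2 differ by 3 \<delta> - n1, the very number that bounds the cokernel.\<close>

lemma w_3_p1: "w (int p + 1) + 3 * \<delta> = w (int p - 2) + 3 * (p + 1) + n1"
proof -
  have "w (int p + 1) = w (int p) + (\<Sum>i<s. p + 2 - a i)" using w_nat[of "p + 1"] by (simp add: add.commute[of 1 "int p"])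
  moreover have "w (int p) = w (int p - 1) + (\<Sum>i<s. p + 1 - a i)" by (rule w_nat)
  moreover have "x1 + 3 * \<delta> = x4 + 3 * (p + 1) + n1"
    if "x1 = x2 + y1" "x2 = x3 + y2" "x3 = x4 + y3" "y2 + \<delta> = p + 1" "y1 = y2 + N" "y3 + nA = y2"
    for x1 x2 x3 x4 y1 y2 y3 :: nat using that N_split by simp
  ultimately show ?thesis using w_pm1 slack_0(1) slack_1 slack_m1 by blast
qed


text \<open>In view of \<open>hdim_3\<close>, R/I has equal predicted dimensions in degrees p - 1
  and p + 2.\<close>

lemma w_3_critical:
  assumes "N = \<delta> + 1" "n2 = 0"
  shows "w (int p + 2) = w (int p - 1) + 3 * (p + 2)"
proof -
  have "w (int p + 2) = w (int p + 1) + (\<Sum>i<s. p + 3 - a i)" using w_nat[of "p + 2"]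
    by (simp add: add.commute[of 1 "int p"] add.commute[of 2 "int p"] eval_nat_numeral)
  moreover have "w (int p + 1) = w (int p) + (\<Sum>i<s. p + 2 - a i)" using w_nat[of "p + 1"] by (simp add: add.commute[of 1 "int p"])
  moreover have "w (int p) = w (int p - 1) + (\<Sum>i<s. p + 1 - a i)" by (rule w_nat)
  moreover have "x1 = x4 + 3 * (p + 2)"
    if "x1 = x2 + y1" "x2 = x3 + y2" "x3 = x4 + y3" "y3 + \<delta> = p + 1" "y2 = y3 + N" "y1 = y2 + N + n2"
    for x1 x2 x3 x4 y1 y2 y3 :: nat using that assms by simp
  ultimately show ?thesis using slack_0(1) slack_1 slack_2 by blast
qed

lemma hdim_3: "hdim (int p + 1) = hdim (int p - 2) + 3 * (p + 1)" "hdim (int p + 2) = hdim (int p - 1) + 3 * (p + 2)"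
  using hdim_diff[of "int p + 2"] hdim_diff[of "int p + 1"] hdim_diff[of "int p"] hdim_diff[of "int p - 1"]
  by (simp_all add: add.commute[of 1])

lemma slack_le: assumes "j \<le> p" shows "(\<Sum>i<s. j + 1 - a i) \<le> j"
proof -
  have "(\<Sum>i<s. j + 1 - a i) * (p + 1) \<le> (j + 1) * p" by (rule slack_mono[OF slack_p assms])
  also have "\<dots> < (j + 1) * (p + 1)" by simp
  finally show ?thesis by (simp only: mult_less_cancel2) simp
qed

end

text \<open>The kernel before passing to the quotient contains the ideal piece, and by rank-nullity
  the hypothesis bounds its dimension by that of the piece.\<close>

lemma injective_if_kdim:
  fixes F :: "'k::field mpoly"
  assumes X: "finite X" "\<And>i. i \<in> X \<Longrightarrow> G i \<in> homR (int (e i))" and F: "F \<in> homR k"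
    and le: "kdim (psum X G e j) + hdim (j - k) \<le> kdim (sumF (psum X G e j) F (homR (j - k))) + kdim (psum X G e (j - k))"
    and g: "g \<in> homR (j - k)" "F * g \<in> psum X G e j"
  shows "g \<in> psum X G e (j - k)"
proof -
  let ?V = "psum X G e j" and ?U = "psum X G e (j - k)"
  let ?K = "{g \<in> homR (j - k). F * g \<in> ?V}"
  have K: "mp.subspace ?K"
    using subspace_homR[of "j - k", where 'a = 'k] subspace_psum[OF X(1), of G e j]
    by (auto intro!: mp.subspaceI simp: mp.subspace_0 mp.subspace_add mp.subspace_scale distrib_left mult_msmult)
  have fK: "findim ?K" by (rule findim_subset[OF findim_homR]) auto
  have "kdim (sumF ?V F (homR (j - k))) + kdim ?K \<le> kdim ?V + kdim (homR (j - k) :: 'k mpoly set)"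
    by (rule kdim_sumF_le[OF findim_psum[OF X(1)] findim_homR subspace_psum[OF X(1)] K]) auto
  then have "kdim ?K \<le> kdim ?U" using le by (simp add: kdim_homR)
  moreover have "?U \<subseteq> ?K"
    using psum_homR[of X G e "j - k", OF X(2)] psum_mult[OF _ F, of _ X G e "j - k"] by auto
  ultimately have "?U = ?K" using kdim_subspace_eq[OF fK subspace_psum[OF X(1)]] by blast
  then show ?thesis using g by blast
qed

lemma full_if_kdim:
  assumes "mp.subspace V" "V \<subseteq> homR j" "hdim j \<le> kdim V" shows "homR j = V"
  using kdim_subspace_eq[OF findim_homR assms(1,2)] assms(3) by (simp add: kdim_homR)

text \<open>R/(I, F) is generated in degree 0, so once it vanishes in some degree it vanishes in the
  next.\<close>

lemma linear_surjective_Suc: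
  fixes F :: "'k::field mpoly"
  assumes "finite X" "homR j \<subseteq> sumF (psum X G e j) F (homR (j - 1))" "j \<ge> 0"
  shows "homR (j + 1) \<subseteq> sumF (psum X G e (j + 1)) F (homR j)"
proof
  fix f :: "'k mpoly" assume "f \<in> homR (j + 1)"
  then have "f \<in> mp.span {var k * g | k g. k < 3 \<and> g \<in> homR j}" by (rule homR_Suc_span[OF _ assms(3)])
  moreover have "mp.span {var k * g | k g. k < 3 \<and> g \<in> homR j} \<subseteq> sumF (psum X G e (j + 1)) F (homR j)"
  proof (rule mp.span_minimal[OF _ subspace_sumF[OF subspace_psum[OF assms(1)] subspace_homR]], safe)
    fix k :: nat and g :: "'k mpoly" assume k: "k < 3" and g: "g \<in> homR j"
    then obtain v h where vh: "g = v + F * h" "v \<in> psum X G e j" "h \<in> homR (j - 1)"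
      using assms(2) unfolding sumF_def by blast
    have "var k * v \<in> psum X G e (j + 1)" by (rule psum_mult[OF vh(2) var_homR[OF k]])
    moreover have "var k * h \<in> homR (1 + (j - 1))" by (rule homR_mult[OF var_homR[OF k] vh(3)])
    moreover have "var k * g = var k * v + F * (var k * h)" unfolding vh(1) by (simp only: distrib_left mult_ac)
    ultimately show "var k * g \<in> sumF (psum X G e (j + 1)) F (homR j)" unfolding sumF_def by auto
  qed
  ultimately show "f \<in> sumF (psum X G e (j + 1)) F (homR j)" by blast
qed

subsection \<open>Maximal rank at a fixed configuration\<close>

text \<open>Finitely many lower bounds on dimensions, hence an open condition. The family
  \<open>line\<close> can stop at p + 1, because from there on surjectivity of L propagates.\<close>

locale general_configuration = exponents +
  fixes C :: "nat \<Rightarrow> nat \<Rightarrow> 'k::field_char_0"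
  assumes line: "\<And>j. j \<le> p + 1 \<Longrightarrow> hdim (int j) \<le> kdim (sumF (psum {..<s} (pwr C a) a (int j)) (linform (C s)) (homR (int j - 1)))
        + (j + 1 - (\<Sum>i<s. j + 1 - a i))"
    and triple1: "hdim (int p + 1) \<le> kdim (sumF (psum {..<s} (pwr C a) a (int p + 1)) (linform (C s) ^ 3) (homR (int p - 2))) + (3 * \<delta> - n1)"
    and triple2: "hdim (int p + 2) \<le> kdim (sumF (psum {..<s} (pwr C a) a (int p + 2)) (linform (C s) ^ 3) (homR (int p - 1))) + (excess (\<delta> + 1) N - n2)"
    and critical: "N = \<delta> + 1 \<Longrightarrow> N \<ge> 4 \<Longrightarrow> even N \<Longrightarrow> n2 = 0 \<Longrightarrow> w (int p + 2) \<le> kdim (psum {..<s} (pwr C a) a (int p + 2))"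
begin

abbreviation "V j \<equiv> psum {..<s} (pwr C a) a j"
abbreviation "L \<equiv> linform (C s)"
abbreviation "S j \<equiv> sumF (V j) (L ^ 3) (homR (j - 3))"

lemma V_facts: "mp.subspace (V j)" "findim (V j)" "kdim (V j) \<le> w j" "V j \<subseteq> homR j"
  using kdim_psum_le[of "{..<s}" "pwr C a" a j] by (simp_all add: subspace_psum findim_psum psum_pwr_homR w_def)

lemma L3: "L ^ 3 \<in> homR 3"
  using linform_power_homR[of "C s" 3] by simp

lemma S_facts: "mp.subspace (S j)" "S j \<subseteq> homR j"
proof -
  show "mp.subspace (S j)" by (intro subspace_sumF V_facts subspace_homR)
  have "L ^ 3 * g \<in> homR j" if "g \<in> homR (j - 3)" for g using homR_mult[OF L3 that] by simp
  then show "S j \<subseteq> homR j" using V_facts(4)[of j] add_homR unfolding sumF_def by blast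
qed

lemma mult_inj_iff: "mult_inj s (pwr C a) a (L ^ 3) 3 j \<longleftrightarrow> (\<forall>g\<in>homR (j - 3). L ^ 3 * g \<in> V j \<longrightarrow> g \<in> V (j - 3))"
  by (simp add: mult_inj_def idealdeg_psum)

lemma mult_surj_iff: "mult_surj s (pwr C a) a (L ^ 3) 3 j \<longleftrightarrow> homR j \<subseteq> S j"
  by (simp add: mult_surj_def image_plus_ideal_def idealdeg_psum sumF_def)

lemma kdim_V: assumes "j \<le> int p" shows "kdim (V j) = w j"
proof (cases "j < 0")
  case True then show ?thesis using V_facts(3)[of j] w_neg by simp
next
  case False
  then obtain t where t: "j = int t" by (metis nonneg_int_cases not_less)
  have "(\<Sum>i<s. hdim (int t - int (a i))) \<le> kdim (V (int t))"
    by (rule line_induction[of "{..<s}" "pwr C a" a L p, OF _ pwr_homR linform_homR line])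
      (use assms t slack_le in \<open>auto intro: le_SucI\<close>)
  then show ?thesis using V_facts(3)[of j] t by (simp add: w_def)
qed

text \<open>Up to degree p both ideal pieces have exactly the predicted dimension, so the cokernel
  bound leaves no room for a kernel.\<close>

lemma L_injective:
  assumes "j \<le> int p" "g \<in> homR (j - 1)" "L * g \<in> V j" shows "g \<in> V (j - 1)"
proof (cases "j < 1")
  case True
  then have "g = 0" using assms(2) by (simp add: homR_neg)
  then show ?thesis by (simp add: mp.subspace_0[OF V_facts(1)])
next
  case False
  then obtain t where t: "j = int t" by (metis nonneg_int_cases not_less int_one_le_iff_zero_less less_imp_le)
  have "hdim (int t) = hdim (int t - 1) + (t + 1)" using hdim_diff[of "int t"] by simp
  moreover have "kdim (V (int t)) = kdim (V (int t - 1)) + (\<Sum>i<s. t + 1 - a i)"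
    using kdim_V[of "int t"] kdim_V[of "int t - 1"] w_nat[of t] assms(1) t by simp
  ultimately have "kdim (V j) + hdim (j - 1) \<le> kdim (sumF (V j) L (homR (j - 1))) + kdim (V (j - 1))"
    unfolding t using line[of t] slack_le[of t] assms(1) t by simp
  then show ?thesis using injective_if_kdim[OF _ pwr_homR linform_homR _ assms(2,3)] by simp
qed

lemma injective_low: assumes "j \<le> int p" shows "mult_inj s (pwr C a) a (L ^ 3) 3 j"
  unfolding mult_inj_iff
proof (intro ballI impI)
  fix g assume g: "g \<in> homR (j - 3)" "L ^ 3 * g \<in> V j"
  have h1: "L * g \<in> homR (j - 2)" using homR_mult[OF linform_homR g(1)] by simp
  have h2: "L * (L * g) \<in> homR (j - 1)" using homR_mult[OF linform_homR h1] by simp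
  have "L * (L * (L * g)) \<in> V j" using g(2) by (simp add: power3_eq_cube mult.assoc)
  from L_injective[OF assms h2 this] have "L * (L * g) \<in> V (j - 1)" .
  then have "L * g \<in> V (j - 1 - 1)" by (rule L_injective[rotated 2]) (use h1 assms in simp_all)
  then have "g \<in> V (j - 1 - 1 - 1)" by (rule L_injective[rotated 2]) (use g assms in simp_all)
  then show "g \<in> V (j - 3)" by simp
qed

lemma L_surjective: assumes "j \<ge> int p + 1" shows "homR j \<subseteq> sumF (V j) L (homR (j - 1))"
  using assms
proof (induction j rule: int_ge_induct)
  case base
  have "L * g \<in> homR (int p + 1)" if "g \<in> homR (int p)" for g
    using homR_mult[OF linform_homR that] by (simp add: add.commute)
  then have "sumF (V (int p + 1)) L (homR (int p)) \<subseteq> homR (int p + 1)"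
    using V_facts(4)[of "int p + 1"] add_homR unfolding sumF_def by blast
  moreover have "hdim (int p + 1) \<le> kdim (sumF (V (int p + 1)) L (homR (int p)))"
    using line[of "p + 1"] slack_p1 by (simp add: add.commute)
  ultimately show ?case
    using full_if_kdim[OF subspace_sumF[OF V_facts(1) subspace_homR]] by fastforce
next
  case (step j)
  then show ?case using linear_surjective_Suc[of "{..<s}" j "pwr C a" a L] by simp
qed

text \<open>L has to be surjective onto degrees j, j - 1 and j - 2, and the last one must be at
  least p + 1.\<close>

lemma surjective_high: assumes "j \<ge> int p + 3" shows "mult_surj s (pwr C a) a (L ^ 3) 3 j"
  unfolding mult_surj_iff
proof
  fix f :: "'k mpoly" assume "f \<in> homR j"
  then obtain v1 f1 where 1: "f = v1 + L * f1" "v1 \<in> V j" "f1 \<in> homR (j - 1)"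
    using L_surjective[of j] assms unfolding sumF_def by auto
  obtain v2 f2 where 2: "f1 = v2 + L * f2" "v2 \<in> V (j - 1)" "f2 \<in> homR (j - 1 - 1)"
    using L_surjective[of "j - 1"] assms 1(3) unfolding sumF_def by auto
  obtain v3 f3 where 3: "f2 = v3 + L * f3" "v3 \<in> V (j - 1 - 1)" "f3 \<in> homR (j - 1 - 1 - 1)"
    using L_surjective[of "j - 1 - 1"] assms 2(3) unfolding sumF_def by auto
  have "L * v2 \<in> V j" using psum_mult[OF 2(2) linform_homR] by simp
  moreover have "L * v3 \<in> V (j - 1)" using psum_mult[OF 3(2) linform_homR] by simp
  then have "L * (L * v3) \<in> V j" using psum_mult[OF _ linform_homR, of "L * v3"] by fastforce
  ultimately have "v1 + L * v2 + L * (L * v3) \<in> V j"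
    using 1(2) by (intro mp.subspace_add[OF V_facts(1)])
  moreover have "f = (v1 + L * v2 + L * (L * v3)) + L ^ 3 * f3"
    unfolding 1 2 3 by (simp add: algebra_simps power3_eq_cube)
  ultimately show "f \<in> S j" using 3(3) unfolding sumF_def by auto
qed

text \<open>The sign of 3 \<delta> - n1 decides: if it is not positive, the cokernel bound is 0;
  otherwise the bound equals the difference of the predicted dimensions and forces
  injectivity.\<close>

lemma max_rank_p1: "max_rank s (pwr C a) a (L ^ 3) 3 (int p + 1)"
proof (cases "3 * \<delta> \<le> n1")
  case True
  then have "hdim (int p + 1) \<le> kdim (S (int p + 1))" using triple1 by simp
  then show ?thesis using full_if_kdim[OF S_facts] by (simp add: max_rank_def mult_surj_iff)
next
  case False
  have "kdim (V (int p + 1)) + hdim (int p + 1 - 3) \<le> kdim (S (int p + 1)) + kdim (V (int p + 1 - 3))"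
    using triple1 False V_facts(3)[of "int p + 1"] kdim_V[of "int p - 2"] w_3_p1 hdim_3(1) by simp
  then show ?thesis unfolding max_rank_def mult_inj_iff
    by (intro disjI1 ballI impI) (rule injective_if_kdim[OF finite_lessThan pwr_homR L3])
qed

text \<open>Here the two exponents at most p + 1 add up to p + 2, so the Koszul relation of the two
  forms is a syzygy in exactly this degree. This is where the bound N \<ge> 4 in the theorem comes
  from.\<close>

lemma koszul:
  assumes "N = 2" "n2 = 0" "\<delta> = 1" shows "kdim (V (int p + 2)) < w (int p + 2)"
proof (rule ccontr)
  assume "\<not> ?thesis"
  then have ge: "kdim (V (int p + 2)) \<ge> (\<Sum>i\<in>{..<s}. hdim (int p + 2 - int (a i)))" by (simp add: w_def)
  obtain i k where ik: "{i. i < s \<and> a i \<le> p + 1} = {i, k}" "i \<noteq> k"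
    using assms(1) unfolding N_def card_2_iff by blast
  then have iks: "i < s" "k < s" "a i \<le> p + 1" "a k \<le> p + 1" by auto
  have "(\<Sum>i<s. p + 2 - a i) = (\<Sum>i\<in>{i, k}. p + 2 - a i)"
  proof (rule sum.mono_neutral_right)
    show "\<forall>j\<in>{..<s} - {i, k}. p + 2 - a j = 0" using ik(1) by force
  qed (use iks in auto)
  then have "(p + 2 - a i) + (p + 2 - a k) = p + 2"
    using ik(2) slack_1 slack_0 assms by simp
  then have aa: "a i + a k = p + 2" using iks by linarith
  note triv = syzygy_trivial_if_kdim[OF finite_lessThan ge]
  let ?G = "pwr C a"
  let ?g = "\<lambda>l. if l = i then ?G k else if l = k then - ?G i else 0"
  have deg: "int p + 2 - int (a i) = int (a k)" "int p + 2 - int (a k) = int (a i)" using aa by linarith+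
  have "- ?G i = 0"
  proof -
    have "?g k = 0"
    proof (rule triv[where g = ?g])
      have "?G k \<in> homR (int p + 2 - int (a i))" "- ?G i \<in> homR (int p + 2 - int (a k))"
        unfolding deg by (rule pwr_homR neg_homR)+
      then show "?g l \<in> homR (int p + 2 - int (a l))" for l
        by (simp add: zero_homR)
      have "(\<Sum>l<s. ?G l * ?g l) = (\<Sum>l\<in>{i, k}. ?G l * ?g l)"
        by (rule sum.mono_neutral_right) (use iks in auto)
      also have "\<dots> = 0" using ik(2) by (simp add: mult.commute)
      finally show "(\<Sum>l<s. ?G l * ?g l) = 0" .
      show "k \<in> {..<s}" using iks by simp
    qed
    then show ?thesis using ik(2) by simp
  qed
  then have Gi: "?G i = 0" by simp
  \<comment> \<open>Absence of syzygies has forced the generator to be zero; but then any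
    coefficient whatsoever is a syzygy.\<close>
  let ?h = "\<lambda>l. if l = i then var 0 ^ a k else (0 :: 'k mpoly)"
  have "?h i = 0"
  proof (rule triv[where g = ?h])
    have "(var 0 ^ a k :: 'k mpoly) \<in> homR (int p + 2 - int (a i))"
      unfolding deg by (rule var_power_homR) simp
    then show "?h l \<in> homR (int p + 2 - int (a l))" for l
      by (simp add: zero_homR)
    show "(\<Sum>l<s. ?G l * ?h l) = 0" using Gi by (intro sum.neutral) auto
    show "i \<in> {..<s}" using iks by simp
  qed
  moreover have "var 0 ^ a k \<noteq> (0 :: 'k mpoly)"
    unfolding var_power by (metis lookup_single_eq lookup_zero zero_neq_one)
  ultimately show False by simp
qed

text \<open>A positive cokernel bound requires N = \<delta> + 1 even and n2 = 0, so outside the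
  critical case only N = 2 remains. There the syzygy enlarges [R/I]_(p+2) by one, which makes room
  for the cokernel and leaves L^3 injective.\<close>

lemma max_rank_p2:
  assumes "\<not> (N = \<delta> + 1 \<and> N \<ge> 4 \<and> even N \<and> n2 = 0)"
  shows "max_rank s (pwr C a) a (L ^ 3) 3 (int p + 2)"
proof (cases "excess (\<delta> + 1) N - n2 = 0")
  case True
  then have "hdim (int p + 2) \<le> kdim (S (int p + 2))" using triple2 by simp
  then show ?thesis using full_if_kdim[OF S_facts] by (simp add: max_rank_def mult_surj_iff)
next
  case False
  then have *: "N = \<delta> + 1" "even N" "n2 = 0" "excess (\<delta> + 1) N = 1"
    using N_ge unfolding excess_def by (auto split: if_splits)
  have "N \<ge> 2" "N < 4" using * assms slack_0(2) by auto
  moreover obtain k where "N = 2 * k" using *(2) by (elim evenE)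
  ultimately have "N = 2" by simp
  then have "kdim (V (int p + 2)) < w (int p + 2)" using koszul * by simp
  then have "kdim (V (int p + 2)) + hdim (int p + 2 - 3) \<le> kdim (S (int p + 2)) + kdim (V (int p + 2 - 3))"
    using triple2 * kdim_V[of "int p - 1"] w_3_critical hdim_3(2) by simp
  then show ?thesis unfolding max_rank_def mult_inj_iff
    by (intro disjI1 ballI impI) (rule injective_if_kdim[OF finite_lessThan pwr_homR L3])
qed

text \<open>The exponents up to p + 1 give n i = p + 2 - a i with sum p + 2, the numerical setting
  of the double curve; larger exponents exceed p + 2 because n2 = 0.\<close>

lemma not_full_critical:
  assumes "N = \<delta> + 1" "even N" "n2 = 0"
  shows "\<not> homR (int p + 2) \<subseteq> S (int p + 2)"
proof -
  let ?b = "a(s := 3)" and ?X = "{i. i < s \<and> a i \<le> p + 1}"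
  obtain e where e: "N = 2 * e" using assms(2) by (elim evenE)
  have "(\<Sum>i<s. p + 2 - a i) = (\<Sum>i\<in>?X. p + 2 - a i)"
    by (rule sum.mono_neutral_right) auto
  then have d: "p + 2 = (\<Sum>i\<in>?X. p + 2 - a i)" using slack_1 slack_0 assms by simp
  have n2: "a i \<noteq> p + 2" if "i < s" for i using assms(3) that unfolding n2_def by auto
  have "\<not> homR (int (p + 2)) \<subseteq> psum {..s} (pwr C ?b) ?b (int (p + 2))"
  proof (rule double_curve_not_full[where X = ?X and q = s and e = e and n = "\<lambda>i. p + 2 - a i"])
    show "card ?X = 2 * e" using e N_def by simp
    show "e \<ge> 1" using e assms(1) by simp
    show "p + 2 = (\<Sum>i\<in>?X. p + 2 - a i)" by (rule d)
    show "i \<in> ?X \<or> i = s \<or> ?b i > p + 2" if "i \<in> {..s}" for i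
      using that n2[of i] by (cases "a i \<le> p + 1") auto
  qed auto
  then have "\<not> homR (int (p + 2)) \<subseteq> S (int (p + 2))" unfolding psum_atMost_line by simp
  then show ?thesis by (simp add: add.commute)
qed

text \<open>Source and target have equal dimension, so a cokernel of dimension 1 excludes
  injectivity as well. The equality rests on \<open>critical\<close>: the cokernel bound alone would
  leave the dimension of I_(p+2) uncertain by one.\<close>

lemma critical_case:
  assumes c: "N = \<delta> + 1" "N \<ge> 4" "even N" "n2 = 0"
  shows "\<not> max_rank s (pwr C a) a (L ^ 3) 3 (int p + 2)"
    "quotdim s (pwr C a) a (int p - 1) = quotdim s (pwr C a) a (int p + 2)"
    "coker_dim s (pwr C a) a (L ^ 3) 3 (int p + 2) = 1"
proof -
  have V2: "kdim (V (int p + 2)) = w (int p + 2)" using critical[OF c] V_facts(3)[of "int p + 2"] by simp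
  have V1: "kdim (V (int p - 1)) = w (int p - 1)" by (rule kdim_V) simp
  have nS: "\<not> homR (int p + 2) \<subseteq> S (int p + 2)" by (rule not_full_critical[OF c(1,3,4)])
  then have "kdim (S (int p + 2)) < hdim (int p + 2)"
    using full_if_kdim[OF S_facts, of "int p + 2"] by (metis not_less order_refl)
  then have kS: "kdim (S (int p + 2)) + 1 = hdim (int p + 2)"
    using triple2 c by (simp add: excess_def)
  then show "coker_dim s (pwr C a) a (L ^ 3) 3 (int p + 2) = 1"
    by (simp add: coker_dim_def image_plus_ideal_def idealdeg_psum kdim_homR flip: sumF_def)
  show "quotdim s (pwr C a) a (int p - 1) = quotdim s (pwr C a) a (int p + 2)"
    using V1 V2 w_3_critical[OF c(1,4)] hdim_3(2) by (simp add: quotdim_def idealdeg_psum kdim_homR)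
  have "\<not> mult_inj s (pwr C a) a (L ^ 3) 3 (int p + 2)"
  proof
    assume "mult_inj s (pwr C a) a (L ^ 3) 3 (int p + 2)"
    then have "kdim (V (int p + 2)) + kdim (homR (int p + 2 - 3) :: 'k mpoly set) \<le> kdim (S (int p + 2)) + kdim (V (int p + 2 - 3))"
      unfolding mult_inj_iff by (intro kdim_sumF_ge V_facts subspace_homR findim_homR) blast
    then show False using V1 V2 kS w_3_critical[OF c(1,4)] hdim_3(2) by (simp add: kdim_homR)
  qed
  then show "\<not> max_rank s (pwr C a) a (L ^ 3) 3 (int p + 2)"
    using nS by (simp add: max_rank_def mult_surj_iff)
qed

lemma max_rank_other: assumes "j \<noteq> int p + 2" shows "max_rank s (pwr C a) a (L ^ 3) 3 j"
proof -
  consider "j \<le> int p" | "j = int p + 1" | "j \<ge> int p + 3" using assms by linarith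
  then show ?thesis using injective_low max_rank_p1 surjective_high by cases (auto simp: max_rank_def)
qed

end

subsection \<open>Generic bounds\<close>

lemma general_coker_line:
  "general (3 * s + 3) (\<lambda>t :: nat \<Rightarrow> 'k::field_char_0.
     hdim (int j) \<le> kdim (sumF (psum {..<s} (pwr (cfg t) a) a (int j)) (linform (cfg t s)) (homR (int j - 1)))
        + (j + 1 - (\<Sum>i<s. j + 1 - a i)))"
proof -
  let ?b = "a(s := 1)" and ?r = "hdim (int j) - (j + 1 - (\<Sum>i<s. j + 1 - a i))"
  define C :: "nat \<Rightarrow> nat \<Rightarrow> 'k" where
    "C = (\<lambda>i. if i = s then zvec else (\<lambda>k. if k = 0 then 1 else if k = 1 then of_nat i else 0))"
  have "hdim (int j) \<le> kdim (psum (insert s {..<s}) (pwr C ?b) ?b (int j)) + (j + 1 - (\<Sum>i\<in>{..<s}. j + 1 - ?b i))"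
    by (rule coker_line_bound) (auto simp: C_def)
  moreover have "(\<Sum>i\<in>{..<s}. j + 1 - ?b i) = (\<Sum>i<s. j + 1 - a i)" by (rule sum.cong) auto
  moreover have "insert s {..<s} = {..s}" by auto
  ultimately have "?r \<le> kdim (psum {..s} (pwr C ?b) ?b (int j))" by simp
  then have "general (3 * s + 3) (\<lambda>t :: nat \<Rightarrow> 'k. ?r \<le> kdim (psum {..s} (pwr (cfg t) ?b) ?b (int j)))"
    by (intro general_kdim_psum) auto
  then show ?thesis
    unfolding psum_atMost_line by (rule general_mono) simp
qed

text \<open>Exponents below j are specialized to the two sections, exponents equal to j are added as
  further powers that each lower a nonzero codimension by one, and larger exponents contribute
  nothing in degree j.\<close>

lemma general_coker_triple:
  assumes d: "d + (\<Sum>i\<in>{i. i < s \<and> a i < j}. j - 1 - a i) = j"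
  shows "general (3 * s + 3) (\<lambda>t :: nat \<Rightarrow> 'k::field_char_0.
     hdim (int j) \<le> kdim (sumF (psum {..<s} (pwr (cfg t) a) a (int j)) (linform (cfg t s) ^ 3) (homR (int j - 3)))
        + (excess d (card {i. i < s \<and> a i < j}) - card {i. i < s \<and> a i = j}))"
proof -
  let ?X = "{i. i < s \<and> a i < j}" and ?Y = "{i. i < s \<and> a i = j}" and ?b = "a(s := 3)"
  let ?r = "hdim (int j) - (excess d (card ?X) - card ?Y)"
  have "(\<Sum>i\<in>?X. j - 1 - ?b i) = (\<Sum>i\<in>?X. j - 1 - a i)" by (rule sum.cong) auto
  then have d': "d + (\<Sum>i\<in>?X. j - 1 - ?b i) = j" using d by simp
  have fX: "finite ?X" "finite ?Y" "s \<notin> ?X" by auto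
  obtain C :: "nat \<Rightarrow> nat \<Rightarrow> 'k" where
    C: "hdim (int j) \<le> kdim (psum (insert s ?X) (pwr C ?b) ?b (int j)) + excess d (card ?X)"
  proof -
    have "?b s = 3" "\<And>i. i \<in> ?X \<Longrightarrow> ?b i < j" by auto
    from exists_triple_config[where 'k = 'k, OF fX(1,3) this d'] show ?thesis using that by blast
  qed
  obtain D :: "nat \<Rightarrow> nat \<Rightarrow> 'k" where
    D: "min (hdim (int j)) (kdim (psum (insert s ?X) (pwr C ?b) ?b (int j)) + card ?Y) \<le> kdim (psum (insert s ?X \<union> ?Y) (pwr D ?b) ?b (int j))"
    using exists_general_powers[of "insert s ?X" ?Y ?b j C] fX by auto
  have "psum (insert s ?X \<union> ?Y) (pwr D ?b) ?b (int j) \<subseteq> psum {..s} (pwr D ?b) ?b (int j)"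
    by (rule psum_mono) auto
  then have "kdim (psum (insert s ?X \<union> ?Y) (pwr D ?b) ?b (int j)) \<le> kdim (psum {..s} (pwr D ?b) ?b (int j))"
    by (rule kdim_mono[OF _ findim_psum]) simp
  then have "?r \<le> kdim (psum {..s} (pwr D ?b) ?b (int j))" using C D by linarith
  then have "general (3 * s + 3) (\<lambda>t :: nat \<Rightarrow> 'k. ?r \<le> kdim (psum {..s} (pwr (cfg t) ?b) ?b (int j)))"
    by (intro general_kdim_psum) auto
  then show ?thesis
    unfolding psum_atMost_line by (rule general_mono) simp
qed

context exponents
begin

lemma general_critical:
  assumes c: "N = \<delta> + 1" "N \<ge> 4" "even N" "n2 = 0"
  shows "general (3 * s + 3) (\<lambda>t :: nat \<Rightarrow> 'k::field_char_0. w (int p + 2) \<le> kdim (psum {..<s} (pwr (cfg t) a) a (int p + 2)))"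
proof -
  let ?X = "{i. i < s \<and> a i \<le> p + 1}"
  have "(\<Sum>i<s. p + 2 - a i) = (\<Sum>i\<in>?X. p + 2 - a i)"
    by (rule sum.mono_neutral_right) auto
  then have d: "p + 2 = (\<Sum>i\<in>?X. p + 2 - a i)" using slack_1 slack_0 c by simp
  have "\<exists>C :: nat \<Rightarrow> nat \<Rightarrow> 'k. (\<Sum>i\<in>?X. hdim (int (p + 2 - a i))) \<le> kdim (psum ?X (pwr C a) a (int (p + 2)))"
    by (rule exists_no_syzygy_config[OF _ _ _ _ d]) (use c in \<open>auto simp: N_def\<close>)
  then obtain C :: "nat \<Rightarrow> nat \<Rightarrow> 'k" where
    C: "(\<Sum>i\<in>?X. hdim (int (p + 2 - a i))) \<le> kdim (psum ?X (pwr C a) a (int (p + 2)))" by blast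
  have "w (int (p + 2)) = (\<Sum>i\<in>?X. hdim (int (p + 2 - a i)))"
    unfolding w_def
  proof (rule sum.mono_neutral_cong_right)
    have n2: "a i \<noteq> p + 2" if "i < s" for i using c(4) that unfolding n2_def by auto
    show "\<forall>i\<in>{..<s} - ?X. hdim (int (p + 2) - int (a i)) = 0"
    proof
      fix i assume "i \<in> {..<s} - ?X"
      then have "int (p + 2) - int (a i) < 0" using n2[of i] by auto
      then show "hdim (int (p + 2) - int (a i)) = 0" by (rule hdim_neg)
    qed
  qed (auto simp: of_nat_diff)
  moreover have "kdim (psum ?X (pwr C a) a (int (p + 2))) \<le> kdim (psum {..<s} (pwr C a) a (int (p + 2)))"
    by (rule kdim_mono[OF psum_mono findim_psum]) auto
  ultimately have "w (int (p + 2)) \<le> kdim (psum {..<s} (pwr C a) a (int (p + 2)))" using C by simp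
  then have "general (3 * s + 3) (\<lambda>t :: nat \<Rightarrow> 'k. w (int (p + 2)) \<le> kdim (psum {..<s} (pwr (cfg t) a) a (int (p + 2))))"
    by (intro general_kdim_psum) auto
  then show ?thesis by (simp add: add.commute)
qed

lemma general_configuration:
  "general (3 * s + 3) (\<lambda>t :: nat \<Rightarrow> 'k::field_char_0. general_configuration s a p (cfg t))"
proof -
  let ?V = "\<lambda>t :: nat \<Rightarrow> 'k. psum {..<s} (pwr (cfg t) a) a"
  have g1: "general (3 * s + 3) (\<lambda>t :: nat \<Rightarrow> 'k. \<forall>j\<in>{..p + 1}.
     hdim (int j) \<le> kdim (sumF (?V t (int j)) (linform (cfg t s)) (homR (int j - 1)))
        + (j + 1 - (\<Sum>i<s. j + 1 - a i)))"
    by (rule general_ball, rule finite_atMost, rule general_coker_line)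
  have g2: "general (3 * s + 3) (\<lambda>t :: nat \<Rightarrow> 'k.
     hdim (int p + 1) \<le> kdim (sumF (?V t (int p + 1)) (linform (cfg t s) ^ 3) (homR (int p - 2))) + (3 * \<delta> - n1))"
  proof -
    have X: "{i. i < s \<and> a i < p + 1} = {i. i < s \<and> a i \<le> p}" by auto
    have "(\<Sum>i\<in>{i. i < s \<and> a i \<le> p}. p - a i) = (\<Sum>i<s. p - a i)"
      by (rule sum.mono_neutral_left) auto
    \<comment> \<open>Residual degree \<delta> + nA against nA double points: the excess is 3
      \<delta>.\<close>
    then have "(\<delta> + nA) + (\<Sum>i\<in>{i. i < s \<and> a i < p + 1}. p + 1 - 1 - a i) = p + 1"
      unfolding X using slack_m1 slack_0(1) by simp
    from general_coker_triple[where 'k = 'k, OF this]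
    show ?thesis
      using slack_0(2) unfolding X nA_def[symmetric] n1_def[symmetric] by (simp add: excess_def add.commute[of 1 "int p"])
  qed
  have g3: "general (3 * s + 3) (\<lambda>t :: nat \<Rightarrow> 'k.
     hdim (int p + 2) \<le> kdim (sumF (?V t (int p + 2)) (linform (cfg t s) ^ 3) (homR (int p - 1))) + (excess (\<delta> + 1) N - n2))"
  proof -
    have X: "{i. i < s \<and> a i < p + 2} = {i. i < s \<and> a i \<le> p + 1}" by auto
    have "(\<Sum>i\<in>{i. i < s \<and> a i \<le> p + 1}. p + 1 - a i) = (\<Sum>i<s. p + 1 - a i)"
      by (rule sum.mono_neutral_left) auto
    \<comment> \<open>Residual degree \<delta> + 1 against N double points. As N \<ge> \<delta> + 1,
      the excess is 1 exactly when N = \<delta> + 1 is even, and 0 otherwise.\<close>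
    then have "(\<delta> + 1) + (\<Sum>i\<in>{i. i < s \<and> a i < p + 2}. p + 2 - 1 - a i) = p + 2"
      unfolding X using slack_0(1) by simp
    from general_coker_triple[where 'k = 'k, OF this]
    show ?thesis
      unfolding X N_def[symmetric] n2_def[symmetric] by (simp add: add.commute[of 2 "int p"])
  qed
  have g4: "general (3 * s + 3) (\<lambda>t :: nat \<Rightarrow> 'k. N = \<delta> + 1 \<longrightarrow> N \<ge> 4 \<longrightarrow> even N \<longrightarrow> n2 = 0 \<longrightarrow>
     w (int p + 2) \<le> kdim (?V t (int p + 2)))"
  proof (cases "N = \<delta> + 1 \<and> N \<ge> 4 \<and> even N \<and> n2 = 0")
    case True
    then have "general (3 * s + 3) (\<lambda>t :: nat \<Rightarrow> 'k. w (int p + 2) \<le> kdim (?V t (int p + 2)))"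
      by (intro general_critical) auto
    then show ?thesis by (rule general_mono) blast
  next
    case False
    then show ?thesis by (intro general_mono[OF general_True]) blast
  qed
  show ?thesis
    by (rule general_mono[OF general_conj[OF general_conj[OF g1 g2] general_conj[OF g3 g4]]], unfold_locales) auto
qed

end

theorem theorem6p3:
  fixes s :: nat and a :: "nat \<Rightarrow> nat"
  assumes "s \<ge> 3" and "\<forall>i<s. a i > 0"
  defines "p \<equiv> pnum s a"
  defines "N \<equiv> card {i. i < s \<and> a i \<le> p + 1}"
  defines "Cond \<equiv> (int N = int (p + 2) - int (\<Sum>i\<in>{i. i < s \<and> a i \<le> p}. (p + 1 - a i))
                  \<and> N \<ge> 4 \<and> even N \<and> (\<forall>i<s. a i \<noteq> p + 2))"
  shows "general (3 * s + 3) (\<lambda>t :: nat \<Rightarrow> 'k::field_char_0.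
           let G = (\<lambda>i. linform (\<lambda>k. t (3 * i + k)) ^ a i);
               L = linform (\<lambda>k. t (3 * s + k))
           in ((\<exists>j::int. \<not> max_rank s G a (L ^ 3) 3 j) \<longleftrightarrow> Cond)
              \<and> (Cond \<longrightarrow>
                   (\<forall>j::int. \<not> max_rank s G a (L ^ 3) 3 j \<longleftrightarrow> j = int p + 2)
                 \<and> quotdim s G a (int p - 1) = quotdim s G a (int p + 2)
                 \<and> coker_dim s G a (L ^ 3) 3 (int p + 2) = 1))"
proof -
  note defs = N_def Cond_def
  have s2: "s \<ge> 2" using assms(1) by simp
  interpret exponents s a p
    by unfold_locales
      (use pnum_properties(1)[OF s2 assms(2)] pnum_properties(2)[OF s2 assms(2), of "p + 1"] in \<open>auto simp: p_def\<close>)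
  have N: "N = exponents.N s a p" unfolding defs(1) exponents.N_def[OF exponents_axioms] ..
  have "n2 = 0 \<longleftrightarrow> (\<forall>i<s. a i \<noteq> p + 2)" by (auto simp: n2_def)
  moreover have "int N = int (p + 2) - int (\<Sum>i\<in>{i. i < s \<and> a i \<le> p}. (p + 1 - a i)) \<longleftrightarrow> N = \<delta> + 1"
    unfolding sum_slack_restrict using slack_0(1) by linarith
  ultimately have Cond: "Cond \<longleftrightarrow> (exponents.N s a p = \<delta> + 1 \<and> exponents.N s a p \<ge> 4 \<and> even (exponents.N s a p) \<and> n2 = 0)"
    unfolding defs(2) N by blast
  show ?thesis
  proof (rule general_mono[OF general_configuration])
    fix t :: "nat \<Rightarrow> 'k"
    assume "general_configuration s a p (cfg t)"
    then interpret c: general_configuration s a p "cfg t" .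
    have G: "(\<lambda>i. linform (\<lambda>k. t (3 * i + k)) ^ a i) = pwr (cfg t) a"
      by (rule ext) (simp add: pwr_def cfg_def[abs_def])
    have L: "linform (\<lambda>k. t (3 * s + k)) = linform (cfg t s)"
      by (simp add: cfg_def[abs_def])
    let ?m = "max_rank s (pwr (cfg t) a) a (linform (cfg t s) ^ 3) 3"
    have "?m j" if "\<not> Cond" for j
      using that c.max_rank_p2 c.max_rank_other unfolding Cond by (cases "j = int p + 2") auto
    moreover have "\<not> ?m (int p + 2)" "quotdim s (pwr (cfg t) a) a (int p - 1) = quotdim s (pwr (cfg t) a) a (int p + 2)"
      "coker_dim s (pwr (cfg t) a) a (linform (cfg t s) ^ 3) 3 (int p + 2) = 1" if Cond
      using that c.critical_case unfolding Cond by auto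
    ultimately show "let G = (\<lambda>i. linform (\<lambda>k. t (3 * i + k)) ^ a i);
               L = linform (\<lambda>k. t (3 * s + k))
           in ((\<exists>j::int. \<not> max_rank s G a (L ^ 3) 3 j) \<longleftrightarrow> Cond)
              \<and> (Cond \<longrightarrow>
                   (\<forall>j::int. \<not> max_rank s G a (L ^ 3) 3 j \<longleftrightarrow> j = int p + 2)
                 \<and> quotdim s G a (int p - 1) = quotdim s G a (int p + 2)
                 \<and> coker_dim s G a (L ^ 3) 3 (int p + 2) = 1)"
      unfolding G L Let_def using c.max_rank_other by blast
  qed
qed

end
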